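(* Let $(\xi_t)_{t\ge0}$ be the Glauber dynamics on $\Omega$ at inverse temperature $\beta$, and let $\mathscr C^\star$ be the critical set. Then: (a) $\lim_{\beta\to\infty}\mathbb P_{\boxminus}\left(\tau_{\mathscr C^\star}<\tau_{\boxplus}\,\middle|\,\tau_{\boxplus}<\tau_{\boxminus}\right)=1$; (b) $\lim_{\beta\to\infty}\mathbb P_{\boxminus}\left(\xi_{\tau_{\mathscr C^\star}}=x\right)=1/|\mathscr C^\star|$ for all $x\in\mathscr C^\star$.
   Context: $\mathcal Q_n=(V_n,E_n)$ is the $n$-dimensional hypercube graph: $V_n=\{0,1\}^n$, with edges (unoriented) between vertices $v,w$ with $\|v-w\|_1=1$. The configuration space is $\Omega=\{+1,-1\}^{V_n}$, identified with the power set $\mathcal P(V_n)$: a set $A\subseteq V_n$ stands for the configuration that is $+1$ on $A$ and $-1$ on $\overline A=V_n\setminus A$. Write $\boxplus=V_n$ and $\boxminus=\emptyset$. For $U,W\subseteq V_n$, $E(U,W)$ is the set of unoriented edges with one endpoint in $U$ and the other in $W$. The Hamiltonian (interaction parameter equal to $1$) is $$\mathcal H(A)=-\tfrac12\left(|E_n|-2|E(A,\overline A)|\right)-\tfrac{\mathfrak h}{2}\left(|A|-|\overline A|\right).$$ Standing assumption: $0<\mathfrak h<n$ and $\mathfrak h$ is not of the form $a/b$ with $a\in\mathbb N$ and $b\in\{1,2,\ldots,2^n\}$. For $\beta\ge 0$ the Glauber dynamics $(\xi_t)_{t\ge0}$ is the continuous-time Markov process on $\Omega$ with transition rates $c_\beta(\xi,\xi')=\exp(-\beta[\mathcal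 H(\xi')-\mathcal H(\xi)]_+)$ if $|\xi\triangle\xi'|=1$, and $0$ for other pairs $\xi\neq\xi'$, where $[x]_+=\max\{0,x\}$. $\mathbb P_{\boxminus}$ is its law when started at $\boxminus$. For $\mathcal A\subseteq\Omega$, $\tau_{\mathcal A}=\inf\{t>0:\xi_t\in\mathcal A,\ \exists\,0<s<t:\xi_s\ne\xi_0\}$ is the first hitting time of $\mathcal A$ once the starting configuration has been vacated; $\tau_x=\tau_{\{x\}}$ for a single configuration $x$. Write $\xi\sim\xi'$ if $|\xi\triangle\xi'|=1$. A path $\gamma:\xi\to\xi'$ is a finite sequence of configurations from $\xi$ to $\xi'$ with consecutive elements related by $\sim$. The communication height is $\Phi(\xi,\xi')=\min_{\gamma:\xi\to\xi'}\max_{\sigma\in\gamma}\mathcal H(\sigma)$, and $\Gamma^\star=\Phi(\boxminus,\boxplus)-\mathcal H(\boxminus)$. The critical set $\mathscr C^\star$ and proto-critical set $\mathscr P^\star$ are defined by letting $\mathscr C^\star\times\mathscr P^\star\subseteq\Omega^2$ be the unique maximal such subset satisfying: 1. for every $\xi\in\mathscr P^\star$ there is $\xi'\in\mathscr C^\star$ with $\xi\sim\xi'$, and for every $\xi\in\mathscr C^\star$ there is $\xi'\in\mathscr P^\star$ with $\xi\sim\xi'$; 2. for every $\xi\in\mathscr P^\star$, $\Phi(\xi,\boxminus)<\Phi(\xi,\boxplus)$; 3. for every $\xi\in\mathscr C^\star$ there is a path $\gamma:\xi\to\boxplus$ with $\max_{\zeta\in\gamma}\mathcal H(\zeta)-\mathcal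 H(\boxminus)\le\Gamma^\star$ and $\gamma\cap\{\zeta\in\Omega:\Phi(\zeta,\boxminus)<\Phi(\zeta,\boxplus)\}=\emptyset$. *)

theory Defs
  imports "HOL-Probability.Probability"
begin

section \<open>The hypercube and the Hamiltonian\<close>

type_synonym vertex = "nat \<Rightarrow> int"
type_synonym config = "vertex set"

definition V :: "nat \<Rightarrow> vertex set" where
  "V n = ({..<n} \<rightarrow>\<^sub>E {0, 1})"

definition E :: "nat \<Rightarrow> vertex set set" where
  "E n = {{v, w} | v w. v \<in> V n \<and> w \<in> V n \<and> (\<Sum>i<n. \<bar>v i - w i\<bar>) = 1}"

definition edges_between :: "nat \<Rightarrow> vertex set \<Rightarrow> vertex set \<Rightarrow> vertex set set" where
  "edges_between n U W = {e \<in> E n. \<exists>u\<in>U. \<exists>w\<in>W. e = {u, w}}"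

text \<open>A set \<open>A \<subseteq> V n\<close> is the spin configuration that is \<open>+1\<close> on \<open>A\<close> and \<open>-1\<close> on \<open>V n - A\<close>;
  all-minus is the empty set and all-plus is \<open>V n\<close>.\<close>

definition Conf :: "nat \<Rightarrow> config set" where
  "Conf n = Pow (V n)"

definition energy :: "nat \<Rightarrow> real \<Rightarrow> config \<Rightarrow> real" where
  "energy n h A =
     - (1/2) * (real (card (E n)) - 2 * real (card (edges_between n A (V n - A))))
     - (h/2) * (real (card A) - real (card (V n - A)))"

definition admissible_field :: "nat \<Rightarrow> real \<Rightarrow> bool" where
  "admissible_field n h \<longleftrightarrow>
     0 < h \<and> h < real n \<and> \<not> (\<exists>a b :: nat. b \<in> {1..2 ^ n} \<and> h = real a / real b)"

definition flip :: "config \<Rightarrow> config \<Rightarrow> bool" where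
  "flip \<xi> \<xi>' \<longleftrightarrow> card ((\<xi> - \<xi>') \<union> (\<xi>' - \<xi>)) = 1"

section \<open>Communication height and the critical set\<close>

definition is_path :: "nat \<Rightarrow> config list \<Rightarrow> config \<Rightarrow> config \<Rightarrow> bool" where
  "is_path n \<gamma> \<xi> \<xi>' \<longleftrightarrow>
     \<gamma> \<noteq> [] \<and> hd \<gamma> = \<xi> \<and> last \<gamma> = \<xi>' \<and> set \<gamma> \<subseteq> Conf n \<and> successively flip \<gamma>"

definition comm_height :: "nat \<Rightarrow> real \<Rightarrow> config \<Rightarrow> config \<Rightarrow> real" where
  "comm_height n h \<xi> \<xi>' = Min {Max (energy n h ` set \<gamma>) | \<gamma>. is_path n \<gamma> \<xi> \<xi>'}"

definition Gamma_star :: "nat \<Rightarrow> real \<Rightarrow> real" where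
  "Gamma_star n h = comm_height n h {} (V n) - energy n h {}"

definition minus_valley :: "nat \<Rightarrow> real \<Rightarrow> config set" where
  "minus_valley n h = {\<zeta> \<in> Conf n. comm_height n h \<zeta> {} < comm_height n h \<zeta> (V n)}"

definition critical_conditions :: "nat \<Rightarrow> real \<Rightarrow> config set \<Rightarrow> config set \<Rightarrow> bool" where
  "critical_conditions n h C P \<longleftrightarrow>
     C \<subseteq> Conf n \<and> P \<subseteq> Conf n \<and>
     (\<forall>\<xi>\<in>P. \<exists>\<xi>'\<in>C. flip \<xi> \<xi>') \<and> (\<forall>\<xi>\<in>C. \<exists>\<xi>'\<in>P. flip \<xi> \<xi>') \<and>
     (\<forall>\<xi>\<in>P. comm_height n h \<xi> {} < comm_height n h \<xi> (V n)) \<and>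
     (\<forall>\<xi>\<in>C. \<exists>\<gamma>. is_path n \<gamma> \<xi> (V n) \<and>
        Max (energy n h ` set \<gamma>) - energy n h {} \<le> Gamma_star n h \<and>
        set \<gamma> \<inter> minus_valley n h = {})"

definition maximal_critical :: "nat \<Rightarrow> real \<Rightarrow> config set \<Rightarrow> config set \<Rightarrow> bool" where
  "maximal_critical n h C P \<longleftrightarrow>
     critical_conditions n h C P \<and>
     (\<forall>C' P'. critical_conditions n h C' P' \<and> C \<times> P \<subseteq> C' \<times> P' \<longrightarrow> C' \<times> P' = C \<times> P)"

lemma ex1_maximal_critical: "\<exists>!(C, P). maximal_critical n h C P"
proof -
  let ?cc = "critical_conditions n h"
  define C where "C = \<Union>{C. \<exists>P. ?cc C P}"
  define P where "P = \<Union>{P. \<exists>C. ?cc C P}"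
  have upper: "C' \<subseteq> C \<and> P' \<subseteq> P" if "?cc C' P'" for C' P'
    using that unfolding C_def P_def by blast
  have C_E: "\<exists>C' P'. ?cc C' P' \<and> \<xi> \<in> C'" if "\<xi> \<in> C" for \<xi>
    using that unfolding C_def by blast
  have P_E: "\<exists>C' P'. ?cc C' P' \<and> \<xi> \<in> P'" if "\<xi> \<in> P" for \<xi>
    using that unfolding P_def by blast
  have cc: "?cc C P"
    unfolding critical_conditions_def
  proof (intro conjI ballI subsetI)
    fix \<xi> assume "\<xi> \<in> P"
    then obtain C' P' where *: "?cc C' P'" "\<xi> \<in> P'"
      using P_E by blast
    note ** = *(1)[unfolded critical_conditions_def]
    show "\<xi> \<in> Conf n" using ** *(2) by blast
    show "comm_height n h \<xi> {} < comm_height n h \<xi> (V n)" using ** *(2) by blast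
    have "\<exists>\<xi>'\<in>C'. flip \<xi> \<xi>'" using ** *(2) by blast
    then show "\<exists>\<xi>'\<in>C. flip \<xi> \<xi>'" using upper[OF *(1)] by blast
  next
    fix \<xi> assume "\<xi> \<in> C"
    then obtain C' P' where *: "?cc C' P'" "\<xi> \<in> C'"
      using C_E by blast
    note ** = *(1)[unfolded critical_conditions_def]
    show "\<xi> \<in> Conf n" using ** *(2) by blast
    have "\<exists>\<xi>'\<in>P'. flip \<xi> \<xi>'" using ** *(2) by blast
    then show "\<exists>\<xi>'\<in>P. flip \<xi> \<xi>'" using upper[OF *(1)] by blast
    show "\<exists>\<gamma>. is_path n \<gamma> \<xi> (V n) \<and>
        Max (energy n h ` set \<gamma>) - energy n h {} \<le> Gamma_star n h \<and>
        set \<gamma> \<inter> minus_valley n h = {}"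
      using ** *(2) by (elim conjE) (erule (1) bspec)
  qed
  have max: "maximal_critical n h C P"
    unfolding maximal_critical_def
  proof (intro conjI allI impI)
    fix C' P' assume "?cc C' P' \<and> C \<times> P \<subseteq> C' \<times> P'"
    moreover from this have "C' \<times> P' \<subseteq> C \<times> P"
      using upper[of C' P'] by (intro Sigma_mono) auto
    ultimately show "C' \<times> P' = C \<times> P" by simp
  qed (fact cc)
  have empty_iff: "A = {} \<longleftrightarrow> B = {}" if "?cc A B" for A B
  proof -
    have "\<forall>\<xi>\<in>B. \<exists>\<xi>'\<in>A. flip \<xi> \<xi>'" "\<forall>\<xi>\<in>A. \<exists>\<xi>'\<in>B. flip \<xi> \<xi>'"
      using that unfolding critical_conditions_def by simp_all
    then show ?thesis by blast
  qed
  have uniq: "C' = C \<and> P' = P" if "maximal_critical n h C' P'" for C' P'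
  proof -
    have cc': "?cc C' P'" using that by (simp add: maximal_critical_def)
    then have "C' \<times> P' \<subseteq> C \<times> P" using upper[OF cc'] by (intro Sigma_mono) auto
    with that cc have eq: "C \<times> P = C' \<times> P'" unfolding maximal_critical_def by simp
    show ?thesis
      using eq empty_iff[OF cc] empty_iff[OF cc'] unfolding times_eq_iff by (elim disjE conjE) simp_all
  qed
  show ?thesis
  proof (rule ex1I)
    show "case (C, P) of (C, P) \<Rightarrow> maximal_critical n h C P" using max by simp
  next
    fix p assume "case p of (C, P) \<Rightarrow> maximal_critical n h C P"
    then have "maximal_critical n h (fst p) (snd p)" by (simp add: case_prod_beta)
    from uniq[OF this] show "p = (C, P)" by (simp add: prod_eq_iff)
  qed
qed

definition critical_pair :: "nat \<Rightarrow> real \<Rightarrow> config set \<times> config set" where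
  "critical_pair n h = (THE (C, P). maximal_critical n h C P)"

definition critical_set :: "nat \<Rightarrow> real \<Rightarrow> config set" where
  "critical_set n h = fst (critical_pair n h)"

definition protocritical_set :: "nat \<Rightarrow> real \<Rightarrow> config set" where
  "protocritical_set n h = snd (critical_pair n h)"

section \<open>Continuous-time Markov processes with finite state space\<close>

text \<open>\<open>S\<close> is the state space and \<open>c x y\<close> the rate of jumping from \<open>x\<close> to \<open>y \<noteq> x\<close>;
  the diagonal values of \<open>c\<close> are irrelevant.\<close>

definition generator :: "'s set \<Rightarrow> ('s \<Rightarrow> 's \<Rightarrow> real) \<Rightarrow> 's \<Rightarrow> 's \<Rightarrow> real" where
  "generator S c x y = (if x = y then - (\<Sum>z\<in>S - {x}. c x z) else c x y)"

primrec generator_power ::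
  "'s set \<Rightarrow> ('s \<Rightarrow> 's \<Rightarrow> real) \<Rightarrow> nat \<Rightarrow> 's \<Rightarrow> 's \<Rightarrow> real" where
  "generator_power S c 0 x y = (if x = y then 1 else 0)"
| "generator_power S c (Suc k) x y = (\<Sum>z\<in>S. generator S c x z * generator_power S c k z y)"

text \<open>The entries of the matrix exponential of \<open>t\<close> times the generator.\<close>

definition transition_prob ::
  "'s set \<Rightarrow> ('s \<Rightarrow> 's \<Rightarrow> real) \<Rightarrow> real \<Rightarrow> 's \<Rightarrow> 's \<Rightarrow> real" where
  "transition_prob S c t x y = (\<Sum>k. t ^ k / fact k * generator_power S c k x y)"

text \<open>A realisation, on the probability space \<open>M\<close>, of the Markov process with rates \<open>c\<close> started
  at \<open>x0\<close>. Only times \<open>t \<ge> 0\<close> matter. Paths are right-continuous for the discrete topology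
  on \<open>S\<close>. The last clause is the Markov property: given the values at times
  \<open>t 0 < \<dots> < t k\<close>, the law after a further time \<open>s\<close> is \<open>transition_prob S c s (a k)\<close>; it is
  stated in product form so that conditioning on null events does not arise.\<close>

definition markov_process ::
  "'w measure \<Rightarrow> (real \<Rightarrow> 'w \<Rightarrow> 's) \<Rightarrow> 's set \<Rightarrow> ('s \<Rightarrow> 's \<Rightarrow> real) \<Rightarrow> 's \<Rightarrow> bool" where
  "markov_process M X S c x0 \<longleftrightarrow>
     prob_space M \<and>
     (\<forall>t\<ge>0. X t \<in> measurable M (count_space S)) \<and>
     (\<forall>\<omega>\<in>space M. \<forall>t\<ge>0. eventually (\<lambda>s. X s \<omega> = X t \<omega>) (at_right t)) \<and>
     (AE \<omega> in M. X 0 \<omega> = x0) \<and>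
     (\<forall>(t :: nat \<Rightarrow> real) a k s y.
        0 \<le> t 0 \<and> strict_mono_on {..k} t \<and> (\<forall>i\<le>k. a i \<in> S) \<and> 0 \<le> s \<and> y \<in> S \<longrightarrow>
        \<P>(\<omega> in M. (\<forall>i\<le>k. X (t i) \<omega> = a i) \<and> X (t k + s) \<omega> = y) =
        \<P>(\<omega> in M. \<forall>i\<le>k. X (t i) \<omega> = a i) * transition_prob S c s (a k) y)"

text \<open>First hitting time of \<open>A\<close> after the initial state has been vacated
  (\<open>\<infinity>\<close> if there is none).\<close>

definition hitting_time :: "(real \<Rightarrow> 'w \<Rightarrow> 's) \<Rightarrow> 's set \<Rightarrow> 'w \<Rightarrow> ereal" where
  "hitting_time X A \<omega> =
     Inf (ereal ` {t. 0 < t \<and> X t \<omega> \<in> A \<and> (\<exists>s. 0 < s \<and> s < t \<and> X s \<omega> \<noteq> X 0 \<omega>)})"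

section \<open>Glauber dynamics\<close>

definition glauber_rate :: "nat \<Rightarrow> real \<Rightarrow> real \<Rightarrow> config \<Rightarrow> config \<Rightarrow> real" where
  "glauber_rate n h \<beta> \<xi> \<xi>' =
     (if flip \<xi> \<xi>' then exp (- \<beta> * max 0 (energy n h \<xi>' - energy n h \<xi>)) else 0)"

definition glauber_dynamics ::
  "nat \<Rightarrow> real \<Rightarrow> real \<Rightarrow> config \<Rightarrow> 'w measure \<Rightarrow> (real \<Rightarrow> 'w \<Rightarrow> config) \<Rightarrow> bool" where
  "glauber_dynamics n h \<beta> \<xi>0 M X \<longleftrightarrow>
     markov_process M X (Conf n) (glauber_rate n h \<beta>) \<xi>0"

end

theory Submission
  imports Defs
begin

text \<open>Let $H$ be the energy and let the barrier be the least height at which the all-minus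
configuration \<open>{}\<close> can be connected to the all-plus configuration \<open>V n\<close>. Both parts of the theorem
become statements about functions that are harmonic for the generator of the dynamics off some set
\<open>D\<close>: the mean of such a function at the first entrance into \<open>D\<close>, counted after \<open>{}\<close> has been left,
is its average over the first jump out of \<open>{}\<close> (\<open>exit_identity\<close>). The process is given only through
its finite-dimensional laws and the right-continuity of its paths, so this is proved by watching it
along a time grid of mesh $d$. There it is a Markov chain whose kernel is the identity plus $d$
times the generator up to $O(d^2)$; on the order of $1/d$ steps are made before \<open>D\<close> is reached, so the total
error is $O(d)$, and a path right-constant at every time is caught by every fine enough grid.

The uniform entrance law holds exactly, at every inverse temperature, because of symmetry. A
critical configuration has energy equal to the barrier (\<open>critical_energy\<close>). The condition on the
field makes the energy determine the size, so all critical configurations have one common size, and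
comparison with a nested chain of isoperimetric sets shows that they minimise the edge boundary for
that size (\<open>critical_optimal\<close>). Subsets of the hypercube of a given size that minimise the edge
boundary form a single orbit of the automorphism group (\<open>optimal_unique\<close>): the equality case of
Harper's inequality forces such a set to be a subcube together with a smaller minimiser in one
neighbouring subcube. Automorphisms fix \<open>{}\<close> and preserve the rates and the critical set, hence all
entrance points have the same probability.

For the passage through the critical set, a path from \<open>{}\<close> to \<open>V n\<close> that stays at or below the
barrier must meet the critical set: the configuration at which it finally leaves the valley of \<open>{}\<close>
satisfies the defining conditions of a critical configuration (\<open>critical_set_separates\<close>). Therefore
a crossing that avoids the critical set first reaches a configuration above the barrier. The maximum
principle turns this into an inequality between fluxes out of \<open>{}\<close>. By reversibility the flux towards
the configurations above the barrier is at most of the order of their Gibbs weight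
(\<open>flux_upper_bound\<close>), while the flux towards \<open>V n\<close> is at least of the order of the weight of the
barrier (\<open>flux_lower_bound\<close>). The ratio tends to zero.\<close>

section \<open>Superadditivity of the edge counting function\<close>

fun popcount :: "nat \<Rightarrow> nat" where
  "popcount n = (if n = 0 then 0 else n mod 2 + popcount (n div 2))"

declare popcount.simps [simp del]

lemma popcount_power_add: "j < 2 ^ a \<Longrightarrow> popcount (2 ^ a + j) = Suc (popcount j)"
proof (induction a arbitrary: j)
  case 0
  then show ?case by (simp add: popcount.simps)
next
  case (Suc a)
  have "(2 ^ Suc a + j) div 2 = 2 ^ a + j div 2" "(2 ^ Suc a + j) mod 2 = j mod 2" by auto
  moreover have "j div 2 < 2 ^ a" using Suc.prems by (simp add: less_mult_imp_div_less mult.commute)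
  ultimately have "popcount (2 ^ Suc a + j) = j mod 2 + Suc (popcount (j div 2))"
    using Suc.IH by (subst popcount.simps) simp
  then show ?case by (subst (2) popcount.simps) (simp add: popcount.simps[of 0])
qed

text \<open>The number of edges of the hypercube with both ends among the first \<open>k\<close> vertices, listed in
binary order: a new vertex \<open>j\<close> has one earlier neighbour for each binary digit one of \<open>j\<close>.\<close>

definition harper :: "nat \<Rightarrow> nat" where
  "harper k = (\<Sum>j<k. popcount j)"

lemma harper_0 [simp]: "harper 0 = 0" by (simp add: harper_def)

lemma harper_1 [simp]: "harper (Suc 0) = 0" by (simp add: harper_def popcount.simps)

lemma harper_power_add: "m \<le> 2 ^ a \<Longrightarrow> harper (2 ^ a + m) = harper (2 ^ a) + harper m + m"
proof (induction m)
  case (Suc m)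
  then show ?case by (simp add: harper_def popcount_power_add)
qed simp

lemma harper_power_Suc: "harper (2 ^ Suc a) = 2 * harper (2 ^ a) + 2 ^ a"
  using harper_power_add[of "2 ^ a" a] by (simp add: mult_2)

lemma exists_binary_size: "0 < (m :: nat) \<Longrightarrow> \<exists>a. 2 ^ a \<le> m \<and> m < 2 ^ Suc a"
  using ex_power_ivl1[of 2 m] by auto

text \<open>Compare \<open>p\<close> and \<open>q\<close> with the powers of two around their sum. If \<open>p\<close> already contains the
leading power \<open>2 ^ a\<close>, removing it from both sides leaves superadditivity without the extra term,
which is strict for positive \<open>q\<close> unless nothing of \<open>p\<close> is left. If both contain \<open>2 ^ (a - 1)\<close>, removing both leaves
the same inequality for smaller numbers. If only \<open>p\<close> does, a carry occurs and the inequality is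
strict. The second conjunct records which cases admit equality; it drives the uniqueness proof.\<close>

lemma harper_superadd_aux:
  "q \<le> p \<Longrightarrow> harper p + harper q + q \<le> harper (p + q) \<and>
    (\<forall>a. 0 < q \<and> harper p + harper q + q = harper (p + q) \<and> 2 ^ a \<le> p + q \<and> p + q < 2 ^ Suc a
      \<longrightarrow> p = 2 ^ a \<or> p < 2 ^ a \<and> (\<exists>b. a = Suc b \<and> 2 ^ b \<le> q))"
proof (induction "p + q" arbitrary: p q rule: less_induct)
  case less
  have IH: "harper x + harper y + min x y \<le> harper (x + y)" if "x + y < p + q" for x y
  proof (cases "y \<le> x")
    case True
    then show ?thesis using less.hyps[of x y] that by (simp add: min_absorb2)
  next
    case False
    then show ?thesis using less.hyps[of y x] that by (simp add: min_absorb1 add.commute)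
  qed
  show ?case
  proof (cases "q = 0")
    case False
    then obtain a where a: "2 ^ a \<le> p + q" "p + q < 2 ^ Suc a" using exists_binary_size[of "p + q"] by auto
    have uniq: "a' = a" if "2 ^ a' \<le> p + q" "p + q < 2 ^ Suc a'" for a'
    proof -
      have "(2::nat) ^ a' < 2 ^ Suc a" "(2::nat) ^ a < 2 ^ Suc a'" using a that by linarith+
      then have "a' < Suc a" "a < Suc a'" by (auto intro: power_less_imp_less_exp[of "2::nat"] simp del: power_Suc)
      then show ?thesis by simp
    qed
    have "harper p + harper q + q \<le> harper (p + q) \<and>
      (harper p + harper q + q = harper (p + q) \<longrightarrow> p = 2 ^ a \<or> p < 2 ^ a \<and> (\<exists>b. a = Suc b \<and> 2 ^ b \<le> q))"
    proof (cases "2 ^ a \<le> p")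
      case True
      define p' where "p' = p - 2 ^ a"
      have p: "p = 2 ^ a + p'" using True by (simp add: p'_def)
      have lt: "p' + q < 2 ^ a" using a p by simp
      have h: "harper p = harper (2 ^ a) + harper p' + p'"
        unfolding p by (rule harper_power_add) (use lt in simp)
      have "harper (2 ^ a + (p' + q)) = harper (2 ^ a) + harper (p' + q) + (p' + q)"
        by (rule harper_power_add) (use lt in simp)
      then have h2: "harper (p + q) = harper (2 ^ a) + harper (p' + q) + (p' + q)"
        by (simp add: p add.assoc)
      have i: "harper p' + harper q + min p' q \<le> harper (p' + q)" by (rule IH) (use p in simp)
      show ?thesis
      proof (intro conjI impI)
        show "harper p + harper q + q \<le> harper (p + q)" using h h2 i by linarith
        assume "harper p + harper q + q = harper (p + q)"
        then have "min p' q = 0" using h h2 i by linarith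
        then show "p = 2 ^ a \<or> p < 2 ^ a \<and> (\<exists>b. a = Suc b \<and> 2 ^ b \<le> q)"
          using False p by (auto simp: min_def split: if_splits)
      qed
    next
      case p_lt: False
      have "a \<noteq> 0" using a False less.prems by (cases a) auto
      then obtain b where b: "a = Suc b" using not0_implies_Suc by blast
      have "2 ^ b \<le> p" using a(1) less.prems b by simp
      define p' where "p' = p - 2 ^ b"
      have p: "p = 2 ^ b + p'" using \<open>2 ^ b \<le> p\<close> by (simp add: p'_def)
      have p'_lt: "p' < 2 ^ b" using p_lt b p by simp
      have hp: "harper p = harper (2 ^ b) + harper p' + p'"
        unfolding p by (rule harper_power_add) (use p'_lt in simp)
      have ha: "harper (2 ^ a) = 2 * harper (2 ^ b) + 2 ^ b" unfolding b by (rule harper_power_Suc)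
      show ?thesis
      proof (cases "2 ^ b \<le> q")
        case True
        define q' where "q' = q - 2 ^ b"
        have q: "q = 2 ^ b + q'" using True by (simp add: q'_def)
        have qp: "q' \<le> p'" using less.prems p q by simp
        have hq: "harper q = harper (2 ^ b) + harper q' + q'"
          unfolding q by (rule harper_power_add) (use p'_lt qp in simp)
        have "harper (2 ^ a + (p' + q')) = harper (2 ^ a) + harper (p' + q') + (p' + q')"
          by (rule harper_power_add) (use p'_lt qp b in simp)
        moreover have "p + q = 2 ^ a + (p' + q')" using p q b by simp
        ultimately have h2: "harper (p + q) = harper (2 ^ a) + harper (p' + q') + (p' + q')" by simp
        have i: "harper p' + harper q' + min p' q' \<le> harper (p' + q')" by (rule IH) (use p q in simp)
        moreover have "min p' q' = q'" using qp by simp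
        ultimately have "harper p + harper q + q \<le> harper (p + q)" using h2 ha hp hq q by linarith
        moreover have "p < 2 ^ a \<and> (\<exists>b. a = Suc b \<and> 2 ^ b \<le> q)" using p_lt b True by simp
        ultimately show ?thesis by blast
      next
        case q_lt: False
        \<comment> \<open>the sum of the remainders carries over into \<open>2 ^ b\<close>\<close>
        define m where "m = p' + q - 2 ^ b"
        have pq: "p' + q = 2 ^ b + m" "p + q = 2 ^ a + m" using a p b by (auto simp: m_def)
        have m: "m < 2 ^ b" using p'_lt q_lt pq by linarith
        have h2: "harper (p + q) = harper (2 ^ a) + harper m + m"
          unfolding pq by (rule harper_power_add) (use m b in simp)
        have h3: "harper (p' + q) = harper (2 ^ b) + harper m + m"
          unfolding pq by (rule harper_power_add) (use m in simp)
        have i: "harper p' + harper q + min p' q \<le> harper (p' + q)" by (rule IH) (use p in simp)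
        have "harper p + harper q + q < harper (p + q)"
          using i h2 h3 hp ha p'_lt q_lt by (cases "p' \<le> q") (simp_all add: min_def)
        then show ?thesis by simp
      qed
    qed
    then have le: "harper p + harper q + q \<le> harper (p + q)"
      and eq: "harper p + harper q + q = harper (p + q) \<Longrightarrow> p = 2 ^ a \<or> p < 2 ^ a \<and> (\<exists>b. a = Suc b \<and> 2 ^ b \<le> q)"
      by simp_all
    show ?thesis
    proof (intro conjI allI impI le)
      fix a' assume a': "0 < q \<and> harper p + harper q + q = harper (p + q) \<and> 2 ^ a' \<le> p + q \<and> p + q < 2 ^ Suc a'"
      then have "a' = a" by (intro uniq) simp_all
      then show "p = 2 ^ a' \<or> p < 2 ^ a' \<and> (\<exists>b. a' = Suc b \<and> 2 ^ b \<le> q)" using eq a' by simp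
    qed
  qed simp
qed

lemma harper_superadd: "q \<le> p \<Longrightarrow> harper p + harper q + q \<le> harper (p + q)"
  using harper_superadd_aux by blast

lemma harper_superadd_eq:
  assumes "q \<le> p" "0 < q" "harper p + harper q + q = harper (p + q)" "2 ^ a \<le> p + q" "p + q < 2 ^ Suc a"
  shows "p = 2 ^ a \<or> p < 2 ^ a \<and> (\<exists>b. a = Suc b \<and> 2 ^ b \<le> q)"
  using harper_superadd_aux[OF assms(1)] assms by blast

lemma harper_superadd_min: "harper p + harper q + min p q \<le> harper (p + q)"
proof (cases "q \<le> p")
  case True
  then show ?thesis using harper_superadd[of q p] by (simp add: min_absorb2)
next
  case False
  then show ?thesis using harper_superadd[of p q] by (simp add: min_absorb1 add.commute)
qed

section \<open>The edge-isoperimetric inequality in the cube\<close>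

definition adj :: "'a set \<Rightarrow> 'a set \<Rightarrow> bool" where
  "adj A B \<longleftrightarrow> (\<exists>i. sym_diff A B = {i})"

text \<open>Ordered pairs are counted, so this is twice the number of edges spanned by \<open>F\<close>.\<close>

definition adj_pairs :: "'a set set \<Rightarrow> nat" where
  "adj_pairs F = card {(A, B). A \<in> F \<and> B \<in> F \<and> adj A B}"

lemma adj_sym: "adj A B \<longleftrightarrow> adj B A" by (simp add: adj_def Un_commute)

lemma adj_pairs_Un:
  assumes "finite F" "finite G" "F \<inter> G = {}"
  shows "adj_pairs (F \<union> G) = adj_pairs F + adj_pairs G + 2 * card {(A, B). A \<in> F \<and> B \<in> G \<and> adj A B}"
proof -
  let ?FF = "{(A, B). A \<in> F \<and> B \<in> F \<and> adj A B}" and ?GG = "{(A, B). A \<in> G \<and> B \<in> G \<and> adj A B}"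
  let ?FG = "{(A, B). A \<in> F \<and> B \<in> G \<and> adj A B}" and ?GF = "{(A, B). A \<in> G \<and> B \<in> F \<and> adj A B}"
  have fin: "finite ?FF" "finite ?GG" "finite ?FG" "finite ?GF"
    by (rule finite_subset[of _ "(F \<union> G) \<times> (F \<union> G)"], blast, simp add: assms)+
  have "{(A, B). A \<in> F \<union> G \<and> B \<in> F \<union> G \<and> adj A B} = (?FF \<union> ?GG) \<union> (?FG \<union> ?GF)" by auto
  then have "adj_pairs (F \<union> G) = card ((?FF \<union> ?GG) \<union> (?FG \<union> ?GF))" by (simp add: adj_pairs_def)
  also have "\<dots> = card (?FF \<union> ?GG) + card (?FG \<union> ?GF)"
    by (rule card_Un_disjoint) (use fin assms(3) in blast)+
  also have "card (?FF \<union> ?GG) = card ?FF + card ?GG"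
    by (rule card_Un_disjoint) (use fin assms(3) in blast)+
  also have "card (?FG \<union> ?GF) = card ?FG + card ?GF"
    by (rule card_Un_disjoint) (use fin assms(3) in blast)+
  also have "card ?GF = card ?FG"
  proof -
    have "?GF = ?FG\<inverse>" by (auto simp: adj_sym)
    then show ?thesis by simp
  qed
  finally show ?thesis by (simp add: adj_pairs_def)
qed

lemma adj_pairs_image:
  assumes "inj_on g F" and "\<And>A B. \<lbrakk>A \<in> F; B \<in> F\<rbrakk> \<Longrightarrow> adj (g A) (g B) \<longleftrightarrow> adj A B"
  shows "adj_pairs (g ` F) = adj_pairs F"
proof -
  have "{(A, B). A \<in> g ` F \<and> B \<in> g ` F \<and> adj A B} = map_prod g g ` {(A, B). A \<in> F \<and> B \<in> F \<and> adj A B}"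
  proof (intro equalityI subsetI)
    fix p assume "p \<in> {(A, B). A \<in> g ` F \<and> B \<in> g ` F \<and> adj A B}"
    then obtain A B where "A \<in> F" "B \<in> F" "p = (g A, g B)" "adj (g A) (g B)" by blast
    moreover from this have "adj A B" using assms(2) by blast
    ultimately show "p \<in> map_prod g g ` {(A, B). A \<in> F \<and> B \<in> F \<and> adj A B}" by force
  next
    fix p assume "p \<in> map_prod g g ` {(A, B). A \<in> F \<and> B \<in> F \<and> adj A B}"
    then obtain A B where "A \<in> F" "B \<in> F" "p = (g A, g B)" "adj A B" by auto
    then show "p \<in> {(A, B). A \<in> g ` F \<and> B \<in> g ` F \<and> adj A B}" using assms(2) by blast
  qed
  moreover have "inj_on (map_prod g g) {(A, B). A \<in> F \<and> B \<in> F \<and> adj A B}"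
    using assms(1) by (auto simp: inj_on_def)
  ultimately show ?thesis unfolding adj_pairs_def by (simp add: card_image)
qed

lemma adj_insert_both: "\<lbrakk>i \<notin> A; i \<notin> B\<rbrakk> \<Longrightarrow> adj (insert i A) (insert i B) \<longleftrightarrow> adj A B"
  by (simp add: adj_def insert_Diff_if)

lemma adj_insert_one: 
  assumes "i \<notin> A" "i \<in> B"
  shows "adj A B \<longleftrightarrow> B = insert i A"
proof
  assume "adj A B"
  then obtain j where j: "sym_diff A B = {j}" by (auto simp: adj_def)
  have "x \<in> sym_diff A B \<longleftrightarrow> x = j" for x unfolding j by simp
  then have "(x \<in> A \<longleftrightarrow> x \<in> B) \<longleftrightarrow> x \<noteq> j" for x by (metis DiffI DiffE Un_iff)
  then show "B = insert i A" using assms by (metis insert_iff set_eqI)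
next
  assume "B = insert i A"
  then have "sym_diff A B = {i}" using assms by auto
  then show "adj A B" by (auto simp: adj_def)
qed

definition lower :: "'a \<Rightarrow> 'a set set \<Rightarrow> 'a set set" where
  "lower i F = {A \<in> F. i \<notin> A}"

text \<open>The sets with \<open>i\<close> are stored without \<open>i\<close>, so that both halves of \<open>F\<close> live in the same
smaller cube; the edges in direction \<open>i\<close> then correspond to the common elements of the halves.\<close>

definition upper :: "'a \<Rightarrow> 'a set set \<Rightarrow> 'a set set" where
  "upper i F = {A. i \<notin> A \<and> insert i A \<in> F}"

lemma family_split: "F = lower i F \<union> insert i ` upper i F"
proof (intro set_eqI iffI)
  fix A assume A: "A \<in> F"
  show "A \<in> lower i F \<union> insert i ` upper i F"
  proof (cases "i \<in> A")
    case True
    then have "A - {i} \<in> upper i F" "A = insert i (A - {i})" using A by (auto simp: upper_def insert_absorb)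
    then show ?thesis by blast
  qed (use A in \<open>simp add: lower_def\<close>)
qed (auto simp: lower_def upper_def)

lemma inj_on_insert_upper: "inj_on (insert i) (upper i F)"
  by (auto simp: inj_on_def upper_def)

lemma split_disjoint: "lower i F \<inter> insert i ` upper i F = {}"
  by (auto simp: lower_def)

lemma split_finite:
  assumes "finite F"
  shows "finite (lower i F)" "finite (upper i F)"
proof -
  show "finite (lower i F)" using assms by (simp add: lower_def)
  have "insert i ` upper i F \<subseteq> F" by (auto simp: upper_def)
  then show "finite (upper i F)" using assms finite_subset finite_imageD[OF _ inj_on_insert_upper] by metis
qed

lemma card_split: "finite F \<Longrightarrow> card F = card (lower i F) + card (upper i F)"
  by (subst family_split[of F i])
    (simp add: card_Un_disjoint split_finite split_disjoint card_image inj_on_insert_upper)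

lemma adj_pairs_split:
  assumes F: "finite F"
  shows "adj_pairs F = adj_pairs (lower i F) + adj_pairs (upper i F) + 2 * card (lower i F \<inter> upper i F)"
proof -
  have "adj_pairs F = adj_pairs (lower i F) + adj_pairs (insert i ` upper i F)
      + 2 * card {(A, B). A \<in> lower i F \<and> B \<in> insert i ` upper i F \<and> adj A B}"
    by (subst family_split[of F i]) (intro adj_pairs_Un split_disjoint finite_imageI split_finite F)
  also have "adj_pairs (insert i ` upper i F) = adj_pairs (upper i F)"
    by (intro adj_pairs_image inj_on_insert_upper) (auto simp: upper_def adj_insert_both)
  also have "{(A, B). A \<in> lower i F \<and> B \<in> insert i ` upper i F \<and> adj A B}
      = (\<lambda>A. (A, insert i A)) ` (lower i F \<inter> upper i F)"
  proof (intro set_eqI iffI)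
    fix p assume "p \<in> {(A, B). A \<in> lower i F \<and> B \<in> insert i ` upper i F \<and> adj A B}"
    then obtain A B where p: "p = (A, B)" "A \<in> lower i F" "B \<in> insert i ` upper i F" "adj A B" by auto
    then have "i \<notin> A" "i \<in> B" by (auto simp: lower_def)
    then have "B = insert i A" using p(4) adj_insert_one by metis
    moreover have "A \<in> upper i F"
    proof -
      obtain A' where "A' \<in> upper i F" "B = insert i A'" using p(3) by auto
      moreover from this have "A' = A" using \<open>B = insert i A\<close> \<open>i \<notin> A\<close> by (auto simp: upper_def)
      ultimately show ?thesis by simp
    qed
    ultimately show "p \<in> (\<lambda>A. (A, insert i A)) ` (lower i F \<inter> upper i F)" using p by auto
  next
    fix p assume "p \<in> (\<lambda>A. (A, insert i A)) ` (lower i F \<inter> upper i F)"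
    then obtain A where "p = (A, insert i A)" "A \<in> lower i F" "A \<in> upper i F" by auto
    moreover from this have "adj A (insert i A)" using adj_insert_one[of i A] by (simp add: lower_def)
    ultimately show "p \<in> {(A, B). A \<in> lower i F \<and> B \<in> insert i ` upper i F \<and> adj A B}" by auto
  qed
  also have "card \<dots> = card (lower i F \<inter> upper i F)"
    by (intro card_image) (auto simp: inj_on_def)
  finally show ?thesis .
qed

lemma lower_upper_Pow:
  assumes "F \<subseteq> Pow (insert i N)"
  shows "lower i F \<subseteq> Pow N" "upper i F \<subseteq> Pow N"
  using assms by (auto simp: lower_def upper_def)

text \<open>Harper's inequality. Cutting along one direction leaves two smaller families, joined by at most
as many edges as the smaller one has elements; superadditivity of \<open>harper\<close> absorbs these.\<close>

theorem edge_isoperimetry: "\<lbrakk>finite N; F \<subseteq> Pow N\<rbrakk> \<Longrightarrow> adj_pairs F \<le> 2 * harper (card F)"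
proof (induction N arbitrary: F rule: finite_induct)
  case empty
  then have "{(A, B). A \<in> F \<and> B \<in> F \<and> adj A B} = {}" by (auto simp: adj_def)
  then have "adj_pairs F = 0" by (simp only: adj_pairs_def card.empty)
  then show ?case by simp
next
  case (insert i N)
  have F: "finite F" using insert.prems insert.hyps(1) by (meson finite.insertI finite_Pow_iff finite_subset)
  have "card (lower i F \<inter> upper i F) \<le> min (card (lower i F)) (card (upper i F))"
    using split_finite[OF F] by (simp add: card_mono)
  moreover have "adj_pairs (lower i F) \<le> 2 * harper (card (lower i F))"
    "adj_pairs (upper i F) \<le> 2 * harper (card (upper i F))"
    using insert.IH lower_upper_Pow[OF insert.prems] by auto
  ultimately show ?case
    unfolding card_split[OF F, of i] using adj_pairs_split[OF F, of i]
      harper_superadd_min[of "card (lower i F)" "card (upper i F)"] by linarith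
qed

section \<open>The structure of optimal families\<close>

text \<open>The subcube through the vertex \<open>B\<close> with free directions \<open>J\<close>.\<close>

definition cube :: "'a set \<Rightarrow> 'a set \<Rightarrow> 'a set set" where
  "cube B J = {A. sym_diff A B \<subseteq> J}"

definition optimal :: "'a set set \<Rightarrow> bool" where
  "optimal F \<longleftrightarrow> adj_pairs F = 2 * harper (card F)"

lemma sym_diff_cancel [simp]: "sym_diff (sym_diff A B) B = A"
  by blast

lemma inj_sym_diff: "inj_on (\<lambda>A. sym_diff A B) F"
  by (rule inj_on_inverseI[of _ "\<lambda>A. sym_diff A B"]) simp

lemma adj_sym_diff: "adj (sym_diff A s) (sym_diff B s) \<longleftrightarrow> adj A B"
proof -
  have "sym_diff (sym_diff A s) (sym_diff B s) = sym_diff A B" by blast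
  then show ?thesis unfolding adj_def by (simp only:)
qed

lemma cube_eq_image: "cube B J = (\<lambda>K. sym_diff K B) ` Pow J"
proof (intro equalityI subsetI)
  fix A assume "A \<in> cube B J"
  then have "sym_diff A B \<in> Pow J" by (simp add: cube_def)
  then show "A \<in> (\<lambda>K. sym_diff K B) ` Pow J"
    by (intro image_eqI[of _ _ "sym_diff A B"]) (simp only: sym_diff_cancel)
next
  fix A assume "A \<in> (\<lambda>K. sym_diff K B) ` Pow J"
  then obtain K where "K \<subseteq> J" "A = sym_diff K B" by blast
  then show "A \<in> cube B J" unfolding cube_def by (simp only: sym_diff_cancel mem_Collect_eq)
qed

lemma card_cube: "finite J \<Longrightarrow> card (cube B J) = 2 ^ card J"
  by (simp only: cube_eq_image card_image[OF inj_sym_diff] card_Pow)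

text \<open>For an optimal family every inequality in the proof of Harper's theorem is an equality. In
particular the halves are optimal and the smaller one is contained in the larger one.\<close>

lemma optimal_split:
  assumes N: "finite N" and F: "F \<subseteq> Pow (insert i N)" and opt: "optimal F"
    and ne: "lower i F \<noteq> {}" "upper i F \<noteq> {}"
  defines "p \<equiv> max (card (lower i F)) (card (upper i F))"
    and "q \<equiv> min (card (lower i F)) (card (upper i F))"
  shows "optimal (lower i F)" "optimal (upper i F)" "0 < q" "p + q = card F"
    "harper p + harper q + q = harper (p + q)"
    "lower i F \<subseteq> upper i F \<or> upper i F \<subseteq> lower i F"
proof -
  let ?l = "lower i F" and ?u = "upper i F"
  have fF: "finite F" using F N by (meson finite.insertI finite_Pow_iff finite_subset)
  note fin = split_finite[OF fF, of i]
  have le: "adj_pairs ?l \<le> 2 * harper (card ?l)" "adj_pairs ?u \<le> 2 * harper (card ?u)"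
    using edge_isoperimetry[OF N] lower_upper_Pow[OF F] by auto
  have int: "card (?l \<inter> ?u) \<le> q" unfolding q_def using fin by (simp add: card_mono)
  have pq: "p + q = card F" unfolding p_def q_def card_split[OF fF, of i] by (simp add: max_def min_def)
  have hpq: "harper p + harper q = harper (card ?l) + harper (card ?u)"
    unfolding p_def q_def by (simp add: max_def min_def)
  have super: "harper p + harper q + q \<le> harper (p + q)"
    by (rule harper_superadd) (simp add: p_def q_def)
  have total: "2 * harper (p + q) = adj_pairs ?l + adj_pairs ?u + 2 * card (?l \<inter> ?u)"
    using opt adj_pairs_split[OF fF, of i] by (simp add: optimal_def pq)
  show "optimal ?l" "optimal ?u"
    unfolding optimal_def using le int hpq super total by linarith+
  show "0 < q" using ne fin by (simp add: q_def card_gt_0_iff)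
  show "p + q = card F" by (rule pq)
  show "harper p + harper q + q = harper (p + q)" using le int hpq super total by linarith
  have c: "card (?l \<inter> ?u) = q" using le int hpq super total by linarith
  show "?l \<subseteq> ?u \<or> ?u \<subseteq> ?l"
  proof (cases "card ?l \<le> card ?u")
    case True
    then have "card (?l \<inter> ?u) = card ?l" using c by (simp add: q_def)
    then have "?l \<inter> ?u = ?l" using fin by (intro card_subset_eq) auto
    then show ?thesis by blast
  next
    case False
    then have "card (?l \<inter> ?u) = card ?u" using c by (simp add: q_def)
    then have "?l \<inter> ?u = ?u" using fin by (intro card_subset_eq) auto
    then show ?thesis by blast
  qed
qed

lemma cube_in_lower: "cube B J \<subseteq> lower i F \<Longrightarrow> cube B J \<subseteq> F"
  by (auto simp: lower_def)

lemma cube_in_upper: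
  assumes sub: "cube B J \<subseteq> upper i F" and i: "i \<notin> B" "i \<notin> J"
  shows "cube (insert i B) J \<subseteq> F"
proof
  fix A assume A: "A \<in> cube (insert i B) J"
  then have s: "sym_diff A (insert i B) \<subseteq> J" by (simp add: cube_def)
  then have "i \<in> A" using i by blast
  then have "sym_diff (A - {i}) B \<subseteq> J" using s i by blast
  then have "A - {i} \<in> upper i F" using sub by (auto simp: cube_def)
  then show "A \<in> F" using \<open>i \<in> A\<close> by (simp add: upper_def insert_absorb)
qed

lemma cube_in_both:
  assumes sub: "cube B J \<subseteq> lower i F" "cube B J \<subseteq> upper i F" and i: "i \<notin> B" "i \<notin> J"
  shows "cube B (insert i J) \<subseteq> F"
proof
  fix A assume "A \<in> cube B (insert i J)"
  then have s: "sym_diff A B \<subseteq> insert i J" by (simp add: cube_def)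
  show "A \<in> F"
  proof (cases "i \<in> A")
    case True
    then have "sym_diff (A - {i}) B \<subseteq> J" using s i by blast
    then have "A - {i} \<in> upper i F" using sub by (auto simp: cube_def)
    then show "A \<in> F" using True by (simp add: upper_def insert_absorb)
  next
    case False
    then have "sym_diff A B \<subseteq> J" using s i by blast
    then have "A \<in> lower i F" using sub by (auto simp: cube_def)
    then show ?thesis by (simp add: lower_def)
  qed
qed

text \<open>By the equality cases of superadditivity, one of the halves either has exactly \<open>2 ^ a\<close> elements,
and contains a subcube of dimension \<open>a\<close> by induction, or both halves have at least \<open>2 ^ (a - 1)\<close>
elements. In the second case a subcube of the smaller half also lies in the larger one, and the two
copies form a subcube of one dimension more.\<close>

lemma optimal_contains_cube:
  assumes "finite N" "F \<subseteq> Pow N" "optimal F" "2 ^ a \<le> card F" "card F < 2 ^ Suc a"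
  shows "\<exists>B J. B \<subseteq> N \<and> J \<subseteq> N \<and> card J = a \<and> cube B J \<subseteq> F"
  using assms
proof (induction N arbitrary: F a rule: finite_induct)
  case empty
  then have "card F \<le> card (Pow {} :: 'a set set)" by (intro card_mono) auto
  then have "card F \<le> 1" by simp
  moreover have "(1::nat) \<le> 2 ^ a" by simp
  ultimately have "card F = 1" "(2::nat) ^ a \<le> 1" using empty by linarith+
  then have "a = 0" using less_exp[of a] by linarith
  obtain A where "F = {A}" using \<open>card F = 1\<close> by (auto simp: card_1_singleton_iff)
  then have "F = {{}}" using empty by auto
  then have "cube {} {} \<subseteq> F" by (simp add: cube_def)
  then show ?case using \<open>a = 0\<close> by (intro exI[of _ "{}"]) simp
next
  case (insert i N)
  let ?l = "lower i F" and ?u = "upper i F"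
  have fF: "finite F"
    by (rule finite_subset[OF insert.prems(1)]) (use insert.hyps(1) in simp)
  note fin = split_finite[OF fF, of i]
  note sub = lower_upper_Pow[OF insert.prems(1)]
  have lift_l: ?case if ex: "\<exists>B J. B \<subseteq> N \<and> J \<subseteq> N \<and> card J = a \<and> cube B J \<subseteq> ?l"
  proof -
    obtain B J where BJ: "B \<subseteq> N" "J \<subseteq> N" "card J = a" "cube B J \<subseteq> ?l" using ex by blast
    have "cube B J \<subseteq> F" by (rule cube_in_lower[OF BJ(4)])
    moreover have "B \<subseteq> insert i N" "J \<subseteq> insert i N" using BJ by auto
    ultimately show ?thesis using BJ(3) by blast
  qed
  have lift_u: ?case if ex: "\<exists>B J. B \<subseteq> N \<and> J \<subseteq> N \<and> card J = a \<and> cube B J \<subseteq> ?u"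
  proof -
    obtain B J where BJ: "B \<subseteq> N" "J \<subseteq> N" "card J = a" "cube B J \<subseteq> ?u" using ex by blast
    have "cube (insert i B) J \<subseteq> F" by (rule cube_in_upper[OF BJ(4)]) (use BJ insert.hyps in auto)
    moreover have "insert i B \<subseteq> insert i N" "J \<subseteq> insert i N" using BJ by auto
    ultimately show ?thesis using BJ(3) by blast
  qed
  have ca: "card F = card ?l + card ?u" by (rule card_split[OF fF])
  have ap: "adj_pairs F = adj_pairs ?l + adj_pairs ?u + 2 * card (?l \<inter> ?u)" by (rule adj_pairs_split[OF fF])
  show ?case
  proof (cases "?l = {} \<or> ?u = {}")
    case True
    then show ?thesis
    proof
      assume e: "?l = {}"
      then have "optimal ?u" "card ?u = card F"
        using insert.prems(2) ap ca by (simp_all add: optimal_def adj_pairs_def)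
      then show ?thesis using insert.IH[OF sub(2), of a] insert.prems lift_u by simp
    next
      assume e: "?u = {}"
      then have "optimal ?l" "card ?l = card F"
        using insert.prems(2) ap ca by (simp_all add: optimal_def adj_pairs_def)
      then show ?thesis using insert.IH[OF sub(1), of a] insert.prems lift_l by simp
    qed
  next
    case False
    then have ne: "?l \<noteq> {}" "?u \<noteq> {}" by auto
    note sp = optimal_split[OF insert.hyps(1) insert.prems(1,2) ne]
    define p where "p = max (card ?l) (card ?u)"
    define q where "q = min (card ?l) (card ?u)"
    note sp = sp[folded p_def q_def]
    have qp: "q \<le> p" by (simp add: p_def q_def)
    have "2 ^ a \<le> p + q" "p + q < 2 ^ Suc a" using insert.prems(3,4) sp(4) by simp_all
    from harper_superadd_eq[OF qp sp(3) sp(5) this]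
    consider "p = 2 ^ a" | b where "p < 2 ^ a" "a = Suc b" "2 ^ b \<le> q" by blast
    then show ?thesis
    proof cases
      case 1
      then consider "card ?l = 2 ^ a" | "card ?u = 2 ^ a" unfolding p_def by (metis max_def)
      then show ?thesis
      proof cases
        case 1
        then show ?thesis using insert.IH[OF sub(1) sp(1), of a] lift_l by simp
      next
        case 2
        then show ?thesis using insert.IH[OF sub(2) sp(2), of a] lift_u by simp
      qed
    next
      case (2 b)
      have range: "2 ^ b \<le> card ?l" "card ?l < 2 ^ Suc b" "2 ^ b \<le> card ?u" "card ?u < 2 ^ Suc b"
        using 2 unfolding p_def q_def by auto
      have "\<exists>B J. B \<subseteq> N \<and> J \<subseteq> N \<and> card J = b \<and> cube B J \<subseteq> ?l \<and> cube B J \<subseteq> ?u"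
        using sp(6)
      proof
        assume "?l \<subseteq> ?u"
        then show ?thesis using insert.IH[OF sub(1) sp(1) range(1,2)] by blast
      next
        assume "?u \<subseteq> ?l"
        then show ?thesis using insert.IH[OF sub(2) sp(2) range(3,4)] by blast
      qed
      then obtain B J where BJ: "B \<subseteq> N" "J \<subseteq> N" "card J = b" "cube B J \<subseteq> ?l" "cube B J \<subseteq> ?u"
        by blast
      have iBJ: "i \<notin> B" "i \<notin> J" using BJ insert.hyps by auto
      have "cube B (insert i J) \<subseteq> F" by (rule cube_in_both[OF BJ(4,5) iBJ])
      moreover have "card (insert i J) = a"
        using BJ iBJ 2 insert.hyps(1) finite_subset[OF BJ(2)] by simp
      moreover have "B \<subseteq> insert i N" "insert i J \<subseteq> insert i N" using BJ by auto
      ultimately show ?thesis by blast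
    qed
  qed
qed

text \<open>A neighbour of a subcube differs from it in exactly one fixed direction and has only one
neighbour in it.\<close>

lemma adj_to_cube:
  assumes "A \<in> cube B J" "adj A w"
  shows "w \<in> cube B J \<or> (\<exists>i. i \<notin> J \<and> sym_diff w B - J = {i} \<and> A = sym_diff w {i})"
proof -
  obtain i where i: "sym_diff A w = {i}" using assms(2) by (auto simp: adj_def)
  have m: "(x \<in> A \<longleftrightarrow> x \<in> w) \<longleftrightarrow> x \<noteq> i" for x
  proof -
    have "x \<in> sym_diff A w \<longleftrightarrow> x = i" unfolding i by simp
    then show ?thesis by (metis DiffE DiffI Un_iff)
  qed
  have A: "(x \<in> A) \<noteq> (x \<in> B) \<Longrightarrow> x \<in> J" for x using assms(1) by (auto simp: cube_def)
  have Aw: "A = sym_diff w {i}" using m by blast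
  show ?thesis
  proof (cases "i \<in> J")
    case True
    have "sym_diff w B \<subseteq> J"
    proof
      fix x assume "x \<in> sym_diff w B"
      then show "x \<in> J" using A[of x] m[of x] True by auto
    qed
    then show ?thesis by (simp add: cube_def)
  next
    case False
    have "x \<in> sym_diff w B - J \<longleftrightarrow> x = i" for x
      using A[of x] m[of x] False by auto
    then have "sym_diff w B - J = {i}" by blast
    then show ?thesis using False Aw by blast
  qed
qed

lemma adj_outside:
  assumes "adj w w'" "sym_diff w B - J = {i}" "sym_diff w' B - J = {j}"
  shows "i = j"
proof (rule ccontr)
  assume "i \<noteq> j"
  obtain k where k: "sym_diff w w' = {k}" using assms(1) by (auto simp: adj_def)
  have "sym_diff (sym_diff w B - J) (sym_diff w' B - J) \<subseteq> sym_diff w w'" by blast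
  then have "sym_diff {i} {j} \<subseteq> {k}" unfolding assms(2,3) k .
  then show False using \<open>i \<noteq> j\<close> by auto
qed

text \<open>A vertex outside the subcube has at most one neighbour in it. Counting edges, optimality forces
each remaining vertex to have one and the remaining vertices to be optimal among themselves. If they
were adjacent to the subcube in two different directions, they would split into two parts without
edges in between, contrary to strict superadditivity.\<close>

lemma optimal_rest:
  assumes N: "finite N" and F: "F \<subseteq> Pow N" and opt: "optimal F"
    and C: "cube B J \<subseteq> F" "J \<subseteq> N" "B \<subseteq> N" "card J = a"
    and m: "card F = 2 ^ a + m" "0 < m" "m \<le> 2 ^ a"
  shows "\<exists>i\<in>N - J. optimal (F - cube B J) \<and> (\<forall>w\<in>F - cube B J. sym_diff w B - J = {i})"
proof -
  let ?C = "cube B J" and ?R = "F - cube B J"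
  have fF: "finite F" using F N finite_subset by blast
  have fC: "finite ?C" "finite ?R" using fF C(1) finite_subset by auto
  have cC: "card ?C = 2 ^ a" using card_cube[OF finite_subset[OF C(2) N], of B] C(4) by simp
  have cR: "card ?R = m" using card_Diff_subset[OF fC(1) C(1)] cC m by simp
  let ?X = "{(A, w). A \<in> ?C \<and> w \<in> ?R \<and> adj A w}"
  have X: "\<exists>i. i \<notin> J \<and> sym_diff w B - J = {i} \<and> A = sym_diff w {i}" if "(A, w) \<in> ?X" for A w
    using adj_to_cube[of A B J w] that by blast
  have inj: "inj_on snd ?X"
  proof (rule inj_onI)
    fix p p' assume p: "p \<in> ?X" "p' \<in> ?X" "snd p = snd p'"
    obtain A w A' where e: "p = (A, w)" "p' = (A', w)" using p(3) by (metis prod.collapse)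
    obtain i i' where "sym_diff w B - J = {i}" "A = sym_diff w {i}" "sym_diff w B - J = {i'}" "A' = sym_diff w {i'}"
      using X[of A w] X[of A' w] p e by blast
    then show "p = p'" using e by simp
  qed
  have img: "snd ` ?X \<subseteq> ?R" by auto
  have cX: "card ?X \<le> m" using card_mono[OF fC(2) img] card_image[OF inj] cR by simp
  have dec: "adj_pairs F = adj_pairs ?C + adj_pairs ?R + 2 * card ?X"
    using adj_pairs_Un[OF fC] C(1) by (simp add: Un_absorb1)
  have sub: "?C \<subseteq> Pow N" "?R \<subseteq> Pow N" using F C(1) by auto
  have le: "adj_pairs ?C \<le> 2 * harper (2 ^ a)" "adj_pairs ?R \<le> 2 * harper m"
    using edge_isoperimetry[OF N sub(1)] edge_isoperimetry[OF N sub(2)] cC cR by simp_all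
  have tot: "adj_pairs F = 2 * (harper (2 ^ a) + harper m + m)"
    using opt harper_power_add[OF m(3)] by (simp add: optimal_def m(1))
  have eqs: "r = 2 * k \<and> x = j"
    if "t = 2 * (h + k + j)" "t = c + r + 2 * x" "c \<le> 2 * h" "r \<le> 2 * k" "x \<le> j" for t c r x h k j :: nat
    using that by auto
  have optR: "adj_pairs ?R = 2 * harper m" using eqs[OF tot dec le cX] by (rule conjunct1)
  have "card (snd ` ?X) = card ?R"
    unfolding card_image[OF inj] cR by (rule conjunct2[OF eqs[OF tot dec le cX]])
  then have surj: "snd ` ?X = ?R" by (rule card_subset_eq[OF fC(2) img])
  have out: "\<exists>i. i \<notin> J \<and> sym_diff w B - J = {i}" if w: "w \<in> ?R" for w
  proof -
    have "w \<in> snd ` ?X" using w unfolding surj .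
    then obtain p where p: "p \<in> ?X" "w = snd p" by (rule imageE) simp
    then have "(fst p, w) \<in> ?X" by (simp only: prod.collapse)
    from X[OF this] show ?thesis by (elim exE conjE) (intro exI conjI)
  qed
  have "?R \<noteq> {}"
  proof
    assume "?R = {}"
    then have "card ?R = 0" by (simp only: card.empty)
    then show False using cR m(2) by simp
  qed
  then obtain w0 where w0: "w0 \<in> ?R" by blast
  obtain i where i: "i \<notin> J" "sym_diff w0 B - J = {i}" using out[OF w0] by blast
  have iN: "i \<in> N"
  proof -
    have "i \<in> sym_diff w0 B" using i by blast
    moreover have "w0 \<subseteq> N" using w0 sub by blast
    ultimately show ?thesis using C(3) by blast
  qed
  \<comment> \<open>the part attached in direction \<open>i\<close> and the part attached in other directions\<close>
  define R1 where "R1 = {w\<in>?R. sym_diff w B - J = {i}}"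
  define R2 where "R2 = {w\<in>?R. sym_diff w B - J \<noteq> {i}}"
  have R12: "R1 \<union> R2 = ?R" "R1 \<inter> R2 = {}" by (auto simp: R1_def R2_def)
  have f12: "finite R1" "finite R2" unfolding R1_def R2_def by (rule finite_subset[OF _ fC(2)], blast)+
  have none: "{(A, w). A \<in> R1 \<and> w \<in> R2 \<and> adj A w} = {}"
  proof -
    have False if A: "A \<in> R1" and w: "w \<in> R2" and aw: "adj A w" for A w
    proof -
      have wR: "w \<in> ?R" and wi: "sym_diff w B - J \<noteq> {i}" using w unfolding R2_def by blast+
      obtain j where j: "sym_diff w B - J = {j}" using out[OF wR] by blast
      have Ai: "sym_diff A B - J = {i}" using A unfolding R1_def by blast
      show False using adj_outside[OF aw Ai j] wi j by blast
    qed
    then show ?thesis by blast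
  qed
  have "adj_pairs ?R = adj_pairs R1 + adj_pairs R2"
    using adj_pairs_Un[OF f12 R12(2)] unfolding R12(1) none by simp
  also have "\<dots> \<le> 2 * harper (card R1) + 2 * harper (card R2)"
    using R12 sub(2) by (intro add_mono edge_isoperimetry[OF N]) auto
  finally have "harper m \<le> harper (card R1) + harper (card R2)" using optR by simp
  moreover have c12: "card R1 + card R2 = m" using card_Un_disjoint[OF f12 R12(2)] R12(1) cR by simp
  moreover have "harper (card R1) + harper (card R2) + min (card R1) (card R2) \<le> harper (card R1 + card R2)"
    by (rule harper_superadd_min)
  ultimately have "min (card R1) (card R2) = 0" by simp
  moreover have "card R1 \<noteq> 0" using w0 i f12 by (auto simp: R1_def)
  ultimately have "card R2 = 0" by (simp add: min_def split: if_splits)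
  then have "R2 = {}" using f12 by simp
  then have "\<forall>w\<in>?R. sym_diff w B - J = {i}" by (auto simp: R2_def)
  moreover have "optimal ?R" using optR cR by (simp add: optimal_def)
  ultimately show ?thesis using iN i(1) by blast
qed

section \<open>Uniqueness of optimal families\<close>

lemma bij_extension:
  assumes N: "finite N" "finite N'" "card N = card N'" and J: "J \<subseteq> N" "J' \<subseteq> N'" "bij_betw g J J'"
  obtains s where "bij_betw s N N'" "\<And>x. x \<in> J \<Longrightarrow> s x = g x"
proof -
  have "card J = card J'" using J(3) by (rule bij_betw_same_card)
  then have "card (N - J) = card (N' - J')"
    using N J by (simp add: card_Diff_subset finite_subset)
  then obtain k where k: "bij_betw k (N - J) (N' - J')"
    using N finite_same_card_bij[of "N - J" "N' - J'"] by auto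
  define s where "s x = (if x \<in> J then g x else k x)" for x
  have "bij_betw s J J'" using J(3) by (rule bij_betw_cong[THEN iffD1, rotated]) (simp add: s_def)
  moreover have "bij_betw s (N - J) (N' - J')" using k by (rule bij_betw_cong[THEN iffD1, rotated]) (simp add: s_def)
  ultimately have "bij_betw s (J \<union> (N - J)) (J' \<union> (N' - J'))"
    by (rule bij_betw_combine) blast
  moreover have "J \<union> (N - J) = N" "J' \<union> (N' - J') = N'" using J by auto
  ultimately have "bij_betw s N N'" by (simp only:)
  then show thesis by (rule that) (simp add: s_def)
qed

text \<open>Automorphisms of the cube are written as \<open>A \<mapsto> s ` sym_diff A r\<close>, a reflection followed by a
permutation of the directions. This lemma is what makes such maps compose.\<close>

lemma image_sym_diff:
  assumes "inj_on s N" "A \<subseteq> N" "B \<subseteq> N"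
  shows "s ` (sym_diff A B) = sym_diff (s ` A) (s ` B)"
  using assms by (auto simp: inj_on_def image_iff)

lemma sym_diff_assoc: "sym_diff A (sym_diff B D) = sym_diff (sym_diff A B) D"
  by blast

definition equivalent :: "'a set \<Rightarrow> 'a set \<Rightarrow> 'a set set \<Rightarrow> 'a set set \<Rightarrow> bool" where
  "equivalent N N' F F' \<longleftrightarrow> (\<exists>s r. bij_betw s N N' \<and> r \<subseteq> N \<and> F' = (\<lambda>A. s ` sym_diff A r) ` F)"

text \<open>The images need only be shown to lie in \<open>F'\<close>: the map is injective and the families have the
same cardinality.\<close>

lemma equivalentI:
  assumes N: "finite N" and s: "bij_betw s N N'" and r: "r \<subseteq> N" and F: "F \<subseteq> Pow N" and F': "finite F'"
    and card: "card F = card F'" and sub: "\<And>A. A \<in> F \<Longrightarrow> s ` sym_diff A r \<in> F'"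
  shows "equivalent N N' F F'"
proof -
  have inj: "inj_on (\<lambda>A. s ` sym_diff A r) F"
  proof (rule inj_onI)
    fix A B assume AB: "A \<in> F" "B \<in> F" and e: "s ` sym_diff A r = s ` sym_diff B r"
    have "sym_diff A r \<subseteq> N" "sym_diff B r \<subseteq> N" using AB F r by blast+
    with e have "sym_diff A r = sym_diff B r"
      using s unfolding bij_betw_def by (metis inj_on_image_eq_iff)
    then have "sym_diff (sym_diff A r) r = sym_diff (sym_diff B r) r" by (rule arg_cong)
    then show "A = B" by (simp only: sym_diff_cancel)
  qed
  have "(\<lambda>A. s ` sym_diff A r) ` F \<subseteq> F'" using sub by blast
  then have "(\<lambda>A. s ` sym_diff A r) ` F = F'"
    by (rule card_subset_eq[OF F']) (simp only: card_image[OF inj] card)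
  then show ?thesis unfolding equivalent_def using s r by blast
qed

text \<open>A reflection after the permutation can be moved in front of it, as \<open>s\<close> is onto.\<close>

lemma translate_image:
  assumes s: "bij_betw s N N'" and B: "B \<subseteq> N" "B' \<subseteq> N'" and r: "r \<subseteq> N"
  shows "\<exists>r'. r' \<subseteq> N \<and> (\<forall>A. A \<subseteq> N \<longrightarrow> s ` sym_diff A r' = sym_diff (s ` sym_diff (sym_diff A B) r) B')"
proof -
  \<comment> \<open>the preimage of \<open>B'\<close>, so that reflecting in it first amounts to reflecting in \<open>B'\<close> afterwards\<close>
  define D where "D = {x\<in>N. s x \<in> B'}"
  have D: "D \<subseteq> N" "s ` D = B'" using s B by (auto simp: D_def bij_betw_def)
  show ?thesis
  proof (intro exI[of _ "sym_diff (sym_diff B r) D"] conjI allI impI)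
    show "sym_diff (sym_diff B r) D \<subseteq> N" using B r D by blast
    fix A assume A: "A \<subseteq> N"
    have "sym_diff A (sym_diff (sym_diff B r) D) = sym_diff (sym_diff (sym_diff A B) r) D"
      by (simp only: sym_diff_assoc)
    moreover have "sym_diff (sym_diff A B) r \<subseteq> N" using A B r by blast
    ultimately show "s ` sym_diff A (sym_diff (sym_diff B r) D) = sym_diff (s ` sym_diff (sym_diff A B) r) B'"
      using image_sym_diff[of s N "sym_diff (sym_diff A B) r" D] s D by (simp only: bij_betw_def)
  qed
qed

text \<open>If all of \<open>H\<close> outside the subcube lies in one neighbouring subcube, this is that part of \<open>H\<close>,
read as a family of subsets of \<open>L\<close>.\<close>

definition face :: "'a set set \<Rightarrow> 'a set \<Rightarrow> 'a set \<Rightarrow> 'a set set" where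
  "face H D L = (\<lambda>w. sym_diff w D \<inter> L) ` (H - cube D L)"

lemma face:
  assumes j: "j \<notin> L" "optimal (H - cube D L)" "\<forall>w\<in>H - cube D L. sym_diff w D - L = {j}"
  shows "face H D L \<subseteq> Pow L" "optimal (face H D L)" "card (face H D L) = card (H - cube D L)"
    "\<And>w. w \<in> H - cube D L \<Longrightarrow> sym_diff w D = insert j (sym_diff w D \<inter> L)"
    "\<And>K. K \<in> face H D L \<Longrightarrow> sym_diff (insert j K) D \<in> H"
proof -
  show "face H D L \<subseteq> Pow L" by (auto simp: face_def)
  show ins: "sym_diff w D = insert j (sym_diff w D \<inter> L)" if w: "w \<in> H - cube D L" for w
  proof -
    have "sym_diff w D = (sym_diff w D - L) \<union> (sym_diff w D \<inter> L)" by blast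
    then show ?thesis unfolding bspec[OF j(3) w] by simp
  qed
  have undo: "w = sym_diff (insert j (sym_diff w D \<inter> L)) D" if w: "w \<in> H - cube D L" for w
    unfolding ins[OF w, symmetric] by (simp only: sym_diff_cancel)
  have inj: "inj_on (\<lambda>w. sym_diff w D \<inter> L) (H - cube D L)"
    by (rule inj_on_inverseI[of _ "\<lambda>K. sym_diff (insert j K) D"]) (rule undo[symmetric])
  show c: "card (face H D L) = card (H - cube D L)" unfolding face_def by (rule card_image[OF inj])
  have "adj_pairs (face H D L) = adj_pairs (H - cube D L)"
    unfolding face_def
  proof (rule adj_pairs_image[OF inj])
    fix w w' assume w: "w \<in> H - cube D L" "w' \<in> H - cube D L"
    have "adj w w' \<longleftrightarrow> adj (sym_diff w D) (sym_diff w' D)" by (rule adj_sym_diff[symmetric])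
    also have "\<dots> \<longleftrightarrow> adj (insert j (sym_diff w D \<inter> L)) (insert j (sym_diff w' D \<inter> L))"
      by (simp only: ins[OF w(1), symmetric] ins[OF w(2), symmetric])
    also have "\<dots> \<longleftrightarrow> adj (sym_diff w D \<inter> L) (sym_diff w' D \<inter> L)"
      by (rule adj_insert_both) (use j(1) in auto)
    finally show "adj (sym_diff w D \<inter> L) (sym_diff w' D \<inter> L) \<longleftrightarrow> adj w w'" by simp
  qed
  then show "optimal (face H D L)" using j(2) c by (simp add: optimal_def)
  show "sym_diff (insert j K) D \<in> H" if K: "K \<in> face H D L" for K
  proof -
    obtain w where w: "w \<in> H - cube D L" "K = sym_diff w D \<inter> L" using K unfolding face_def by blast
    show ?thesis unfolding w(2) undo[OF w(1), symmetric] using w(1) by simp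
  qed
qed

text \<open>Induction on the size. Both families consist of a subcube of the same dimension and an optimal
rest in one neighbouring subcube. An automorphism of the small cube matching the two rests, given by
the induction hypothesis, extends to one of the large cube that also matches the subcubes and the
directions in which the rests are attached.\<close>

theorem optimal_unique:
  assumes "finite N" "finite N'" "card N = card N'" "F \<subseteq> Pow N" "F' \<subseteq> Pow N'"
    "optimal F" "optimal F'" "card F = card F'"
  shows "equivalent N N' F F'"
  using assms
proof (induction "card F" arbitrary: N N' F F' rule: less_induct)
  case less
  have fF: "finite F" "finite F'" using less.prems(1,2,4,5) by (meson finite_Pow_iff finite_subset)+
  show ?case
  proof (cases "card F = 0")
    case True
    then have e: "F = {}" "F' = {}" using fF less.prems(8) by auto
    obtain s where "bij_betw s N N'" using finite_same_card_bij[OF less.prems(1,2,3)] by blast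
    then show ?thesis unfolding equivalent_def e by (intro exI[of _ s] exI[of _ "{}"]) simp
  next
    case False
    then obtain a where a: "2 ^ a \<le> card F" "card F < 2 ^ Suc a" using exists_binary_size[of "card F"] by auto
    define m where "m = card F - 2 ^ a"
    have m: "card F = 2 ^ a + m" "card F' = 2 ^ a + m" "m \<le> 2 ^ a" using a less.prems(8) by (auto simp: m_def)
    obtain B J where C: "B \<subseteq> N" "J \<subseteq> N" "card J = a" "cube B J \<subseteq> F"
      using optimal_contains_cube[OF less.prems(1,4,6) a] by blast
    obtain B' J' where C': "B' \<subseteq> N'" "J' \<subseteq> N'" "card J' = a" "cube B' J' \<subseteq> F'"
      using optimal_contains_cube[OF less.prems(2,5,7)] a less.prems(8) by metis
    have fJ: "finite J" "finite J'" using C C' less.prems(1,2) finite_subset by blast+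
    show ?thesis
    proof (cases "m = 0")
      case True
      have FC: "cube B J = F" "cube B' J' = F'"
        using card_subset_eq[OF fF(1) C(4)] card_subset_eq[OF fF(2) C'(4)] card_cube[OF fJ(1), of B]
          card_cube[OF fJ(2), of B'] C C' m True by simp_all
      obtain g where g: "bij_betw g J J'" using finite_same_card_bij[OF fJ] C(3) C'(3) by auto
      obtain s where s: "bij_betw s N N'" "\<And>x. x \<in> J \<Longrightarrow> s x = g x"
        using bij_extension[OF less.prems(1,2,3) C(2) C'(2) g] by blast
      from translate_image[OF s(1) C(1) C'(1) empty_subsetI]
      obtain r where r: "r \<subseteq> N \<and> (\<forall>A. A \<subseteq> N \<longrightarrow> s ` sym_diff A r = sym_diff (s ` sym_diff (sym_diff A B) {}) B')"
        by (rule exE)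
      note r = conjunct1[OF r] conjunct2[OF r, rule_format]
      show ?thesis
      proof (rule equivalentI[OF less.prems(1) s(1) r(1) less.prems(4) fF(2) less.prems(8)])
        fix A assume A: "A \<in> F"
        then have "sym_diff A B \<subseteq> J" unfolding FC(1)[symmetric] by (simp add: cube_def)
        then have "s ` sym_diff A B \<subseteq> J'" using s(2) g by (auto simp: bij_betw_def)
        moreover have "A \<subseteq> N" using A less.prems(4) by blast
        ultimately show "s ` sym_diff A r \<in> F'"
          using r(2)[of A] unfolding FC(2)[symmetric] cube_def by (simp only: Diff_empty empty_Diff Un_empty_right mem_Collect_eq sym_diff_cancel)
      qed
    next
      case False
      then have m0: "0 < m" by simp
      obtain i where i: "i \<in> N - J" "optimal (F - cube B J)" "\<forall>w\<in>F - cube B J. sym_diff w B - J = {i}"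
        using optimal_rest[OF less.prems(1,4,6) C(4,2,1,3) m(1) m0 m(3)] by blast
      obtain i' where i': "i' \<in> N' - J'" "optimal (F' - cube B' J')"
          "\<forall>w\<in>F' - cube B' J'. sym_diff w B' - J' = {i'}"
        using optimal_rest[OF less.prems(2,5,7) C'(4,2,1,3) m(2) m0 m(3)] by blast
      have iJ: "i \<notin> J" "i' \<notin> J'" using i(1) i'(1) by auto
      note G = face[OF iJ(1) i(2,3)] and G' = face[OF iJ(2) i'(2,3)]
      have cR: "card (F - cube B J) = m" "card (F' - cube B' J') = m"
        using card_Diff_subset[OF finite_subset[OF C(4) fF(1)] C(4)] card_Diff_subset[OF finite_subset[OF C'(4) fF(2)] C'(4)]
          card_cube[OF fJ(1), of B] card_cube[OF fJ(2), of B'] C(3) C'(3) m by simp_all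
      have "equivalent J J' (face F B J) (face F' B' J')"
      proof (rule less.hyps)
        show "card (face F B J) < card F" using G(3) cR m by simp
        show "card J = card J'" using C(3) C'(3) by simp
        show "card (face F B J) = card (face F' B' J')" using G(3) G'(3) cR by simp
      qed (use fJ G G' in auto)
      then obtain g r0 where g: "bij_betw g J J'" "r0 \<subseteq> J" "face F' B' J' = (\<lambda>A. g ` sym_diff A r0) ` face F B J"
        unfolding equivalent_def by blast
      have "bij_betw (g(i := i')) (insert i J) (insert i' J')"
      proof -
        have "bij_betw (g(i := i')) J J'" using g(1) by (rule bij_betw_cong[THEN iffD1, rotated]) (use iJ in auto)
        moreover have "bij_betw (g(i := i')) {i} {i'}" by (simp add: bij_betw_def)
        ultimately have "bij_betw (g(i := i')) ({i} \<union> J) ({i'} \<union> J')"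
          using iJ by (intro bij_betw_combine) auto
        then show ?thesis by simp
      qed
      then obtain s where s: "bij_betw s N N'" "\<And>x. x \<in> insert i J \<Longrightarrow> s x = (g(i := i')) x"
        using bij_extension[OF less.prems(1,2,3), of "insert i J" "insert i' J'"] i(1) i'(1) C(2) C'(2) by blast
      have sJ: "s ` K = g ` K" if "K \<subseteq> J" for K using that s(2) iJ by (intro image_cong) auto
      have si: "s i = i'" using s(2)[of i] by simp
      from translate_image[OF s(1) C(1) C'(1) subset_trans[OF g(2) C(2)]]
      obtain r where r: "r \<subseteq> N \<and> (\<forall>A. A \<subseteq> N \<longrightarrow> s ` sym_diff A r = sym_diff (s ` sym_diff (sym_diff A B) r0) B')"
        by (rule exE)
      note r = conjunct1[OF r] conjunct2[OF r, rule_format]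
      show ?thesis
      proof (rule equivalentI[OF less.prems(1) s(1) r(1) less.prems(4) fF(2) less.prems(8)])
        fix A assume A: "A \<in> F"
        then have AN: "A \<subseteq> N" using less.prems(4) by blast
        show "s ` sym_diff A r \<in> F'"
        proof (cases "A \<in> cube B J")
          case True
          then have "sym_diff A B \<subseteq> J" by (simp add: cube_def)
          then have K: "sym_diff (sym_diff A B) r0 \<subseteq> J" using g(2) by blast
          then have "s ` sym_diff (sym_diff A B) r0 \<subseteq> J'" unfolding sJ[OF K] using g(1) by (auto simp: bij_betw_def)
          then have "s ` sym_diff A r \<in> cube B' J'"
            unfolding r(2)[OF AN] cube_def by (simp only: mem_Collect_eq sym_diff_cancel)
          then show ?thesis using C'(4) by blast
        next
          case False
          then have AR: "A \<in> F - cube B J" using A by blast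
          define K where "K = sym_diff A B \<inter> J"
          have K: "K \<in> face F B J" unfolding face_def K_def using AR by (rule imageI)
          have KJ: "K \<subseteq> J" by (simp add: K_def)
          have "sym_diff A B = insert i K" unfolding K_def by (rule G(4)[OF AR])
          moreover have "sym_diff (insert i K) r0 = insert i (sym_diff K r0)" using iJ g(2) by blast
          moreover have "s ` insert i (sym_diff K r0) = insert i' (g ` sym_diff K r0)"
            using sJ[of "sym_diff K r0"] KJ g(2) si by auto
          ultimately have e: "s ` sym_diff A r = sym_diff (insert i' (g ` sym_diff K r0)) B'"
            unfolding r(2)[OF AN] by (simp only:)
          have "g ` sym_diff K r0 \<in> face F' B' J'" unfolding g(3) using K by (rule imageI)
          then show ?thesis unfolding e by (rule G'(5))
        qed
      qed
    qed
  qed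
qed

text \<open>The binary enumeration of the vertices. Its second half is a copy of the first half in direction
\<open>i\<close>, so an initial segment splits into a full subcube and a shorter initial segment.\<close>

lemma exists_optimal_chain:
  assumes "finite N"
  shows "\<exists>L. distinct L \<and> set L = Pow N \<and> (\<forall>k\<le>2 ^ card N. adj_pairs (set (take k L)) = 2 * harper k)"
  using assms
proof (induction N rule: finite_induct)
  case empty
  have "adj_pairs (set (take k [{}::'a set])) = 2 * harper k" if "k \<le> 1" for k
  proof -
    have "adj_pairs F = 0" if "F \<subseteq> {{}::'a set}" for F
      using edge_isoperimetry[of "{}" F] that card_mono[of "{{}}" F] by (cases "card F") auto
    moreover have "harper k = 0" using that by (cases k) auto
    ultimately show ?thesis using set_take_subset[of k "[{}::'a set]"] by simp
  qed
  then show ?case by (intro exI[of _ "[{}]"]) simp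
next
  case (insert i N)
  then obtain L where L: "distinct L" "set L = Pow N" and opt: "\<And>k. k \<le> 2 ^ card N \<Longrightarrow> adj_pairs (set (take k L)) = 2 * harper k"
    by blast
  have len: "length L = 2 ^ card N" using distinct_card[OF L(1)] L(2) insert.hyps(1) by (simp add: card_Pow)
  let ?L = "L @ map (insert i) L"
  have iN: "i \<notin> A" if "A \<in> set L" for A using that L(2) insert.hyps(2) by auto
  have inj: "inj_on (insert i) (set L)" using iN by (intro inj_onI) (metis insert_ident)
  have "distinct ?L" using L(1) inj iN by (auto simp: distinct_map)
  moreover have "set ?L = Pow (insert i N)" using L(2) by (auto simp: Pow_insert)
  moreover have "adj_pairs (set (take k ?L)) = 2 * harper k" if k: "k \<le> 2 ^ card (insert i N)" for k
  proof (cases "k \<le> 2 ^ card N")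
    case True
    then show ?thesis using opt len by simp
  next
    case False
    define m where "m = k - 2 ^ card N"
    have km: "k = 2 ^ card N + m" using False by (simp add: m_def)
    have m: "m \<le> 2 ^ card N" using k insert.hyps km by simp
    let ?F = "set (take k ?L)"
    have F: "?F = set L \<union> insert i ` set (take m L)" using km len by (simp add: take_map)
    have sub: "set (take m L) \<subseteq> set L" by (rule set_take_subset)
    have lo: "lower i ?F = set L" unfolding F lower_def using iN by auto
    have up: "upper i ?F = set (take m L)"
    proof (intro equalityI subsetI)
      fix A assume "A \<in> upper i ?F"
      then have A: "i \<notin> A" "insert i A \<in> ?F" by (auto simp: upper_def)
      then obtain A' where "A' \<in> set (take m L)" "insert i A = insert i A'" unfolding F using iN by blast
      moreover from this have "i \<notin> A'" using sub iN by blast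
      ultimately have "A = A'" using A(1) by (simp add: insert_ident)
      then show "A \<in> set (take m L)" using \<open>A' \<in> set (take m L)\<close> by simp
    next
      fix A assume A: "A \<in> set (take m L)"
      then have "i \<notin> A" using sub iN by blast
      moreover have "insert i A \<in> ?F" unfolding F using A by blast
      ultimately show "A \<in> upper i ?F" by (simp only: upper_def mem_Collect_eq simp_thms)
    qed
    have "set L \<inter> set (take m L) = set (take m L)" using sub by blast
    moreover have "card (set (take m L)) = m"
      using L(1) len m by (simp add: distinct_card)
    ultimately have "adj_pairs ?F = adj_pairs (set L) + adj_pairs (set (take m L)) + 2 * m"
      using adj_pairs_split[of ?F i] unfolding lo up by simp
    also have "adj_pairs (set L) = 2 * harper (2 ^ card N)" using opt[of "2 ^ card N"] len by simp
    also have "adj_pairs (set (take m L)) = 2 * harper m" by (rule opt[OF m])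
    finally show ?thesis unfolding km harper_power_add[OF m] by simp
  qed
  ultimately show ?case by blast
qed

section \<open>Configurations and their energy\<close>

lemma adj_iff_card: "adj A B \<longleftrightarrow> card (sym_diff A B) = 1"
  unfolding adj_def by (rule card_1_singleton_iff[symmetric, unfolded One_nat_def[symmetric]])

lemma flip_iff_adj: "flip A B \<longleftrightarrow> adj A B"
  unfolding flip_def adj_iff_card ..

lemma neighbours_in_Pow:
  assumes "A \<subseteq> N"
  shows "{B. B \<in> Pow N \<and> adj A B} = (\<lambda>i. sym_diff {i} A) ` N"
proof (intro equalityI subsetI)
  fix B assume "B \<in> {B. B \<in> Pow N \<and> adj A B}"
  then obtain i where B: "B \<subseteq> N" "sym_diff A B = {i}" by (auto simp: adj_def)
  have "sym_diff (sym_diff A B) A = B" by blast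
  then have "B = sym_diff {i} A" unfolding B(2) by (rule sym)
  moreover have "i \<in> N" using B assms by blast
  ultimately show "B \<in> (\<lambda>i. sym_diff {i} A) ` N" by (rule image_eqI)
next
  fix B assume "B \<in> (\<lambda>i. sym_diff {i} A) ` N"
  then obtain i where i: "i \<in> N" "B = sym_diff {i} A" by (rule imageE) simp
  have "sym_diff A (sym_diff {i} A) = {i}" by blast
  then have "adj A B" unfolding adj_def i(2) by blast
  moreover have "B \<subseteq> N" using assms i by blast
  ultimately show "B \<in> {B. B \<in> Pow N \<and> adj A B}" by simp
qed

lemma card_neighbours:
  assumes "A \<subseteq> N"
  shows "card {B. B \<in> Pow N \<and> adj A B} = card N"
proof -
  have "inj_on (\<lambda>i. sym_diff {i} A) N"
  proof (rule inj_onI)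
    fix i j assume "sym_diff {i} A = sym_diff {j} A"
    then have "sym_diff (sym_diff {i} A) A = sym_diff (sym_diff {j} A) A" by (rule arg_cong)
    then show "i = j" by (simp only: sym_diff_cancel singleton_inject)
  qed
  then show ?thesis unfolding neighbours_in_Pow[OF assms] by (rule card_image)
qed

text \<open>Every vertex of the cube has \<open>card N\<close> neighbours, inside or outside of \<open>F\<close>.\<close>

lemma boundary_count:
  assumes N: "finite N" and F: "F \<subseteq> Pow N"
  shows "adj_pairs F + card {(A, B). A \<in> F \<and> B \<in> Pow N - F \<and> adj A B} = card N * card F"
proof -
  have fF: "finite F" using F N finite_subset by blast
  let ?I = "{(A, B). A \<in> F \<and> B \<in> F \<and> adj A B}" and ?O = "{(A, B). A \<in> F \<and> B \<in> Pow N - F \<and> adj A B}"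
  have fin: "finite ?I" "finite ?O"
    by (rule finite_subset[of _ "Pow N \<times> Pow N"], use F in blast, simp add: N)+
  have "(SIGMA A:F. {B. B \<in> Pow N \<and> adj A B}) = ?I \<union> ?O" using F by blast
  then have "card (SIGMA A:F. {B. B \<in> Pow N \<and> adj A B}) = card (?I \<union> ?O)" by simp
  also have "\<dots> = card ?I + card ?O" by (rule card_Un_disjoint[OF fin]) blast
  also have "card (SIGMA A:F. {B. B \<in> Pow N \<and> adj A B}) = (\<Sum>A\<in>F. card {B. B \<in> Pow N \<and> adj A B})"
    using fF N by (intro card_SigmaI) auto
  also have "\<dots> = (\<Sum>A\<in>F. card N)" using F by (intro sum.cong card_neighbours refl) blast
  finally have "card F * card N = card ?I + card ?O" by (simp only: sum_constant of_nat_id)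
  then show ?thesis unfolding adj_pairs_def by (simp only: mult.commute)
qed

text \<open>Vertices are identified with the sets of their coordinates equal to one, which turns subsets of
the hypercube into families of sets.\<close>

definition supp :: "nat \<Rightarrow> vertex \<Rightarrow> nat set" where
  "supp n v = {i\<in>{..<n}. v i = 1}"

definition vert :: "nat \<Rightarrow> nat set \<Rightarrow> vertex" where
  "vert n A = (\<lambda>i\<in>{..<n}. if i \<in> A then 1 else 0)"

lemma vert_in: "vert n A \<in> V n" by (auto simp: vert_def V_def)

lemma supp_vert: "A \<subseteq> {..<n} \<Longrightarrow> supp n (vert n A) = A"
  by (auto simp: supp_def vert_def)

lemma vert_supp: "v \<in> V n \<Longrightarrow> vert n (supp n v) = v"
proof
  fix i assume v: "v \<in> V n"
  show "vert n (supp n v) i = v i"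
  proof (cases "i < n")
    case True
    then have "v i = 0 \<or> v i = 1" using v by (auto simp: V_def PiE_iff)
    then show ?thesis using True by (auto simp: vert_def supp_def)
  next
    case False
    then show ?thesis using v by (auto simp: vert_def V_def PiE_iff extensional_def)
  qed
qed

lemma supp_subset: "supp n v \<subseteq> {..<n}" by (auto simp: supp_def)

lemma supp_bij: "bij_betw (supp n) (V n) (Pow {..<n})"
proof (rule bij_betw_byWitness[where f' = "vert n"])
  show "supp n ` V n \<subseteq> Pow {..<n}" using supp_subset by blast
qed (auto simp: vert_supp supp_vert vert_in)

lemma vert_bij: "bij_betw (vert n) (Pow {..<n}) (V n)"
proof (rule bij_betw_byWitness[where f' = "supp n"])
  show "supp n ` V n \<subseteq> Pow {..<n}" using supp_subset by blast
qed (auto simp: vert_supp supp_vert vert_in)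

lemma finite_V: "finite (V n)" by (simp add: V_def finite_PiE)

lemma card_V: "card (V n) = 2 ^ n"
  using bij_betw_same_card[OF supp_bij] by (simp add: card_Pow)

lemma supp_inj: "A \<subseteq> V n \<Longrightarrow> inj_on (supp n) A"
  using supp_bij unfolding bij_betw_def by (blast intro: inj_on_subset)

lemma dist_eq_card:
  assumes "v \<in> V n" "w \<in> V n"
  shows "(\<Sum>i<n. \<bar>v i - w i\<bar>) = int (card (sym_diff (supp n v) (supp n w)))"
proof -
  have "\<bar>v i - w i\<bar> = (if i \<in> sym_diff (supp n v) (supp n w) then 1 else 0)" if "i < n" for i
  proof -
    have "v i = 0 \<or> v i = 1" "w i = 0 \<or> w i = 1" using assms that by (auto simp: V_def PiE_iff)
    then show ?thesis using that by (auto simp: supp_def)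
  qed
  then have "(\<Sum>i<n. \<bar>v i - w i\<bar>) = (\<Sum>i<n. if i \<in> sym_diff (supp n v) (supp n w) then 1 else 0)"
    by (intro sum.cong) auto
  also have "\<dots> = (\<Sum>i\<in>{..<n} \<inter> sym_diff (supp n v) (supp n w). 1)"
    by (subst sum.inter_restrict) auto
  also have "{..<n} \<inter> sym_diff (supp n v) (supp n w) = sym_diff (supp n v) (supp n w)"
    using supp_subset[of n v] supp_subset[of n w] by blast
  finally show ?thesis by simp
qed

definition neighbouring :: "nat \<Rightarrow> vertex \<Rightarrow> vertex \<Rightarrow> bool" where
  "neighbouring n v w \<longleftrightarrow> adj (supp n v) (supp n w)"

lemma neighbouring_sym: "neighbouring n v w \<longleftrightarrow> neighbouring n w v" unfolding neighbouring_def by (rule adj_sym)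

lemma E_eq: "E n = {{v, w} | v w. v \<in> V n \<and> w \<in> V n \<and> neighbouring n v w}"
proof -
  have "(\<Sum>i<n. \<bar>v i - w i\<bar>) = 1 \<longleftrightarrow> neighbouring n v w" if "v \<in> V n" "w \<in> V n" for v w
    unfolding dist_eq_card[OF that] neighbouring_def adj_iff_card by simp
  then show ?thesis unfolding E_def by blast
qed

definition inner_pairs :: "nat \<Rightarrow> config \<Rightarrow> nat" where
  "inner_pairs n A = adj_pairs (supp n ` A)"

lemma card_edges_between:
  assumes A: "A \<subseteq> V n"
  shows "real (card (edges_between n A (V n - A))) = real n * real (card A) - real (inner_pairs n A)"
proof -
  let ?P = "{(v, w). v \<in> A \<and> w \<in> V n - A \<and> neighbouring n v w}"
  let ?Q = "{(S, T). S \<in> supp n ` A \<and> T \<in> Pow {..<n} - supp n ` A \<and> adj S T}"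
  have "edges_between n A (V n - A) = (\<lambda>(v, w). {v, w}) ` ?P"
  proof (intro equalityI subsetI)
    fix e assume "e \<in> edges_between n A (V n - A)"
    then obtain u w where uw: "e \<in> E n" "u \<in> A" "w \<in> V n - A" "e = {u, w}" by (auto simp: edges_between_def)
    then obtain u' w' where "e = {u', w'}" "neighbouring n u' w'" by (auto simp: E_eq)
    then have "neighbouring n u w" using uw(4) neighbouring_sym by (metis doubleton_eq_iff)
    then have "(u, w) \<in> ?P" using uw by simp
    then show "e \<in> (\<lambda>(v, w). {v, w}) ` ?P" using uw(4) by (intro image_eqI[of _ _ "(u, w)"]) simp_all
  next
    fix e assume "e \<in> (\<lambda>(v, w). {v, w}) ` ?P"
    then obtain u w where uw: "u \<in> A" "w \<in> V n - A" "neighbouring n u w" "e = {u, w}" by auto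
    moreover from this have "e \<in> E n" using A by (auto simp: E_eq)
    ultimately show "e \<in> edges_between n A (V n - A)" by (auto simp: edges_between_def)
  qed
  moreover have "inj_on (\<lambda>(v, w). {v, w}) ?P" by (auto simp: inj_on_def doubleton_eq_iff)
  ultimately have 1: "card (edges_between n A (V n - A)) = card ?P" by (simp add: card_image)
  have img: "supp n ` (V n - A) = Pow {..<n} - supp n ` A"
  proof -
    have "supp n ` (V n - A) = supp n ` V n - supp n ` A"
      using supp_inj[of "V n" n] A by (intro inj_on_image_set_diff) auto
    then show ?thesis using supp_bij by (simp add: bij_betw_def)
  qed
  have "?Q = map_prod (supp n) (supp n) ` ?P"
  proof (intro equalityI subsetI)
    fix p assume "p \<in> ?Q"
    then obtain S T where p: "p = (S, T)" "S \<in> supp n ` A" "T \<in> supp n ` (V n - A)" "adj S T" unfolding img by blast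
    then obtain v w where "v \<in> A" "S = supp n v" "w \<in> V n - A" "T = supp n w" by blast
    then have "(v, w) \<in> ?P" "p = map_prod (supp n) (supp n) (v, w)" using p by (simp_all add: neighbouring_def)
    then show "p \<in> map_prod (supp n) (supp n) ` ?P" by (rule rev_image_eqI)
  next
    fix p assume "p \<in> map_prod (supp n) (supp n) ` ?P"
    then obtain v w where "v \<in> A" "w \<in> V n - A" "neighbouring n v w" "p = (supp n v, supp n w)" by auto
    moreover from this have "supp n w \<in> Pow {..<n} - supp n ` A" unfolding img[symmetric] by (intro imageI)
    ultimately show "p \<in> ?Q" by (simp add: neighbouring_def)
  qed
  moreover have "inj_on (map_prod (supp n) (supp n)) ?P"
    by (rule inj_on_subset[OF map_prod_inj_on[OF supp_inj supp_inj, of "V n" n "V n" n]]) (use A in auto)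
  ultimately have 2: "card ?Q = card ?P" by (simp only: card_image)
  have "inner_pairs n A + card ?Q = n * card A"
    using boundary_count[of "{..<n}" "supp n ` A"] card_image[OF supp_inj[OF A]]
    by (simp add: inner_pairs_def image_subset_iff supp_subset)
  then have "real (inner_pairs n A + card ?P) = real (n * card A)"
    unfolding 2 by (rule arg_cong)
  then have "real (inner_pairs n A) + real (card ?P) = real n * real (card A)"
    by (simp only: of_nat_add of_nat_mult)
  then show ?thesis unfolding 1 by linarith
qed

text \<open>At fixed size the energy is governed by the number of edges spanned by \<open>A\<close> alone, since the edge
boundary is what the degrees leave over.\<close>

lemma energy_eq:
  assumes A: "A \<subseteq> V n"
  shows "energy n h A = energy n h {} + (real n - h) * real (card A) - real (inner_pairs n A)"
proof -
  have c: "real (card (V n - A)) = real (card (V n)) - real (card A)"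
    using card_Diff_subset[OF finite_subset[OF A finite_V] A] card_mono[OF finite_V A] by (simp add: of_nat_diff)
  have 0: "card (edges_between n {} (V n)) = 0" by (simp add: edges_between_def)
  show ?thesis
    unfolding energy_def card_edges_between[OF A] c by (simp add: 0 algebra_simps)
qed

lemma inner_pairs_le:
  assumes "A \<subseteq> V n"
  shows "inner_pairs n A \<le> 2 * harper (card A)"
  using edge_isoperimetry[of "{..<n}" "supp n ` A"] card_image[OF supp_inj[OF assms]]
  by (simp add: inner_pairs_def image_subset_iff supp_subset)

definition automorphism :: "nat \<Rightarrow> (vertex \<Rightarrow> vertex) \<Rightarrow> bool" where
  "automorphism n g \<longleftrightarrow> bij_betw g (V n) (V n) \<and> (\<forall>v\<in>V n. \<forall>w\<in>V n. neighbouring n (g v) (g w) \<longleftrightarrow> neighbouring n v w)"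

lemma automorphism_inverse:
  assumes g: "automorphism n g"
  shows "automorphism n (inv_into (V n) g)"
proof -
  let ?k = "inv_into (V n) g"
  have b: "bij_betw g (V n) (V n)" using g by (simp add: automorphism_def)
  have k: "bij_betw ?k (V n) (V n)" by (rule bij_betw_inv_into[OF b])
  have "neighbouring n (?k v) (?k w) \<longleftrightarrow> neighbouring n v w" if "v \<in> V n" "w \<in> V n" for v w
  proof -
    have "?k v \<in> V n" "?k w \<in> V n" using k that by (auto simp: bij_betw_def)
    then have "neighbouring n (g (?k v)) (g (?k w)) \<longleftrightarrow> neighbouring n (?k v) (?k w)" using g by (simp add: automorphism_def)
    then show ?thesis using bij_betw_inv_into_right[OF b] that by simp
  qed
  then show ?thesis using k by (simp add: automorphism_def)
qed

lemma automorphism_image_subset: "\<lbrakk>automorphism n g; A \<subseteq> V n\<rbrakk> \<Longrightarrow> g ` A \<subseteq> V n"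
  by (auto simp: automorphism_def bij_betw_def)

lemma automorphism_image_inverse:
  assumes "automorphism n g" "A \<subseteq> V n"
  shows "inv_into (V n) g ` g ` A = A" "g ` inv_into (V n) g ` A = A"
proof -
  have "inj_on g (V n)" "g ` V n = V n" using assms by (auto simp: automorphism_def bij_betw_def)
  then show "inv_into (V n) g ` g ` A = A" "g ` inv_into (V n) g ` A = A"
    using assms(2) by (auto simp: inv_into_image_cancel image_inv_into_cancel)
qed

lemma automorphism_energy:
  assumes g: "automorphism n g" and A: "A \<subseteq> V n"
  shows "energy n h (g ` A) = energy n h A"
proof -
  have inj: "inj_on g A" using g A by (auto simp: automorphism_def bij_betw_def intro: inj_on_subset)
  have gA: "g ` A \<subseteq> V n" by (rule automorphism_image_subset[OF g A])
  define f where "f S = supp n (g (vert n S))" for S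
  have vs: "vert n (supp n v) = v" if "v \<in> A" for v using that A by (auto simp: vert_supp)
  have "supp n ` g ` A = f ` supp n ` A"
    unfolding image_image f_def by (rule image_cong) (simp_all add: vs)
  moreover have "adj_pairs (f ` supp n ` A) = adj_pairs (supp n ` A)"
  proof (rule adj_pairs_image)
    show "inj_on f (supp n ` A)"
    proof (rule inj_onI)
      fix S T assume ST: "S \<in> supp n ` A" "T \<in> supp n ` A" and e: "f S = f T"
      then obtain v w where vw: "v \<in> A" "w \<in> A" "S = supp n v" "T = supp n w" by blast
      then have "supp n (g v) = supp n (g w)" using e by (simp add: f_def vs)
      then have "g v = g w" using supp_inj[OF gA] vw by (auto simp: inj_on_def)
      then show "S = T" using inj vw by (auto simp: inj_on_def)
    qed
    fix S T assume "S \<in> supp n ` A" "T \<in> supp n ` A"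
    then obtain v w where vw: "v \<in> A" "w \<in> A" "S = supp n v" "T = supp n w" by blast
    have "neighbouring n (g v) (g w) \<longleftrightarrow> neighbouring n v w" using g A vw by (auto simp: automorphism_def)
    then show "adj (f S) (f T) \<longleftrightarrow> adj S T" using vw by (simp add: f_def vs neighbouring_def)
  qed
  ultimately have "inner_pairs n (g ` A) = inner_pairs n A" by (simp add: inner_pairs_def)
  then show ?thesis unfolding energy_eq[OF A] energy_eq[OF gA] card_image[OF inj] by simp
qed

lemma adj_image:
  assumes "inj_on g N" "A \<subseteq> N" "B \<subseteq> N"
  shows "adj (g ` A) (g ` B) \<longleftrightarrow> adj A B"
proof -
  have "card (sym_diff (g ` A) (g ` B)) = card (sym_diff A B)"
    unfolding image_sym_diff[OF assms, symmetric]
    by (rule card_image) (rule inj_on_subset[OF assms(1)], use assms in blast)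
  then show ?thesis by (simp add: adj_iff_card)
qed

lemma optimal_configs_equivalent:
  assumes A: "A \<subseteq> V n" "B \<subseteq> V n" "card A = card B"
    and opt: "optimal (supp n ` A)" "optimal (supp n ` B)"
  obtains g where "automorphism n g" "g ` A = B"
proof -
  have sub: "supp n ` A \<subseteq> Pow {..<n}" "supp n ` B \<subseteq> Pow {..<n}" using supp_subset by blast+
  have "card (supp n ` A) = card (supp n ` B)"
    using A card_image[OF supp_inj] by metis
  then have "equivalent {..<n} {..<n} (supp n ` A) (supp n ` B)"
    by (intro optimal_unique sub opt) simp_all
  then obtain s r where s: "bij_betw s {..<n} {..<n}" and r: "r \<subseteq> {..<n}"
    and im: "supp n ` B = (\<lambda>S. s ` sym_diff S r) ` supp n ` A" unfolding equivalent_def by blast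
  define f where "f S = s ` sym_diff S r" for S
  have sd: "sym_diff S r \<subseteq> {..<n}" if "S \<subseteq> {..<n}" for S using that r by blast
  have inj: "inj_on s {..<n}" using s by (rule bij_betw_imp_inj_on)
  have f_sub: "f S \<subseteq> {..<n}" if "S \<subseteq> {..<n}" for S
    unfolding f_def using s sd[OF that] by (auto simp: bij_betw_def)
  have f_adj: "adj (f S) (f T) \<longleftrightarrow> adj S T" if "S \<subseteq> {..<n}" "T \<subseteq> {..<n}" for S T
    unfolding f_def adj_image[OF inj sd[OF that(1)] sd[OF that(2)]] by (rule adj_sym_diff)
  have f_inj: "inj_on f (Pow {..<n})"
  proof (rule inj_onI)
    fix S T assume "S \<in> Pow {..<n}" "T \<in> Pow {..<n}" and e: "f S = f T"
    then have ST: "S \<subseteq> {..<n}" "T \<subseteq> {..<n}" by simp_all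
    have "sym_diff S r = sym_diff T r"
      using e unfolding f_def by (rule iffD1[OF inj_on_image_eq_iff[OF inj sd[OF ST(1)] sd[OF ST(2)]]])
    then have "sym_diff (sym_diff S r) r = sym_diff (sym_diff T r) r" by (rule arg_cong)
    then show "S = T" by (simp only: sym_diff_cancel)
  qed
  have f_bij: "bij_betw f (Pow {..<n}) (Pow {..<n})"
  proof -
    have "f ` Pow {..<n} \<subseteq> Pow {..<n}" using f_sub by (intro image_subsetI PowI) simp
    then have "f ` Pow {..<n} = Pow {..<n}" by (intro endo_inj_surj f_inj) simp_all
    then show ?thesis using f_inj by (simp only: bij_betw_def simp_thms)
  qed
  define g where "g v = vert n (f (supp n v))" for v
  have sg: "supp n (g v) = f (supp n v)" for v
    unfolding g_def by (rule supp_vert[OF f_sub[OF supp_subset]])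
  have "bij_betw (vert n \<circ> (f \<circ> supp n)) (V n) (V n)"
    by (rule bij_betw_trans[OF bij_betw_trans[OF supp_bij f_bij] vert_bij])
  then have "bij_betw g (V n) (V n)" by (simp add: g_def[abs_def] comp_def)
  then have "automorphism n g"
    unfolding automorphism_def neighbouring_def sg using f_adj supp_subset by blast
  moreover have "g ` A = B"
  proof -
    have "g ` A = vert n ` f ` supp n ` A" by (simp add: g_def image_image)
    also have "f ` supp n ` A = supp n ` B" unfolding im f_def ..
    also have "vert n ` supp n ` B = B" unfolding image_image using A(2) vert_supp by (auto simp: image_iff subset_iff)
    finally show ?thesis .
  qed
  ultimately show thesis by (rule that)
qed

section \<open>Connectedness below a level\<close>

definition steps :: "config set \<Rightarrow> (config \<times> config) set" where
  "steps W = {(a, b). a \<in> W \<and> b \<in> W \<and> flip a b}"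

text \<open>Connectedness inside \<open>W\<close> by single spin flips. It replaces explicit paths: reflexive-transitive
closures concatenate and reverse without list manipulations.\<close>

definition joined :: "config set \<Rightarrow> config \<Rightarrow> config \<Rightarrow> bool" where
  "joined W a b \<longleftrightarrow> a \<in> W \<and> (a, b) \<in> (steps W)\<^sup>*"

lemma flip_sym: "flip a b \<longleftrightarrow> flip b a" unfolding flip_iff_adj by (rule adj_sym)

lemma joined_refl: "a \<in> W \<Longrightarrow> joined W a a" by (simp add: joined_def)

lemma joined_in: "joined W a b \<Longrightarrow> b \<in> W"
  unfolding joined_def by (auto elim: rtranclE simp: steps_def)

lemma joined_trans: "\<lbrakk>joined W a b; joined W b c\<rbrakk> \<Longrightarrow> joined W a c"
  unfolding joined_def by (auto intro: rtrancl_trans)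

lemma joined_sym: "joined W a b \<Longrightarrow> joined W b a"
proof -
  assume j: "joined W a b"
  have "sym (steps W)" unfolding steps_def by (rule symI) (simp add: flip_sym)
  then have "(b, a) \<in> (steps W)\<^sup>*" using j unfolding joined_def by (auto dest: symD[OF sym_rtrancl])
  then show ?thesis using joined_in[OF j] by (simp add: joined_def)
qed

lemma joined_step: "\<lbrakk>joined W a b; flip b c; c \<in> W\<rbrakk> \<Longrightarrow> joined W a c"
  using joined_in[of W a b] unfolding joined_def
  by (auto intro: rtrancl.rtrancl_into_rtrancl simp: steps_def)

lemma joined_mono: "\<lbrakk>joined W a b; W \<subseteq> W'\<rbrakk> \<Longrightarrow> joined W' a b"
proof -
  assume j: "joined W a b" and s: "W \<subseteq> W'"
  have "steps W \<subseteq> steps W'" using s by (auto simp: steps_def)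
  from rtrancl_mono[OF this] j s show ?thesis by (auto simp: joined_def)
qed

lemma successively_in_steps:
  "\<lbrakk>p \<noteq> []; set p \<subseteq> W; successively flip p\<rbrakk> \<Longrightarrow> (hd p, last p) \<in> (steps W)\<^sup>*"
proof (induction p)
  case (Cons x p)
  show ?case
  proof (cases "p = []")
    case False
    then have "(hd p, last p) \<in> (steps W)\<^sup>*" "flip x (hd p)" "x \<in> W" "hd p \<in> W"
      using Cons by (auto simp: successively_Cons)
    then have "(x, last p) \<in> (steps W)\<^sup>*"
      by (intro converse_rtrancl_into_rtrancl[of x "hd p"]) (simp_all add: steps_def)
    then show ?thesis using False by simp
  qed simp
qed simp

lemma path_iff_joined:
  assumes W: "W \<subseteq> Conf n"
  shows "(\<exists>p. is_path n p a b \<and> set p \<subseteq> W) \<longleftrightarrow> joined W a b"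
proof
  assume "\<exists>p. is_path n p a b \<and> set p \<subseteq> W"
  then obtain p where p: "p \<noteq> []" "hd p = a" "last p = b" "successively flip p" "set p \<subseteq> W"
    by (auto simp: is_path_def)
  then show "joined W a b" using successively_in_steps[OF p(1,5,4)] hd_in_set[OF p(1)] by (auto simp: joined_def)
next
  assume "joined W a b"
  moreover from this have "b \<in> W" by (rule joined_in)
  ultimately have "(a, b) \<in> (steps W)\<^sup>*" "b \<in> W" by (simp_all add: joined_def)
  then show "\<exists>p. is_path n p a b \<and> set p \<subseteq> W"
  proof (induction rule: converse_rtrancl_induct)
    case base
    then show ?case using W by (intro exI[of _ "[b]"]) (auto simp: is_path_def)
  next
    case (step x y)
    then obtain p where p: "is_path n p y b" "set p \<subseteq> W" by blast
    have "x \<in> W" "flip x y" using step.hyps(1) by (simp_all add: steps_def)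
    then have "is_path n (x # p) x b" "set (x # p) \<subseteq> W"
      using p W by (auto simp: is_path_def successively_Cons)
    then show ?case by blast
  qed
qed

lemma flip_cases:
  assumes "flip a b"
  obtains v where "v \<notin> a" "b = insert v a" | v where "v \<notin> b" "a = insert v b"
proof -
  obtain v where v: "sym_diff a b = {v}" using assms unfolding flip_iff_adj adj_def by blast
  show thesis
  proof (cases "v \<in> a")
    case True
    moreover have "v \<in> sym_diff a b" unfolding v by simp
    ultimately have "v \<notin> b" by blast
    then have "adj b a" "v \<notin> b" "v \<in> a" using True assms flip_iff_adj adj_sym by blast+
    then show thesis using that(2)[of v] adj_insert_one[of v b a] by simp
  next
    case False
    moreover have "v \<in> sym_diff a b" unfolding v by simp
    ultimately have "v \<in> b" by blast
    then show thesis using that(1)[of v] adj_insert_one[of v a b] False assms flip_iff_adj by simp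
  qed
qed

lemma flip_insert: "v \<notin> a \<Longrightarrow> flip a (insert v a)"
  unfolding flip_iff_adj using adj_insert_one[of v a "insert v a"] by simp

lemma finite_Conf: "finite (Conf n)" by (simp add: Conf_def finite_V)

lemma Conf_finite: "a \<in> Conf n \<Longrightarrow> finite a" by (auto simp: Conf_def intro: finite_subset[OF _ finite_V])

lemma empty_Conf: "{} \<in> Conf n" and V_Conf: "V n \<in> Conf n" by (simp_all add: Conf_def)

lemma flip_card_le: "\<lbrakk>flip a b; finite a; finite b\<rbrakk> \<Longrightarrow> card b \<le> Suc (card a)"
  by (erule flip_cases) (simp_all add: card_insert_if)

lemma joined_empty: "a \<in> Conf n \<Longrightarrow> joined (Conf n) {} a"
proof -
  assume a: "a \<in> Conf n"
  have "finite a" using a by (rule Conf_finite)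
  then show ?thesis using a
  proof (induction a rule: finite_induct)
    case empty
    then show ?case by (rule joined_refl)
  next
    case (insert v a)
    then have "a \<in> Conf n" by (simp add: Conf_def)
    then have "joined (Conf n) {} a" by (rule insert.IH)
    then show ?case using flip_insert[OF insert.hyps(2)] insert.prems by (rule joined_step)
  qed
qed

lemma joined_all: "\<lbrakk>a \<in> Conf n; b \<in> Conf n\<rbrakk> \<Longrightarrow> joined (Conf n) a b"
  by (rule joined_trans[OF joined_sym[OF joined_empty] joined_empty])

text \<open>Single flips change the size by one, so no size is skipped.\<close>

lemma joined_intermediate_size:
  assumes "joined W {} a" "W \<subseteq> Conf n" "k \<le> card a"
  shows "\<exists>b\<in>W. card b = k"
proof -
  have "({}, a) \<in> (steps W)\<^sup>*" "{} \<in> W" using assms(1) by (simp_all add: joined_def)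
  then show ?thesis using assms(3)
  proof (induction arbitrary: k rule: rtrancl_induct)
    case base
    then show ?case by (intro bexI[of _ "{}"]) simp_all
  next
    case (step y z)
    have yz: "flip y z" "y \<in> W" "z \<in> W" using step.hyps(2) by (auto simp: steps_def)
    then have "card z \<le> Suc (card y)" using assms(2) by (intro flip_card_le) (auto intro: Conf_finite)
    then show ?case using step yz by (cases "k \<le> card y") (auto simp: le_Suc_eq)
  qed
qed

lemma last_exit:
  assumes "(x, y) \<in> r\<^sup>*" "x \<in> A" "y \<notin> A"
  shows "\<exists>a b. a \<in> A \<and> b \<notin> A \<and> (a, b) \<in> r \<and> (b, y) \<in> {(u, v) \<in> r. u \<notin> A \<and> v \<notin> A}\<^sup>*"
  using assms
proof (induction rule: rtrancl_induct)
  case (step y z)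
  show ?case
  proof (cases "y \<in> A")
    case True
    then show ?thesis using step by blast
  next
    case False
    then obtain a b where ab: "a \<in> A" "b \<notin> A" "(a, b) \<in> r" "(b, y) \<in> {(u, v) \<in> r. u \<notin> A \<and> v \<notin> A}\<^sup>*"
      using step by blast
    have "(y, z) \<in> {(u, v) \<in> r. u \<notin> A \<and> v \<notin> A}" using False step by simp
    with ab(4) have "(b, z) \<in> {(u, v) \<in> r. u \<notin> A \<and> v \<notin> A}\<^sup>*" by (rule rtrancl_into_rtrancl)
    with ab(1,2,3) show ?thesis by blast
  qed
qed simp

section \<open>The barrier and the critical set\<close>

locale ising_cube =
  fixes n :: nat and h :: real
  assumes field: "admissible_field n h"
begin

abbreviation energy_h :: "config \<Rightarrow> real" where "energy_h \<equiv> energy n h"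
abbreviation height :: "config \<Rightarrow> config \<Rightarrow> real" where "height \<equiv> comm_height n h"

abbreviation crit :: "config set" where "crit \<equiv> critical_set n h"
abbreviation valley :: "config set" where "valley \<equiv> minus_valley n h"

definition sublevel :: "real \<Rightarrow> config set" where
  "sublevel c = {a \<in> Conf n. energy_h a \<le> c}"

definition barrier :: real where "barrier = height {} (V n)"

lemma sublevel_Conf: "sublevel c \<subseteq> Conf n" by (auto simp: sublevel_def)

lemma sublevel_mono: "c \<le> d \<Longrightarrow> sublevel c \<subseteq> sublevel d" by (auto simp: sublevel_def)

lemma path_max_le_iff:
  assumes "is_path n p a b"
  shows "Max (energy_h ` set p) \<le> c \<longleftrightarrow> set p \<subseteq> sublevel c"
proof -
  have "Max (energy_h ` set p) \<le> c \<longleftrightarrow> (\<forall>x\<in>set p. energy_h x \<le> c)"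
    using assms by (subst Max_le_iff) (auto simp: is_path_def)
  then show ?thesis using assms by (auto simp: sublevel_def is_path_def)
qed

text \<open>All statements about communication heights are reduced to connectedness in sublevel sets.\<close>

lemma height_le_iff:
  assumes ab: "a \<in> Conf n" "b \<in> Conf n"
  shows "height a b \<le> c \<longleftrightarrow> joined (sublevel c) a b"
proof -
  let ?P = "{Max (energy_h ` set p) | p. is_path n p a b}"
  have fin: "finite ?P"
  proof (rule finite_subset)
    show "?P \<subseteq> energy_h ` Conf n"
    proof
      fix x assume "x \<in> ?P"
      then obtain p where p: "is_path n p a b" "x = Max (energy_h ` set p)" by blast
      then have "x \<in> energy_h ` set p" by (auto simp: is_path_def intro!: Max_in)
      then show "x \<in> energy_h ` Conf n" using p(1) by (auto simp: is_path_def)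
    qed
  qed (simp add: finite_Conf)
  have ne: "?P \<noteq> {}" using joined_all[OF ab] unfolding path_iff_joined[OF subset_refl, symmetric] by blast
  have "height a b \<le> c \<longleftrightarrow> (\<exists>x\<in>?P. x \<le> c)" unfolding comm_height_def by (rule Min_le_iff[OF fin ne])
  also have "\<dots> \<longleftrightarrow> (\<exists>p. is_path n p a b \<and> Max (energy_h ` set p) \<le> c)" by blast
  also have "\<dots> \<longleftrightarrow> (\<exists>p. is_path n p a b \<and> set p \<subseteq> sublevel c)" using path_max_le_iff by blast
  also have "\<dots> \<longleftrightarrow> joined (sublevel c) a b" by (rule path_iff_joined[OF sublevel_Conf])
  finally show ?thesis .
qed

lemma joined_height: "\<lbrakk>a \<in> Conf n; b \<in> Conf n; height a b \<le> c\<rbrakk> \<Longrightarrow> joined (sublevel c) a b"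
  using height_le_iff by blast

lemma energy_le_height: "\<lbrakk>a \<in> Conf n; b \<in> Conf n\<rbrakk> \<Longrightarrow> energy_h a \<le> height a b"
  using joined_height[of a b "height a b"] by (simp add: joined_def sublevel_def)

lemma barrier_le: "joined (sublevel c) {} (V n) \<Longrightarrow> barrier \<le> c"
  unfolding barrier_def using height_le_iff[OF empty_Conf V_Conf] by blast

lemma joined_barrier: "joined (sublevel barrier) {} (V n)"
  unfolding barrier_def by (rule joined_height[OF empty_Conf V_Conf order_refl])

text \<open>The least energy of a configuration of size \<open>k\<close>, by Harper's inequality.\<close>

definition profile :: "nat \<Rightarrow> real" where
  "profile k = energy_h {} + (real n - h) * real k - 2 * real (harper k)"

lemma energy_ge_profile:
  assumes "a \<in> Conf n"
  shows "profile (card a) \<le> energy_h a"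
  using energy_eq[of a n h] inner_pairs_le[of a n] assms
  by (simp add: profile_def Conf_def)

lemma optimal_of_profile:
  assumes "a \<in> Conf n" "energy_h a = profile (card a)"
  shows "optimal (supp n ` a)"
proof -
  have a: "a \<subseteq> V n" using assms by (simp add: Conf_def)
  have "real (inner_pairs n a) = 2 * real (harper (card a))"
    using energy_eq[OF a, of h] assms(2) by (simp add: profile_def)
  then have "inner_pairs n a = 2 * harper (card a)" by linarith
  then show ?thesis by (simp add: optimal_def inner_pairs_def card_image[OF supp_inj[OF a]])
qed

lemma profile_le_barrier:
  assumes "k \<le> 2 ^ n"
  shows "profile k \<le> barrier"
proof -
  obtain b where b: "b \<in> sublevel barrier" "card b = k"
    using joined_intermediate_size[OF joined_barrier sublevel_Conf, of k] assms by (auto simp: card_V)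
  then show ?thesis using energy_ge_profile[of b] by (auto simp: sublevel_def)
qed

text \<open>The barrier is at least every value of the profile, because a path meets all sizes. It is at most
the largest value, because the nested optimal families form a path.\<close>

lemma barrier_attained: "\<exists>k\<le>2 ^ n. barrier = profile k"
proof -
  obtain L where L: "distinct L" "set L = Pow {..<n}"
    and opt: "\<And>k. k \<le> 2 ^ n \<Longrightarrow> adj_pairs (set (take k L)) = 2 * harper k"
    using exists_optimal_chain[of "{..<n}"] by auto
  have len: "length L = 2 ^ n" using distinct_card[OF L(1)] L(2) by (simp add: card_Pow)
  define A where "A k = vert n ` set (take k L)" for k
  have sub: "set (take k L) \<subseteq> Pow {..<n}" for k using set_take_subset L(2) by metis
  have supp: "supp n ` A k = set (take k L)" for k
    unfolding A_def image_image using sub[of k] by (auto simp: supp_vert subset_iff image_iff)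
  have AV: "A k \<subseteq> V n" for k unfolding A_def using vert_in by auto
  have card: "card (A k) = k" if "k \<le> 2 ^ n" for k
    using card_image[OF supp_inj[OF AV], of k] that L(1) len unfolding supp by (simp add: distinct_card)
  have en: "energy_h (A k) = profile k" if "k \<le> 2 ^ n" for k
    using energy_eq[OF AV, of h k] opt[OF that] card[OF that] by (simp add: inner_pairs_def supp profile_def)
  define c where "c = Max (profile ` {..2 ^ n})"
  have c: "profile k \<le> c" if "k \<le> 2 ^ n" for k unfolding c_def using that by (intro Max_ge) auto
  have "joined (sublevel c) {} (A k)" if "k \<le> 2 ^ n" for k
    using that
  proof (induction k)
    case 0
    have "A 0 = {}" by (simp add: A_def)
    then show ?case using en[of 0] c[of 0] by (simp add: joined_refl sublevel_def empty_Conf)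
  next
    case (Suc k)
    have A_Suc: "A (Suc k) = insert (vert n (L ! k)) (A k)"
      unfolding A_def using Suc.prems len by (simp add: take_Suc_conv_app_nth)
    have "vert n (L ! k) \<notin> A k"
    proof
      assume "vert n (L ! k) \<in> A k"
      then have "A (Suc k) = A k" using A_Suc by (simp add: insert_absorb)
      then show False using card[of k] card[of "Suc k"] Suc.prems by simp
    qed
    then have fl: "flip (A k) (A (Suc k))" unfolding A_Suc by (rule flip_insert)
    have in_c: "A (Suc k) \<in> sublevel c"
      using en[OF Suc.prems] c[OF Suc.prems] AV by (simp add: sublevel_def Conf_def)
    have "joined (sublevel c) {} (A k)" by (rule Suc.IH) (use Suc.prems in simp)
    then show ?case using fl in_c by (rule joined_step)
  qed
  then have "joined (sublevel c) {} (A (2 ^ n))" by simp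
  moreover have "A (2 ^ n) = V n"
    using card_subset_eq[OF finite_V AV[of "2 ^ n"]] card[of "2 ^ n"] by (simp add: card_V)
  ultimately have le: "barrier \<le> c" by (intro barrier_le) simp
  have "c \<in> profile ` {..2 ^ n}" unfolding c_def by (rule Max_in) simp_all
  then obtain k where k: "k \<le> 2 ^ n" "c = profile k" by auto
  have "barrier = profile k" using le profile_le_barrier[OF k(1)] k(2) by simp
  with k(1) show ?thesis by (intro exI conjI)
qed

lemma field_bounds: "0 < h" "h < real n" using field by (simp_all add: admissible_field_def)

lemma energy_empty_less_barrier: "energy_h {} < barrier"
proof -
  have "energy_h {} < profile 1" using field_bounds by (simp add: profile_def)
  also have "\<dots> \<le> barrier" by (rule profile_le_barrier) simp
  finally show ?thesis .
qed

lemma energy_full_less_empty: "energy_h (V n) < energy_h {}"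
proof -
  have "card (edges_between n (V n) (V n - V n)) = 0" by (simp add: edges_between_def)
  then have "real (inner_pairs n (V n)) = real n * real (card (V n))"
    using card_edges_between[of "V n" n] by simp
  then have "energy_h (V n) = energy_h {} - h * real (card (V n))"
    using energy_eq[of "V n" n h] by (simp add: left_diff_distrib)
  moreover have "0 < h * real (card (V n))" using field_bounds by (simp add: card_V)
  ultimately show ?thesis by simp
qed

text \<open>Equal energies at different sizes would express the field as a quotient of an integer by a
difference of sizes, which lies between \<open>1\<close> and \<open>2 ^ n\<close>.\<close>

lemma equal_energy_equal_card:
  assumes "a \<in> Conf n" "b \<in> Conf n" "energy_h a = energy_h b"
  shows "card a = card b"
proof -
  have no: False if ab: "a \<in> Conf n" "b \<in> Conf n" "energy_h a = energy_h b" "card b < card a" for a b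
  proof -
    define d where "d = card a - card b"
    have d: "real d = real (card a) - real (card b)" "1 \<le> d" using ab by (auto simp: d_def)
    have "d \<le> 2 ^ n" using card_mono[OF finite_V, of a n] ab by (simp add: d_def Conf_def card_V)
    define x where "x = int (n * card a) - int (inner_pairs n a) - (int (n * card b) - int (inner_pairs n b))"
    have hd: "h * real d = real_of_int x"
    proof -
      have "h * real d = h * real (card a) - h * real (card b)" by (simp add: d(1) right_diff_distrib)
      moreover have "a \<subseteq> V n" "b \<subseteq> V n" using ab by (simp_all add: Conf_def)
      ultimately show ?thesis
        using energy_eq[of a n h] energy_eq[of b n h] ab(3) by (simp add: x_def left_diff_distrib)
    qed
    then have "0 < real_of_int x" using field_bounds d by (metis less_numeral_extra(1) mult_pos_pos of_nat_0_less_iff order_less_le_trans)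
    then have "real (nat x) = real_of_int x" by simp
    then have "h * real d = real (nat x)" using hd by simp
    then have "h = real (nat x) / real d" using d(2) by (intro eq_divide_imp) simp_all
    moreover have "d \<in> {1..2 ^ n}" using d \<open>d \<le> 2 ^ n\<close> by simp
    ultimately show False using field unfolding admissible_field_def by blast
  qed
  show ?thesis using no[of a b] no[of b a] assms by (metis linorder_neqE_nat)
qed

lemma Max_path_le_Gamma:
  "Max (energy n h ` set p) - energy_h {} \<le> Gamma_star n h \<longleftrightarrow> Max (energy n h ` set p) \<le> barrier"
  by (simp add: Gamma_star_def barrier_def)

lemma critical_conditions_barrier:
  "critical_conditions n h C P \<longleftrightarrow>
     C \<subseteq> Conf n \<and> P \<subseteq> Conf n \<and>
     (\<forall>\<xi>\<in>P. \<exists>\<xi>'\<in>C. flip \<xi> \<xi>') \<and> (\<forall>\<xi>\<in>C. \<exists>\<xi>'\<in>P. flip \<xi> \<xi>') \<and>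
     P \<subseteq> valley \<and>
     (\<forall>\<xi>\<in>C. joined (sublevel barrier - valley) \<xi> (V n))"
proof -
  have "(\<exists>p. is_path n p \<xi> (V n) \<and> Max (energy n h ` set p) \<le> barrier \<and> set p \<inter> valley = {})
     \<longleftrightarrow> joined (sublevel barrier - valley) \<xi> (V n)" for \<xi>
  proof -
    have "joined (sublevel barrier - valley) \<xi> (V n) \<longleftrightarrow>
       (\<exists>p. is_path n p \<xi> (V n) \<and> set p \<subseteq> sublevel barrier - valley)"
      by (rule path_iff_joined[symmetric]) (use sublevel_Conf in blast)
    then show ?thesis using path_max_le_iff by blast
  qed
  then show ?thesis
    unfolding critical_conditions_def Max_path_le_Gamma minus_valley_def by blast
qed

lemma critical_pair_maximal: "maximal_critical n h (crit) (protocritical_set n h)"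
  using theI'[OF ex1_maximal_critical[of n h]]
  by (simp add: critical_set_def protocritical_set_def critical_pair_def case_prod_unfold)

lemma critical_pair_conditions: "critical_conditions n h (crit) (protocritical_set n h)"
  using critical_pair_maximal by (simp add: maximal_critical_def)

text \<open>The conditions are stable under unions of pairs, so the maximal pair contains every other one.
Passing from products to factors needs both factors nonempty, which holds for any pair with
nonempty \<open>C\<close>.\<close>

lemma critical_conditions_subset:
  assumes C: "critical_conditions n h C P"
  shows "C \<subseteq> crit"
proof (cases "C = {}")
  case False
  let ?C = "crit" and ?P = "protocritical_set n h"
  have cc: "critical_conditions n h (?C \<union> C) (?P \<union> P)"
    using critical_pair_conditions C unfolding critical_conditions_barrier by blast
  have "?C \<times> ?P \<subseteq> (?C \<union> C) \<times> (?P \<union> P)" by blast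
  with cc have eq: "(?C \<union> C) \<times> (?P \<union> P) = ?C \<times> ?P"
    using critical_pair_maximal unfolding maximal_critical_def by blast
  obtain x where "x \<in> C" using False by blast
  then have "P \<noteq> {}" using C unfolding critical_conditions_barrier by blast
  then show ?thesis using eq by blast
qed simp

lemma critical_set_Conf: "crit \<subseteq> Conf n"
  using critical_pair_conditions unfolding critical_conditions_barrier by blast

text \<open>Let \<open>p\<close> be a proto-critical neighbour of \<open>x\<close>. It is joined to \<open>{}\<close> strictly below the barrier;
otherwise it could reach \<open>V n\<close> through \<open>x\<close> without climbing higher than on its way to \<open>{}\<close>. If \<open>x\<close>
too were strictly below the barrier, then \<open>x\<close> would be joined to \<open>{}\<close> below the barrier and, not
belonging to the valley, also to \<open>V n\<close>; the barrier would be lower than it is.\<close>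

lemma critical_energy:
  assumes x: "x \<in> crit"
  shows "energy_h x = barrier"
proof -
  let ?M = "valley"
  obtain p where p: "p \<in> protocritical_set n h" "flip x p"
    and j: "joined (sublevel barrier - ?M) x (V n)"
    using critical_pair_conditions x unfolding critical_conditions_barrier by blast
  have xC: "x \<in> Conf n" using critical_set_Conf x by blast
  have pM: "p \<in> ?M" using critical_pair_conditions p unfolding critical_conditions_barrier by blast
  then have pC: "p \<in> Conf n" and lt: "height p {} < height p (V n)" by (simp_all add: minus_valley_def)
  have x_le: "energy_h x \<le> barrier" and xM: "x \<notin> ?M" using j by (auto simp: joined_def sublevel_def)
  have jV: "joined (sublevel barrier) x (V n)" using j by (rule joined_mono) blast
  have p0: "joined (sublevel (height p {})) p {}" by (rule joined_height[OF pC empty_Conf order_refl])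
  have low: "height p {} < barrier"
  proof (rule ccontr)
    assume "\<not> ?thesis"
    then have c: "barrier \<le> height p {}" by simp
    have "joined (sublevel (height p {})) p x"
      using energy_le_height[OF pC empty_Conf] x_le c xC pC p(2)
      by (intro joined_step[OF joined_refl]) (auto simp: sublevel_def flip_sym)
    moreover have "joined (sublevel (height p {})) x (V n)"
      by (rule joined_mono[OF jV sublevel_mono[OF c]])
    ultimately have "joined (sublevel (height p {})) p (V n)" by (rule joined_trans)
    then have "height p (V n) \<le> height p {}" using height_le_iff[OF pC V_Conf] by blast
    then show False using lt by simp
  qed
  have "\<not> energy_h x < barrier"
  proof
    assume xlt: "energy_h x < barrier"
    \<comment> \<open>a level below the barrier at which \<open>x\<close>, \<open>p\<close> and \<open>{}\<close> are joined\<close>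
    define c where "c = max (height p {}) (energy_h x)"
    have c: "c < barrier" using low xlt by (simp add: c_def)
    have "joined (sublevel c) p {}" by (rule joined_mono[OF p0 sublevel_mono]) (simp add: c_def)
    moreover have "joined (sublevel c) x p"
    proof (rule joined_step[OF joined_refl p(2)])
      show "x \<in> sublevel c" using xC by (simp add: sublevel_def c_def)
      show "p \<in> sublevel c" using \<open>joined (sublevel c) p {}\<close> by (simp add: joined_def)
    qed
    ultimately have x0: "joined (sublevel c) x {}" by (rule joined_trans[rotated])
    then have "height x {} \<le> c" using height_le_iff[OF xC empty_Conf] by blast
    moreover have "height x (V n) \<le> height x {}" using xM xC by (simp add: minus_valley_def)
    ultimately have "height x (V n) \<le> c" by simp
    then have "joined (sublevel c) x (V n)" by (rule joined_height[OF xC V_Conf])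
    with joined_sym[OF x0] have "joined (sublevel c) {} (V n)" by (rule joined_trans)
    then have "barrier \<le> c" by (rule barrier_le)
    then show False using c by simp
  qed
  then show ?thesis using x_le by simp
qed

text \<open>The size of \<open>x\<close> is one at which the profile attains the barrier, by equality of energies with a
configuration of that size on a path of minimal height.\<close>

lemma critical_optimal:
  assumes "x \<in> crit"
  shows "optimal (supp n ` x)" 
proof -
  have xC: "x \<in> Conf n" using critical_set_Conf assms by blast
  obtain k where k: "k \<le> 2 ^ n" "barrier = profile k" using barrier_attained by blast
  have "profile (card x) \<le> energy_h x" by (rule energy_ge_profile[OF xC])
  obtain b where b: "b \<in> sublevel barrier" "card b = k"
    using joined_intermediate_size[OF joined_barrier sublevel_Conf, of k] k by (auto simp: card_V)
  then have bC: "b \<in> Conf n" by (simp add: sublevel_def)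
  have "energy_h b = barrier" using energy_ge_profile[OF bC] b k by (auto simp: sublevel_def)
  then have "card x = k" using equal_energy_equal_card[OF xC bC] critical_energy[OF assms] b by simp
  then show ?thesis using optimal_of_profile[OF xC] critical_energy[OF assms] k by simp
qed

lemma critical_card_eq:
  "\<lbrakk>x \<in> crit; y \<in> crit\<rbrakk> \<Longrightarrow> card x = card y"
  using equal_energy_equal_card critical_energy critical_set_Conf by (metis subsetD)

lemma empty_not_critical: "{} \<notin> crit"
  using critical_energy energy_empty_less_barrier by fastforce

lemma full_not_critical: "V n \<notin> crit"
  using critical_energy energy_empty_less_barrier energy_full_less_empty by fastforce

text \<open>On a path at or below the barrier let \<open>a\<close> be the last configuration in the valley of \<open>{}\<close> and \<open>b\<close> the
next one. The pair \<open>{b}\<close>, \<open>{a}\<close> satisfies the conditions defining the critical sets, so \<open>b\<close> is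
critical.\<close>

lemma critical_set_separates:
  "\<not> joined (sublevel barrier - crit) {} (V n)"
proof
  let ?W = "sublevel barrier - crit" and ?M = "valley"
  assume j: "joined ?W {} (V n)"
  have "height {} {} \<le> energy_h {}"
    unfolding height_le_iff[OF empty_Conf empty_Conf] by (rule joined_refl) (simp add: sublevel_def empty_Conf)
  then have M0: "{} \<in> ?M"
    using energy_empty_less_barrier by (simp add: minus_valley_def empty_Conf barrier_def)
  have "height (V n) (V n) \<le> energy_h (V n)"
    unfolding height_le_iff[OF V_Conf V_Conf] by (rule joined_refl) (simp add: sublevel_def V_Conf)
  then have MV: "V n \<notin> ?M"
    using energy_le_height[OF V_Conf empty_Conf] by (simp add: minus_valley_def)
  obtain a b where ab: "a \<in> ?M" "b \<notin> ?M" "(a, b) \<in> steps ?W"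
      "(b, V n) \<in> {(u, v) \<in> steps ?W. u \<notin> ?M \<and> v \<notin> ?M}\<^sup>*"
    using last_exit[of "{}" "V n" "steps ?W" ?M] j M0 MV unfolding joined_def by blast
  have b: "b \<in> sublevel barrier" "b \<notin> crit" "flip a b" using ab(3) by (auto simp: steps_def)
  have "{(u, v) \<in> steps ?W. u \<notin> ?M \<and> v \<notin> ?M} \<subseteq> steps (sublevel barrier - ?M)" by (auto simp: steps_def)
  then have "(b, V n) \<in> (steps (sublevel barrier - ?M))\<^sup>*" using ab(4) rtrancl_mono by blast
  then have "joined (sublevel barrier - ?M) b (V n)" using b ab by (simp add: joined_def)
  moreover have "b \<in> Conf n" "a \<in> Conf n" using b(1) ab(1) by (auto simp: sublevel_def minus_valley_def)
  ultimately have "critical_conditions n h {b} {a}"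
    unfolding critical_conditions_barrier using b ab flip_sym by simp
  then show False using critical_conditions_subset b(2) by blast
qed

section \<open>Invariance under automorphisms\<close>

lemma automorphism_Conf: "\<lbrakk>automorphism n g; a \<in> Conf n\<rbrakk> \<Longrightarrow> g ` a \<in> Conf n"
  using automorphism_image_subset by (simp add: Conf_def)

lemma automorphism_flip:
  assumes "automorphism n g" "a \<in> Conf n" "b \<in> Conf n"
  shows "flip (g ` a) (g ` b) \<longleftrightarrow> flip a b"
  unfolding flip_iff_adj using assms
  by (intro adj_image[of g "V n"]) (auto simp: automorphism_def bij_betw_def Conf_def)

lemma joined_image:
  assumes g: "automorphism n g" and j: "joined W a b" and W: "W \<subseteq> Conf n"
    and sub: "\<And>x. x \<in> W \<Longrightarrow> g ` x \<in> W'"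
  shows "joined W' (g ` a) (g ` b)"
proof -
  have aW: "a \<in> W" and "(a, b) \<in> (steps W)\<^sup>*" using j by (simp_all add: joined_def)
  from this(2) show ?thesis
  proof (induction rule: rtrancl_induct)
    case base
    show ?case by (rule joined_refl[OF sub[OF aW]])
  next
    case (step y z)
    then have yz: "y \<in> W" "z \<in> W" "flip y z" by (auto simp: steps_def)
    then have "flip (g ` y) (g ` z)" using automorphism_flip[OF g] W by blast
    with step.IH show ?case by (rule joined_step) (rule sub[OF yz(2)])
  qed
qed

lemma automorphism_sublevel: "\<lbrakk>automorphism n g; x \<in> sublevel c\<rbrakk> \<Longrightarrow> g ` x \<in> sublevel c"
  using automorphism_energy automorphism_Conf by (auto simp: sublevel_def Conf_def)

lemma automorphism_height_le:
  assumes g: "automorphism n g" and ab: "a \<in> Conf n" "b \<in> Conf n"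
  shows "height (g ` a) (g ` b) \<le> height a b"
  unfolding height_le_iff[OF automorphism_Conf[OF g ab(1)] automorphism_Conf[OF g ab(2)]]
  by (rule joined_image[OF g joined_height[OF ab order_refl] sublevel_Conf automorphism_sublevel[OF g]])

lemma automorphism_height:
  assumes g: "automorphism n g" and ab: "a \<in> Conf n" "b \<in> Conf n"
  shows "height (g ` a) (g ` b) = height a b"
proof (rule antisym[OF automorphism_height_le[OF g ab]])
  let ?k = "inv_into (V n) g"
  have "height (?k ` g ` a) (?k ` g ` b) \<le> height (g ` a) (g ` b)"
    by (intro automorphism_height_le automorphism_inverse g automorphism_Conf ab)
  moreover have "?k ` g ` a = a" "?k ` g ` b = b"
    using automorphism_image_inverse(1)[OF g] ab by (simp_all add: Conf_def)
  ultimately show "height a b \<le> height (g ` a) (g ` b)" by simp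
qed

lemma automorphism_full: "automorphism n g \<Longrightarrow> g ` V n = V n"
  by (simp add: automorphism_def bij_betw_def)

lemma automorphism_minus_valley:
  assumes g: "automorphism n g" and a: "a \<in> Conf n"
  shows "g ` a \<in> valley \<longleftrightarrow> a \<in> valley"
  using automorphism_height[OF g a empty_Conf] automorphism_height[OF g a V_Conf]
    automorphism_full[OF g] automorphism_Conf[OF g a] a
  by (simp add: minus_valley_def)

text \<open>The image of the critical pair satisfies the same conditions, and the critical set is the largest
one.\<close>

lemma automorphism_critical:
  assumes g: "automorphism n g" and x: "x \<in> crit"
  shows "g ` x \<in> crit"
proof -
  let ?C = "crit" and ?P = "protocritical_set n h" and ?M = "valley"
  note cc = critical_pair_conditions[unfolded critical_conditions_barrier]
  have sub: "?C \<subseteq> Conf n" "?P \<subseteq> Conf n" "?P \<subseteq> ?M" using cc by blast+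
  have "critical_conditions n h (image g ` ?C) (image g ` ?P)"
    unfolding critical_conditions_barrier
  proof (intro conjI ballI)
    show "image g ` ?C \<subseteq> Conf n" "image g ` ?P \<subseteq> Conf n" using sub automorphism_Conf[OF g] by blast+
    show "image g ` ?P \<subseteq> ?M" using sub automorphism_minus_valley[OF g] by blast
    fix y assume "y \<in> image g ` ?P"
    then obtain p where p: "p \<in> ?P" "y = g ` p" by blast
    then obtain q where "q \<in> ?C" "flip p q" using cc by blast
    then have "flip y (g ` q)" using automorphism_flip[OF g, of p q] sub p by blast
    then show "\<exists>z\<in>image g ` ?C. flip y z" using \<open>q \<in> ?C\<close> by blast
  next
    fix y assume "y \<in> image g ` ?C"
    then obtain q where q: "q \<in> ?C" "y = g ` q" by blast
    then obtain p where "p \<in> ?P" "flip q p" using cc by blast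
    then have "flip y (g ` p)" using automorphism_flip[OF g, of q p] sub q by blast
    then show "\<exists>z\<in>image g ` ?P. flip y z" using \<open>p \<in> ?P\<close> by blast
    have "joined (sublevel barrier - ?M) q (V n)" using cc q by blast
    then have "joined (sublevel barrier - ?M) (g ` q) (g ` V n)"
    proof (rule joined_image[OF g])
      show "sublevel barrier - ?M \<subseteq> Conf n" using sublevel_Conf by blast
      fix z assume "z \<in> sublevel barrier - ?M"
      then show "g ` z \<in> sublevel barrier - ?M"
        using automorphism_sublevel[OF g] automorphism_minus_valley[OF g] sublevel_Conf by blast
    qed
    then show "joined (sublevel barrier - ?M) y (V n)" unfolding q(2) automorphism_full[OF g] .
  qed
  then show ?thesis using critical_conditions_subset x by blast
qed

lemma critical_transitive:
  assumes "x \<in> crit" "y \<in> crit"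
  obtains g where "automorphism n g" "g ` x = y"
proof -
  have "x \<subseteq> V n" "y \<subseteq> V n" using critical_set_Conf assms by (auto simp: Conf_def)
  then show thesis
    using critical_card_eq[OF assms] critical_optimal[OF assms(1)] critical_optimal[OF assms(2)] that
    by (rule optimal_configs_equivalent)
qed

end

section \<open>First exits of a discrete chain\<close>

definition determined_by :: "nat \<Rightarrow> ((nat \<Rightarrow> 's) \<Rightarrow> bool) \<Rightarrow> bool" where
  "determined_by k B \<longleftrightarrow> (\<forall>a b. (\<forall>i\<le>k. a i = b i) \<longrightarrow> B a = B b)"

definition vacated :: "'s \<Rightarrow> (nat \<Rightarrow> 's) \<Rightarrow> nat \<Rightarrow> bool" where
  "vacated x0 y j \<longleftrightarrow> (\<exists>i\<le>j. y i \<noteq> x0)"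

text \<open>The trajectory has left \<open>x0\<close> by time \<open>N\<close> and has not met \<open>D\<close> earlier than \<open>N\<close> after leaving \<open>x0\<close>.
Together with \<open>y N \<in> D\<close> this says that \<open>N\<close> is the first hitting time of \<open>D\<close>. Time \<open>N\<close> itself is
allowed to be the time of leaving \<open>x0\<close>, and a start inside \<open>D\<close> does not count as a hit.\<close>

definition running :: "'s \<Rightarrow> 's set \<Rightarrow> (nat \<Rightarrow> 's) \<Rightarrow> nat \<Rightarrow> bool" where
  "running x0 D y N \<longleftrightarrow> vacated x0 y N \<and> (\<forall>j<N. \<not> (y j \<in> D \<and> vacated x0 y j))"

lemma past_running: "determined_by N (\<lambda>y. running x0 D y N \<and> y N = b)"
  unfolding determined_by_def
proof (intro allI impI)
  fix a c :: "nat \<Rightarrow> 'a" assume e: "\<forall>i\<le>N. a i = c i"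
  have vac: "vacated x0 a j \<longleftrightarrow> vacated x0 c j" if "j \<le> N" for j
  proof -
    have "a i = c i" if "i \<le> j" for i using e \<open>j \<le> N\<close> that by simp
    then show ?thesis unfolding vacated_def by (intro ex_cong1 conj_cong refl) simp
  qed
  have "(\<forall>j<N. \<not> (a j \<in> D \<and> vacated x0 a j)) \<longleftrightarrow> (\<forall>j<N. \<not> (c j \<in> D \<and> vacated x0 c j))"
    using e vac by (intro all_cong) (simp add: less_imp_le)
  then show "(running x0 D a N \<and> a N = b) = (running x0 D c N \<and> c N = b)"
    using e vac[of N] unfolding running_def by simp
qed

lemma past_vacated: "determined_by N (\<lambda>y. \<not> vacated x0 y N)"
  unfolding determined_by_def vacated_def by auto

lemma running_Suc:
  "running x0 D y (Suc N) \<and> y (Suc N) = b \<longleftrightarrow>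
    (running x0 D y N \<and> y N \<notin> D) \<and> y (Suc N) = b \<or> \<not> vacated x0 y N \<and> b \<noteq> x0 \<and> y (Suc N) = b"
  unfolding running_def vacated_def by (auto simp: less_Suc_eq le_Suc_eq)

text \<open>A chain watched until it first enters \<open>D\<close> after having left \<open>x0\<close>. The entries of the
kernel \<open>p\<close> that matter are probabilities because \<open>Y\<close> moves according to them.\<close>

locale exit_chain = prob_space M for M :: "'w measure" +
  fixes Y :: "nat \<Rightarrow> 'w \<Rightarrow> 's" and S D :: "'s set" and p :: "'s \<Rightarrow> 's \<Rightarrow> real" and x0 :: 's
  assumes finite_S: "finite S"
    and D_subset: "D \<subseteq> S"
    and x0_in: "x0 \<in> S"
    and Y_measurable: "\<And>i. Y i \<in> measurable M (count_space S)"
    and Y_0: "AE \<omega> in M. Y 0 \<omega> = x0"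
    and markov: "\<And>k a y. \<lbrakk>\<And>i. i \<le> k \<Longrightarrow> a i \<in> S; y \<in> S\<rbrakk> \<Longrightarrow>
        \<P>(\<omega> in M. (\<forall>i\<le>k. Y i \<omega> = a i) \<and> Y (Suc k) \<omega> = y) =
        \<P>(\<omega> in M. \<forall>i\<le>k. Y i \<omega> = a i) * p (a k) y"
begin

lemma Y_in: "\<omega> \<in> space M \<Longrightarrow> Y i \<omega> \<in> S"
  using measurable_space[OF Y_measurable] by simp

lemma Y_eq_sets [measurable]: "{\<omega>\<in>space M. Y i \<omega> = a} \<in> sets M"
proof (cases "a \<in> S")
  case True
  have "Y i -` {a} \<inter> space M \<in> sets M"
    using measurable_sets[OF Y_measurable[of i], of "{a}"] True by simp
  moreover have "{\<omega>\<in>space M. Y i \<omega> = a} = Y i -` {a} \<inter> space M" by auto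
  ultimately show ?thesis by simp
next
  case False
  then have "{\<omega>\<in>space M. Y i \<omega> = a} = {}" using Y_in by blast
  then show ?thesis by (simp only: sets.empty_sets)
qed

lemma cylinder_sets: "{\<omega>\<in>space M. \<forall>i\<le>k. Y i \<omega> = a i} \<in> sets M"
proof -
  have "{\<omega>\<in>space M. \<forall>i\<le>(k::nat). Y i \<omega> = a i} = (\<Inter>i\<in>{..k}. {\<omega>\<in>space M. Y i \<omega> = a i})" by auto
  then show ?thesis by (auto intro!: sets.finite_INT)
qed

lemma past_decompose:
  assumes "determined_by k B"
  shows "{\<omega>\<in>space M. B (\<lambda>i. Y i \<omega>) \<and> Q \<omega>} =
    (\<Union>a\<in>{a \<in> {..k} \<rightarrow>\<^sub>E S. B a}. {\<omega>\<in>space M. (\<forall>i\<le>k. Y i \<omega> = a i) \<and> Q \<omega>})"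
proof (intro set_eqI iffI)
  fix \<omega> assume "\<omega> \<in> {\<omega>\<in>space M. B (\<lambda>i. Y i \<omega>) \<and> Q \<omega>}"
  then have w: "\<omega> \<in> space M" "B (\<lambda>i. Y i \<omega>)" "Q \<omega>" by auto
  let ?a = "restrict (\<lambda>i. Y i \<omega>) {..k}"
  have "B ?a = B (\<lambda>i. Y i \<omega>)"
    by (rule assms[unfolded determined_by_def, rule_format]) simp
  then have "?a \<in> {a \<in> {..k} \<rightarrow>\<^sub>E S. B a}" using w Y_in by auto
  moreover have "\<forall>i\<le>k. Y i \<omega> = ?a i" by simp
  ultimately show "\<omega> \<in> (\<Union>a\<in>{a \<in> {..k} \<rightarrow>\<^sub>E S. B a}. {\<omega>\<in>space M. (\<forall>i\<le>k. Y i \<omega> = a i) \<and> Q \<omega>})"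
    using w by blast
next
  fix \<omega> assume "\<omega> \<in> (\<Union>a\<in>{a \<in> {..k} \<rightarrow>\<^sub>E S. B a}. {\<omega>\<in>space M. (\<forall>i\<le>k. Y i \<omega> = a i) \<and> Q \<omega>})"
  then obtain a where a: "B a" "\<omega> \<in> space M" "\<forall>i\<le>k. Y i \<omega> = a i" "Q \<omega>" by blast
  have "B (\<lambda>i. Y i \<omega>) = B a" by (rule assms[unfolded determined_by_def, rule_format]) (use a in simp)
  then show "\<omega> \<in> {\<omega>\<in>space M. B (\<lambda>i. Y i \<omega>) \<and> Q \<omega>}" using a by auto
qed

lemma finite_words: "finite {a \<in> {..(k::nat)} \<rightarrow>\<^sub>E S. B a}"
  using finite_S by (simp add: finite_PiE)

lemma past_sets: "determined_by k B \<Longrightarrow> {\<omega>\<in>space M. B (\<lambda>i. Y i \<omega>)} \<in> sets M"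
  using past_decompose[of k B "\<lambda>_. True"] finite_words[of k B] cylinder_sets[of k]
  by (auto intro!: sets.finite_UN)

lemma past_sum:
  assumes "determined_by k B" and Q: "{\<omega>\<in>space M. Q \<omega>} \<in> sets M"
  shows "\<P>(\<omega> in M. B (\<lambda>i. Y i \<omega>) \<and> Q \<omega>) =
    (\<Sum>a\<in>{a \<in> {..k} \<rightarrow>\<^sub>E S. B a}. \<P>(\<omega> in M. (\<forall>i\<le>k. Y i \<omega> = a i) \<and> Q \<omega>))"
proof -
  have eq: "{\<omega>\<in>space M. (\<forall>i\<le>k. Y i \<omega> = a i) \<and> Q \<omega>} =
      {\<omega>\<in>space M. \<forall>i\<le>k. Y i \<omega> = a i} \<inter> {\<omega>\<in>space M. Q \<omega>}" for a by auto
  have s: "{\<omega>\<in>space M. (\<forall>i\<le>k. Y i \<omega> = a i) \<and> Q \<omega>} \<in> sets M" for a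
    unfolding eq using cylinder_sets Q by blast
  have "disjoint_family_on (\<lambda>a. {\<omega>\<in>space M. (\<forall>i\<le>k. Y i \<omega> = a i) \<and> Q \<omega>}) {a \<in> {..k} \<rightarrow>\<^sub>E S. B a}"
    unfolding disjoint_family_on_def
  proof (intro ballI impI)
    fix a b assume ab: "a \<in> {a \<in> {..k} \<rightarrow>\<^sub>E S. B a}" "b \<in> {a \<in> {..k} \<rightarrow>\<^sub>E S. B a}" "a \<noteq> b"
    then have "a \<in> {..k} \<rightarrow>\<^sub>E S" "b \<in> {..k} \<rightarrow>\<^sub>E S" by simp_all
    from PiE_ext[OF this] ab(3) have "\<exists>i\<in>{..k}. a i \<noteq> b i" by blast
    then obtain i where "i \<le> k" "a i \<noteq> b i" by (meson atMost_iff)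
    then show "{\<omega>\<in>space M. (\<forall>i\<le>k. Y i \<omega> = a i) \<and> Q \<omega>} \<inter> {\<omega>\<in>space M. (\<forall>i\<le>k. Y i \<omega> = b i) \<and> Q \<omega>} = {}"
      by (intro equals0I) (simp, metis)
  qed
  moreover have "(\<lambda>a. {\<omega>\<in>space M. (\<forall>i\<le>k. Y i \<omega> = a i) \<and> Q \<omega>}) ` {a \<in> {..k} \<rightarrow>\<^sub>E S. B a} \<subseteq> sets M"
    using s by (rule image_subsetI)
  ultimately show ?thesis
    unfolding past_decompose[OF assms(1)] by (intro finite_measure_finite_Union finite_words)
qed

text \<open>The Markov property for words extends to events of the past by summing over the words.\<close>

lemma markov_past:
  assumes B: "determined_by k B" and x: "\<And>y. B y \<Longrightarrow> y k = x" and y: "y \<in> S"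
  shows "\<P>(\<omega> in M. B (\<lambda>i. Y i \<omega>) \<and> Y (Suc k) \<omega> = y) = \<P>(\<omega> in M. B (\<lambda>i. Y i \<omega>)) * p x y"
proof -
  have "\<P>(\<omega> in M. B (\<lambda>i. Y i \<omega>) \<and> Y (Suc k) \<omega> = y) =
      (\<Sum>a\<in>{a \<in> {..k} \<rightarrow>\<^sub>E S. B a}. \<P>(\<omega> in M. (\<forall>i\<le>k. Y i \<omega> = a i) \<and> Y (Suc k) \<omega> = y))"
    by (rule past_sum[OF B]) (rule Y_eq_sets)
  also have "\<dots> = (\<Sum>a\<in>{a \<in> {..k} \<rightarrow>\<^sub>E S. B a}. \<P>(\<omega> in M. (\<forall>i\<le>k. Y i \<omega> = a i)) * p x y)"
  proof (rule sum.cong[OF refl])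
    fix a assume a: "a \<in> {a \<in> {..k} \<rightarrow>\<^sub>E S. B a}"
    then have "\<And>i. i \<le> k \<Longrightarrow> a i \<in> S" by auto
    then show "\<P>(\<omega> in M. (\<forall>i\<le>k. Y i \<omega> = a i) \<and> Y (Suc k) \<omega> = y) =
        \<P>(\<omega> in M. (\<forall>i\<le>k. Y i \<omega> = a i)) * p x y"
      using markov[of k a y] y x[of a] a by auto
  qed
  also have "\<dots> = \<P>(\<omega> in M. B (\<lambda>i. Y i \<omega>)) * p x y"
    using past_sum[OF B, of "\<lambda>_. True"] by (simp add: sum_distrib_right)
  finally show ?thesis .
qed

definition rho :: "nat \<Rightarrow> 's \<Rightarrow> real" where
  "rho N b = \<P>(\<omega> in M. running x0 D (\<lambda>i. Y i \<omega>) N \<and> Y N \<omega> = b)"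

definition alpha :: "nat \<Rightarrow> real" where
  "alpha N = \<P>(\<omega> in M. \<not> vacated x0 (\<lambda>i. Y i \<omega>) N)"

lemma rho_nonneg: "0 \<le> rho N b" by (simp add: rho_def)

lemma alpha_0: "alpha 0 = 1"
proof -
  have "\<P>(\<omega> in M. \<not> vacated x0 (\<lambda>i. Y i \<omega>) 0) = 1"
    using Y_0 past_sets[OF past_vacated[of 0 x0]]
    by (subst prob_Collect_eq_1) (auto simp: vacated_def)
  then show ?thesis by (simp add: alpha_def)
qed

lemma rho_0: "rho 0 b = 0"
proof -
  have "\<P>(\<omega> in M. running x0 D (\<lambda>i. Y i \<omega>) 0 \<and> Y 0 \<omega> = b) = 0"
    using Y_0 past_sets[OF past_running[of 0 x0 D b]]
    by (subst prob_Collect_eq_0) (auto simp: running_def vacated_def)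
  then show ?thesis by (simp add: rho_def)
qed

lemma alpha_Suc: "alpha (Suc N) = alpha N * p x0 x0"
proof -
  have "{\<omega>\<in>space M. \<not> vacated x0 (\<lambda>i. Y i \<omega>) (Suc N)} =
      {\<omega>\<in>space M. \<not> vacated x0 (\<lambda>i. Y i \<omega>) N \<and> Y (Suc N) \<omega> = x0}"
    unfolding vacated_def by (auto simp: le_Suc_eq)
  then show ?thesis
    unfolding alpha_def using markov_past[OF past_vacated[of N x0], of x0 x0] x0_in
    by (auto simp: vacated_def)
qed

lemma alpha_eq: "alpha N = p x0 x0 ^ N"
  by (induction N) (simp_all add: alpha_0 alpha_Suc)

lemma p_x0_nonneg: "0 \<le> p x0 x0"
  using alpha_eq[of 1] by (simp add: alpha_def) (metis measure_nonneg)

text \<open>A trajectory running at time \<open>N + 1\<close> either was running outside \<open>D\<close> one step before or has just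
made its first step away from \<open>x0\<close>.\<close>

lemma rho_Suc:
  assumes b: "b \<in> S"
  shows "rho (Suc N) b = (\<Sum>a\<in>S-D. rho N a * p a b) + (if b = x0 then 0 else alpha N * p x0 b)"
proof -
  let ?A = "\<lambda>a. {\<omega>\<in>space M. (running x0 D (\<lambda>i. Y i \<omega>) N \<and> Y N \<omega> = a) \<and> Y (Suc N) \<omega> = b}"
  let ?B = "{\<omega>\<in>space M. \<not> vacated x0 (\<lambda>i. Y i \<omega>) N \<and> b \<noteq> x0 \<and> Y (Suc N) \<omega> = b}"
  have A: "?A a \<in> sets M" for a
  proof -
    have "?A a = {\<omega>\<in>space M. (running x0 D (\<lambda>i. Y i \<omega>) N \<and> Y N \<omega> = a)} \<inter> {\<omega>\<in>space M. Y (Suc N) \<omega> = b}"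
      by auto
    then show ?thesis using past_sets[OF past_running[of N x0 D a]] Y_eq_sets by auto
  qed
  have B: "?B \<in> sets M"
  proof -
    have "?B = (if b = x0 then {} else {\<omega>\<in>space M. \<not> vacated x0 (\<lambda>i. Y i \<omega>) N} \<inter> {\<omega>\<in>space M. Y (Suc N) \<omega> = b})"
      by auto
    then show ?thesis using past_sets[OF past_vacated[of N x0]] Y_eq_sets by auto
  qed
  have "{\<omega>\<in>space M. running x0 D (\<lambda>i. Y i \<omega>) (Suc N) \<and> Y (Suc N) \<omega> = b} = (\<Union>a\<in>S-D. ?A a) \<union> ?B"
  proof (intro set_eqI)
    fix \<omega>
    show "\<omega> \<in> {\<omega>\<in>space M. running x0 D (\<lambda>i. Y i \<omega>) (Suc N) \<and> Y (Suc N) \<omega> = b} \<longleftrightarrow> \<omega> \<in> (\<Union>a\<in>S-D. ?A a) \<union> ?B"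
      unfolding mem_Collect_eq Un_iff UN_iff running_Suc[of x0 D "\<lambda>i. Y i \<omega>" N b]
      using Y_in[of \<omega> N] by auto
  qed
  then have "rho (Suc N) b = measure M ((\<Union>a\<in>S-D. ?A a) \<union> ?B)" by (simp add: rho_def)
  also have "\<dots> = measure M (\<Union>a\<in>S-D. ?A a) + measure M ?B"
    using A B finite_S
    by (intro finite_measure_Union) (auto simp: running_def intro!: sets.finite_UN)
  also have "measure M (\<Union>a\<in>S-D. ?A a) = (\<Sum>a\<in>S-D. measure M (?A a))"
    using A finite_S by (intro finite_measure_finite_Union) (auto simp: disjoint_family_on_def)
  also have "\<dots> = (\<Sum>a\<in>S-D. rho N a * p a b)"
    using b unfolding rho_def by (intro sum.cong refl markov_past[OF past_running]) auto
  also have "measure M ?B = (if b = x0 then 0 else alpha N * p x0 b)"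
    using markov_past[OF past_vacated[of N x0], of x0 b] b by (auto simp: vacated_def alpha_def)
  finally show ?thesis .
qed

lemma first_step_nonneg:
  assumes "\<And>a. a \<in> S \<Longrightarrow> 0 \<le> t a"
  shows "0 \<le> (\<Sum>b\<in>S-{x0}. p x0 b * t b)"
proof (rule sum_nonneg)
  fix b assume b: "b \<in> S - {x0}"
  then have "p x0 b = rho (Suc 0) b" by (simp add: rho_Suc rho_0 alpha_0)
  then show "0 \<le> p x0 b * t b" using rho_nonneg[of "Suc 0" b] assms[of b] b by simp
qed

text \<open>The mean of \<open>g\<close> at the earlier of time \<open>N\<close> and the first hit of \<open>D\<close>, restricted to trajectories
that have left \<open>x0\<close>.\<close>

definition value_at :: "('s \<Rightarrow> real) \<Rightarrow> nat \<Rightarrow> real" where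
  "value_at g N = (\<Sum>k\<le>N. \<Sum>z\<in>D. rho k z * g z) + (\<Sum>a\<in>S-D. rho N a * g a)"

lemma value_0: "value_at g 0 = 0"
  by (simp add: value_at_def rho_0)

lemma value_Suc:
  "value_at g (Suc N) = value_at g N
     + (\<Sum>a\<in>S-D. rho N a * ((\<Sum>b\<in>S. p a b * g b) - g a))
     + p x0 x0 ^ N * (\<Sum>b\<in>S-{x0}. p x0 b * g b)"
proof -
  have "value_at g (Suc N) - value_at g N = (\<Sum>z\<in>D. rho (Suc N) z * g z)
      + (\<Sum>a\<in>S-D. rho (Suc N) a * g a) - (\<Sum>a\<in>S-D. rho N a * g a)"
    by (simp add: value_at_def)
  also have "(\<Sum>z\<in>D. rho (Suc N) z * g z) + (\<Sum>a\<in>S-D. rho (Suc N) a * g a) = (\<Sum>b\<in>S. rho (Suc N) b * g b)"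
    using sum.subset_diff[OF D_subset finite_S, of "\<lambda>b. rho (Suc N) b * g b"] by simp
  also have "\<dots> = (\<Sum>b\<in>S. (\<Sum>a\<in>S-D. rho N a * p a b * g b))
      + (\<Sum>b\<in>S. (if b = x0 then 0 else alpha N * p x0 b * g b))"
    unfolding sum.distrib[symmetric]
    by (rule sum.cong[OF refl]) (simp add: rho_Suc distrib_right sum_distrib_right)
  also have "(\<Sum>b\<in>S. (\<Sum>a\<in>S-D. rho N a * p a b * g b)) = (\<Sum>a\<in>S-D. rho N a * (\<Sum>b\<in>S. p a b * g b))"
    by (subst sum.swap) (simp add: sum_distrib_left mult.assoc)
  also have "(\<Sum>b\<in>S. (if b = x0 then 0 else alpha N * p x0 b * g b)) = (\<Sum>b\<in>S-{x0}. alpha N * p x0 b * g b)"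
    using finite_S x0_in by (subst sum.remove[of S x0]) (auto intro!: sum.cong)
  also have "\<dots> = p x0 x0 ^ N * (\<Sum>b\<in>S-{x0}. p x0 b * g b)"
    by (simp add: alpha_eq sum_distrib_left mult.assoc)
  finally show ?thesis by (simp add: right_diff_distrib sum_subtractf)
qed

lemma exit_prob_sums:
  assumes z: "z \<in> D"
  shows "(\<lambda>N. rho N z) sums \<P>(\<omega> in M. \<exists>N. running x0 D (\<lambda>i. Y i \<omega>) N \<and> Y N \<omega> = z)"
proof -
  let ?A = "\<lambda>N. {\<omega>\<in>space M. running x0 D (\<lambda>i. Y i \<omega>) N \<and> Y N \<omega> = z}"
  have eq: "{\<omega>\<in>space M. \<exists>N. running x0 D (\<lambda>i. Y i \<omega>) N \<and> Y N \<omega> = z} = (\<Union>N. ?A N)" by auto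
  have d: "disjoint_family ?A"
    unfolding disjoint_family_on_def
  proof (intro ballI impI)
    fix m n :: nat assume "m \<noteq> n"
    then show "?A m \<inter> ?A n = {}"
    proof (cases "m < n")
      case True then show ?thesis using z by (auto simp: running_def)
    next
      case False
      with \<open>m \<noteq> n\<close> have "n < m" by simp
      then show ?thesis using z by (auto simp: running_def)
    qed
  qed
  have "range ?A \<subseteq> sets M" using past_sets[OF past_running] by auto
  from finite_measure_UNION[OF this d] show ?thesis unfolding eq rho_def .
qed

text \<open>Summing the increments of \<open>value_at\<close> gives the geometric series of first steps plus an error of at
most \<open>\<epsilon>\<close> per step spent outside \<open>D\<close>. The function \<open>t\<close> loses at least \<open>\<eta>\<close> in each such step and is
nonnegative, so the expected number of these steps is at most \<open>T / \<eta>\<close>; in particular the chain does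
not stay outside \<open>D\<close> for ever, and no mass is lost in the limit.\<close>

theorem exit_estimate:
  assumes p: "p x0 x0 < 1"
    and eps: "\<And>a. a \<in> S - D \<Longrightarrow> \<bar>(\<Sum>b\<in>S. p a b * u b) - u a\<bar> \<le> \<epsilon>"
    and eta: "0 < \<eta>" "\<And>a. a \<in> S - D \<Longrightarrow> (\<Sum>b\<in>S. p a b * t b) - t a \<le> - \<eta>"
    and t: "\<And>a. a \<in> S \<Longrightarrow> 0 \<le> t a" and "0 \<le> \<epsilon>"
    and st: "(\<Sum>b\<in>S-{x0}. p x0 b * t b) / (1 - p x0 x0) \<le> T"
  shows "\<bar>(\<Sum>z\<in>D. \<P>(\<omega> in M. \<exists>N. running x0 D (\<lambda>i. Y i \<omega>) N \<and> Y N \<omega> = z) * u z)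
           - (\<Sum>b\<in>S-{x0}. p x0 b * u b) / (1 - p x0 x0)\<bar> \<le> \<epsilon> * (T / \<eta>)"
proof -
  let ?q = "p x0 x0"
  define m where "m N = (\<Sum>a\<in>S-D. rho N a)" for N
  have m0: "0 \<le> m N" for N unfolding m_def by (intro sum_nonneg rho_nonneg)
  have geo: "(\<lambda>N. \<Sum>k<N. ?q ^ k) \<longlonglongrightarrow> 1 / (1 - ?q)"
    using geometric_sums[of ?q] p p_x0_nonneg by (simp add: sums_def)
  have geo_le: "(\<Sum>k<N. ?q ^ k) \<le> 1 / (1 - ?q)" for N
    using sum_le_suminf[of "\<lambda>k. ?q ^ k" "{..<N}"] p p_x0_nonneg
    by (simp add: suminf_geometric)
  have val: "value_at g N = (\<Sum>k<N. \<Sum>a\<in>S-D. rho k a * ((\<Sum>b\<in>S. p a b * g b) - g a))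
      + (\<Sum>b\<in>S-{x0}. p x0 b * g b) * (\<Sum>k<N. ?q ^ k)" for g N
    by (induction N) (simp_all add: value_0 value_Suc algebra_simps)
  note st0 = first_step_nonneg[of t, OF t]
  have mass: "(\<Sum>k<N. m k) \<le> T / \<eta>" for N
  proof -
    have "0 \<le> value_at t N"
      unfolding value_at_def using t rho_nonneg D_subset
      by (auto intro!: sum_nonneg add_nonneg_nonneg mult_nonneg_nonneg)
    moreover have "(\<Sum>k<N. \<Sum>a\<in>S-D. rho k a * ((\<Sum>b\<in>S. p a b * t b) - t a)) \<le> (\<Sum>k<N. \<Sum>a\<in>S-D. rho k a * (- \<eta>))"
      by (intro sum_mono mult_left_mono eta rho_nonneg)
    moreover have "(\<Sum>k<N. \<Sum>a\<in>S-D. rho k a * (- \<eta>)) = - \<eta> * (\<Sum>k<N. m k)"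
      by (simp add: m_def sum_distrib_left sum_distrib_right[symmetric] sum_negf mult.commute)
    moreover have "(\<Sum>b\<in>S-{x0}. p x0 b * t b) * (\<Sum>k<N. ?q ^ k) \<le> T"
      using mult_left_mono[OF geo_le st0, of N] st by simp
    ultimately have "\<eta> * (\<Sum>k<N. m k) \<le> T"
      using val[of t N] by simp
    then show ?thesis using eta(1) by (simp add: field_simps)
  qed
  have T0: "0 \<le> T" using mass[of 0] eta(1) by (simp add: zero_le_divide_iff)
  have bnd: "\<bar>value_at u N - (\<Sum>b\<in>S-{x0}. p x0 b * u b) * (\<Sum>k<N. ?q ^ k)\<bar> \<le> \<epsilon> * (T / \<eta>)" for N
  proof -
    have "\<bar>value_at u N - (\<Sum>b\<in>S-{x0}. p x0 b * u b) * (\<Sum>k<N. ?q ^ k)\<bar>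
       = \<bar>\<Sum>k<N. \<Sum>a\<in>S-D. rho k a * ((\<Sum>b\<in>S. p a b * u b) - u a)\<bar>" by (simp add: val)
    also have "\<dots> \<le> (\<Sum>k<N. \<Sum>a\<in>S-D. \<bar>rho k a * ((\<Sum>b\<in>S. p a b * u b) - u a)\<bar>)"
      by (rule order_trans[OF sum_abs]) (intro sum_mono sum_abs)
    also have "\<dots> \<le> (\<Sum>k<N. \<Sum>a\<in>S-D. rho k a * \<epsilon>)"
      by (intro sum_mono) (auto simp: abs_mult rho_nonneg intro!: mult_left_mono eps)
    also have "\<dots> = \<epsilon> * (\<Sum>k<N. m k)"
      by (simp add: m_def sum_distrib_left sum_distrib_right[symmetric] mult.commute)
    also have "\<dots> \<le> \<epsilon> * (T / \<eta>)" using mass \<open>0 \<le> \<epsilon>\<close> by (rule mult_left_mono)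
    finally show ?thesis .
  qed
  have "summable m"
    by (rule summableI_nonneg_bounded[OF m0 mass])
  then have m_lim: "m \<longlonglongrightarrow> 0" by (rule summable_LIMSEQ_zero)
  have rho_lim: "(\<lambda>N. rho N a) \<longlonglongrightarrow> 0" if "a \<in> S - D" for a
  proof (rule tendsto_sandwich[OF _ _ tendsto_const m_lim])
    show "\<forall>\<^sub>F N in sequentially. rho N a \<le> m N"
      using that finite_S rho_nonneg by (auto simp: m_def intro!: always_eventually member_le_sum)
  qed (simp add: rho_nonneg)
  have "(\<lambda>N. (\<Sum>z\<in>D. (\<Sum>k<N. rho k z) * u z)) \<longlonglongrightarrow>
      (\<Sum>z\<in>D. \<P>(\<omega> in M. \<exists>N. running x0 D (\<lambda>i. Y i \<omega>) N \<and> Y N \<omega> = z) * u z)"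
    using exit_prob_sums by (intro tendsto_sum tendsto_mult tendsto_const) (auto simp: sums_def)
  then have "(\<lambda>N. (\<Sum>z\<in>D. (\<Sum>k<Suc N. rho k z) * u z)) \<longlonglongrightarrow>
      (\<Sum>z\<in>D. \<P>(\<omega> in M. \<exists>N. running x0 D (\<lambda>i. Y i \<omega>) N \<and> Y N \<omega> = z) * u z)"
    by (rule LIMSEQ_Suc)
  moreover have "(\<Sum>z\<in>D. (\<Sum>k<Suc N. rho k z) * u z) = (\<Sum>k\<le>N. \<Sum>z\<in>D. rho k z * u z)" for N
    by (subst sum.swap) (simp add: sum_distrib_right lessThan_Suc_atMost)
  ultimately have l1: "(\<lambda>N. \<Sum>k\<le>N. \<Sum>z\<in>D. rho k z * u z) \<longlonglongrightarrow>
      (\<Sum>z\<in>D. \<P>(\<omega> in M. \<exists>N. running x0 D (\<lambda>i. Y i \<omega>) N \<and> Y N \<omega> = z) * u z)" by simp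
  have "(\<lambda>N. \<Sum>a\<in>S-D. rho N a * u a) \<longlonglongrightarrow> (\<Sum>a\<in>S-D. 0 * u a)"
    by (intro tendsto_sum tendsto_mult tendsto_const rho_lim)
  from tendsto_add[OF l1 this]
  have l2: "(\<lambda>N. value_at u N) \<longlonglongrightarrow>
      (\<Sum>z\<in>D. \<P>(\<omega> in M. \<exists>N. running x0 D (\<lambda>i. Y i \<omega>) N \<and> Y N \<omega> = z) * u z)"
    unfolding value_at_def by simp
  have "(\<lambda>N. \<bar>value_at u N - (\<Sum>b\<in>S-{x0}. p x0 b * u b) * (\<Sum>k<N. ?q ^ k)\<bar>) \<longlonglongrightarrow>
     \<bar>(\<Sum>z\<in>D. \<P>(\<omega> in M. \<exists>N. running x0 D (\<lambda>i. Y i \<omega>) N \<and> Y N \<omega> = z) * u z)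
        - (\<Sum>b\<in>S-{x0}. p x0 b * u b) * (1 / (1 - ?q))\<bar>"
    by (intro tendsto_rabs tendsto_diff tendsto_mult tendsto_const l2 geo)
  from tendsto_upperbound[OF this always_eventually] bnd show ?thesis by simp
qed

end

section \<open>Short-time expansion of the semigroup\<close>

text \<open>The generator acting on functions; off the diagonal it has entries \<open>c x y\<close>.\<close>

definition gen_op :: "'s set \<Rightarrow> ('s \<Rightarrow> 's \<Rightarrow> real) \<Rightarrow> ('s \<Rightarrow> real) \<Rightarrow> 's \<Rightarrow> real" where
  "gen_op S c u x = (\<Sum>y\<in>S-{x}. c x y * (u y - u x))"

lemma generator_sum:
  assumes "finite S" "x \<in> S"
  shows "(\<Sum>y\<in>S. generator S c x y * u y) = gen_op S c u x"
proof -
  have "(\<Sum>y\<in>S. generator S c x y * u y) = generator S c x x * u x + (\<Sum>y\<in>S-{x}. generator S c x y * u y)"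
    using assms by (rule sum.remove)
  also have "(\<Sum>y\<in>S-{x}. generator S c x y * u y) = (\<Sum>y\<in>S-{x}. c x y * u y)"
    by (intro sum.cong) (auto simp: generator_def)
  finally show ?thesis
    by (simp add: gen_op_def generator_def right_diff_distrib sum_subtractf sum_distrib_right)
qed

lemma generator_power_bound:
  assumes S: "finite S" and K: "K = (\<Sum>x\<in>S. \<Sum>z\<in>S. \<bar>generator S c x z\<bar>)"
    and x: "x \<in> S"
  shows "\<bar>generator_power S c k x y\<bar> \<le> K ^ k"
  using x
proof (induction k arbitrary: x)
  case (Suc k)
  have K0: "0 \<le> K" unfolding K by (intro sum_nonneg) auto
  have "\<bar>generator_power S c (Suc k) x y\<bar> \<le> (\<Sum>z\<in>S. \<bar>generator S c x z\<bar> * \<bar>generator_power S c k z y\<bar>)"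
    by (simp add: abs_mult[symmetric] sum_abs)
  also have "\<dots> \<le> (\<Sum>z\<in>S. \<bar>generator S c x z\<bar> * K ^ k)"
    by (intro sum_mono mult_left_mono Suc.IH) auto
  also have "\<dots> = (\<Sum>z\<in>S. \<bar>generator S c x z\<bar>) * K ^ k" by (simp add: sum_distrib_right)
  also have "\<dots> \<le> K * K ^ k"
    unfolding K using S Suc.prems K0 K
    by (intro mult_right_mono member_le_sum[where f = "\<lambda>x. \<Sum>z\<in>S. \<bar>generator S c x z\<bar>"])
       (auto intro!: sum_nonneg)
  finally show ?case by simp
qed simp

text \<open>The exponential series from its quadratic term on.\<close>

lemma transition_prob_expansion:
  assumes S: "finite S"
  obtains K where "0 \<le> K" "\<And>d x y. \<lbrakk>0 \<le> d; d \<le> 1; x \<in> S; y \<in> S\<rbrakk> \<Longrightarrow>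
    \<bar>transition_prob S c d x y - (if x = y then 1 else 0) - d * generator S c x y\<bar> \<le> K * d\<^sup>2"
proof -
  define K where "K = (\<Sum>x\<in>S. \<Sum>z\<in>S. \<bar>generator S c x z\<bar>)"
  have K0: "0 \<le> K" unfolding K_def by (intro sum_nonneg) auto
  show thesis
  proof (rule that[of "K\<^sup>2 * exp K"])
    fix d :: real and x y assume d: "0 \<le> d" "d \<le> 1" and x: "x \<in> S" and y: "y \<in> S"
    define f where "f k = d ^ k / fact k * generator_power S c k x y" for k
    have ex: "(\<lambda>k. a ^ k / fact k) sums exp a" for a :: real
      using exp_converges[of a] by (simp add: field_simps)
    have bnd: "\<bar>f k\<bar> \<le> (d * K) ^ k / fact k" for k
      using generator_power_bound[OF S K_def x, of k y] d
      by (simp add: f_def abs_mult power_mult_distrib divide_simps mult_left_mono)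
    have sf: "summable f"
      by (rule summable_comparison_test[OF _ sums_summable[OF ex[of "d * K"]]]) (use bnd in auto)
    have bnd2: "\<bar>f (k + 2)\<bar> \<le> d\<^sup>2 * K\<^sup>2 * (K ^ k / fact k)" for k
    proof -
      have "\<bar>f (k + 2)\<bar> \<le> (d * K) ^ (k + 2) / fact (k + 2)" by (rule bnd)
      also have "\<dots> \<le> (d * K) ^ (k + 2) / fact k"
        using d K0 by (intro divide_left_mono fact_mono) auto
      also have "\<dots> = d\<^sup>2 * K\<^sup>2 * (d ^ k * K ^ k / fact k)"
        by (simp add: power_mult_distrib power2_eq_square)
      also have "\<dots> \<le> d\<^sup>2 * K\<^sup>2 * (1 * K ^ k / fact k)"
        using d K0 by (intro mult_left_mono divide_right_mono mult_right_mono power_le_one) auto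
      finally show ?thesis by simp
    qed
    have s2: "(\<lambda>k. d\<^sup>2 * K\<^sup>2 * (K ^ k / fact k)) sums (d\<^sup>2 * K\<^sup>2 * exp K)"
      by (intro sums_mult ex)
    have tail: "suminf f = (\<Sum>k. f (k + 2)) + (f 0 + f 1)"
      using suminf_split_initial_segment[OF sf, of 2] by (simp add: numeral_2_eq_2)
    have f1: "f 1 = d * generator S c x y"
      using y S by (simp add: f_def sum.delta if_distrib[where f="\<lambda>u. _ * u"] cong: if_cong)
    have "transition_prob S c d x y - (if x = y then 1 else 0) - d * generator S c x y = (\<Sum>k. f (k + 2))"
      using tail f1 by (simp add: transition_prob_def f_def[abs_def])
    moreover have "\<bar>\<Sum>k. f (k + 2)\<bar> \<le> d\<^sup>2 * K\<^sup>2 * exp K"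
    proof -
      have sa: "summable (\<lambda>k. \<bar>f (k + 2)\<bar>)"
        by (rule summable_comparison_test[OF _ sums_summable[OF s2]]) (use bnd2 in auto)
      have "\<bar>\<Sum>k. f (k + 2)\<bar> \<le> (\<Sum>k. \<bar>f (k + 2)\<bar>)" by (rule summable_rabs[OF sa])
      also have "\<dots> \<le> d\<^sup>2 * K\<^sup>2 * exp K"
        using suminf_le[OF bnd2 sa sums_summable[OF s2]] sums_unique[OF s2] by simp
      finally show ?thesis .
    qed
    ultimately show "\<bar>transition_prob S c d x y - (if x = y then 1 else 0) - d * generator S c x y\<bar>
        \<le> K\<^sup>2 * exp K * d\<^sup>2" by (simp add: mult_ac)
  qed (use K0 in simp)
qed

lemma transition_prob_apply:
  assumes S: "finite S"
  obtains K where "0 \<le> K" "\<And>d x. \<lbrakk>0 \<le> d; d \<le> 1; x \<in> S\<rbrakk> \<Longrightarrow>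
    \<bar>(\<Sum>y\<in>S. transition_prob S c d x y * u y) - u x - d * gen_op S c u x\<bar> \<le> K * d\<^sup>2"
proof -
  obtain K where K: "0 \<le> K" "\<And>d x y. \<lbrakk>0 \<le> d; d \<le> 1; x \<in> S; y \<in> S\<rbrakk> \<Longrightarrow>
    \<bar>transition_prob S c d x y - (if x = y then 1 else 0) - d * generator S c x y\<bar> \<le> K * d\<^sup>2"
    using transition_prob_expansion[OF S] by blast
  show thesis
  proof (rule that[of "K * (\<Sum>y\<in>S. \<bar>u y\<bar>)"])
    show "0 \<le> K * (\<Sum>y\<in>S. \<bar>u y\<bar>)" using K(1) by (simp add: sum_nonneg)
    fix d :: real and x assume d: "0 \<le> d" "d \<le> 1" and x: "x \<in> S"
    have "(\<Sum>y\<in>S. (if x = y then 1 else 0) * u y) = u x"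
      using S x by (simp add: if_distrib[where f="\<lambda>v. v * _"] cong: if_cong)
    moreover have "d * gen_op S c u x = (\<Sum>y\<in>S. d * generator S c x y * u y)"
      unfolding generator_sum[OF S x, symmetric] by (simp add: sum_distrib_left mult.assoc)
    ultimately have "(\<Sum>y\<in>S. transition_prob S c d x y * u y) - u x - d * gen_op S c u x
       = (\<Sum>y\<in>S. (transition_prob S c d x y - (if x = y then 1 else 0) - d * generator S c x y) * u y)"
      by (simp add: left_diff_distrib sum_subtractf)
    also have "\<bar>\<dots>\<bar> \<le> (\<Sum>y\<in>S. \<bar>transition_prob S c d x y - (if x = y then 1 else 0) - d * generator S c x y\<bar> * \<bar>u y\<bar>)"
      by (simp add: abs_mult[symmetric] sum_abs)
    also have "\<dots> \<le> (\<Sum>y\<in>S. K * d\<^sup>2 * \<bar>u y\<bar>)"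
      using K(2) d x by (intro sum_mono mult_right_mono) auto
    finally show "\<bar>(\<Sum>y\<in>S. transition_prob S c d x y * u y) - u x - d * gen_op S c u x\<bar>
       \<le> K * (\<Sum>y\<in>S. \<bar>u y\<bar>) * d\<^sup>2" by (simp add: sum_distrib_left mult_ac)
  qed
qed

section \<open>Hitting times of right-constant paths\<close>

definition right_const :: "(real \<Rightarrow> 's) \<Rightarrow> bool" where
  "right_const f \<longleftrightarrow> (\<forall>t\<ge>0. eventually (\<lambda>s. f s = f t) (at_right t))"

text \<open>Compared with the definition of \<open>hitting_time\<close>, the vacating time \<open>s\<close> may coincide with \<open>t\<close>. The
infimum does not change, and for right-constant paths it is now attained.\<close>

definition visits :: "(real \<Rightarrow> 's) \<Rightarrow> 's set \<Rightarrow> real set" where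
  "visits f D = {t. 0 \<le> t \<and> f t \<in> D \<and> (\<exists>s. 0 \<le> s \<and> s \<le> t \<and> f s \<noteq> f 0)}"

lemma right_constD:
  assumes "right_const f" "0 \<le> t"
  obtains e where "0 < e" "\<And>s. \<lbrakk>t \<le> s; s < t + e\<rbrakk> \<Longrightarrow> f s = f t"
proof -
  obtain b where b: "t < b" "\<And>s. \<lbrakk>t < s; s < b\<rbrakk> \<Longrightarrow> f s = f t"
    using assms unfolding right_const_def eventually_at_right_field by blast
  show thesis
  proof (rule that[of "b - t"])
    fix s assume "t \<le> s" "s < t + (b - t)"
    then show "f s = f t" using b(2)[of s] by (cases "s = t") auto
  qed (use b in simp)
qed

lemma visits_has_min:
  assumes f: "right_const f" and ne: "visits f D \<noteq> {}"
  obtains \<tau> where "\<tau> \<in> visits f D" "\<And>t. t \<in> visits f D \<Longrightarrow> \<tau> \<le> t"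
proof -
  define \<tau> where "\<tau> = Inf (visits f D)"
  have bdd: "bdd_below (visits f D)" by (rule bdd_belowI[of _ 0]) (auto simp: visits_def)
  have le: "\<tau> \<le> t" if "t \<in> visits f D" for t
    unfolding \<tau>_def by (rule cInf_lower[OF that bdd])
  have "0 \<le> \<tau>" unfolding \<tau>_def by (rule cInf_greatest[OF ne]) (auto simp: visits_def)
  then obtain e where e: "0 < e" "\<And>s. \<lbrakk>\<tau> \<le> s; s < \<tau> + e\<rbrakk> \<Longrightarrow> f s = f \<tau>"
    using right_constD[OF f] by blast
  obtain t where t: "t \<in> visits f D" "t < \<tau> + e"
    using cInf_lessD[OF ne, of "\<tau> + e"] e unfolding \<tau>_def by auto
  then obtain s where s: "0 \<le> s" "s \<le> t" "f s \<noteq> f 0" and ft: "f t \<in> D" by (auto simp: visits_def)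
  have "f t = f \<tau>" using e(2)[of t] le[OF t(1)] t(2) by simp
  have "\<exists>s. 0 \<le> s \<and> s \<le> \<tau> \<and> f s \<noteq> f 0"
  proof (cases "s \<le> \<tau>")
    case False
    then have "f s = f \<tau>" using e(2)[of s] s t by simp
    then show ?thesis using s \<open>0 \<le> \<tau>\<close> by force
  qed (use s in blast)
  then have "\<tau> \<in> visits f D" using \<open>0 \<le> \<tau>\<close> \<open>f t = f \<tau>\<close> ft by (simp add: visits_def)
  then show thesis using that le by blast
qed

lemma hitting_time_no_visit:
  assumes "visits (\<lambda>t. X t \<omega>) D = {}"
  shows "hitting_time X D \<omega> = \<infinity>"
proof -
  have "{t. 0 < t \<and> X t \<omega> \<in> D \<and> (\<exists>s. 0 < s \<and> s < t \<and> X s \<omega> \<noteq> X 0 \<omega>)} \<subseteq> visits (\<lambda>t. X t \<omega>) D"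
    unfolding visits_def using less_imp_le by blast
  then have "{t. 0 < t \<and> X t \<omega> \<in> D \<and> (\<exists>s. 0 < s \<and> s < t \<and> X s \<omega> \<noteq> X 0 \<omega>)} = {}"
    using assms by blast
  then show ?thesis
    unfolding hitting_time_def by (simp only: image_empty) (simp add: top_ereal_def)
qed

text \<open>The path stays in \<open>D\<close> for a while after \<open>\<tau>\<close>, so there are admissible times \<open>t > \<tau>\<close> arbitrarily
close to \<open>\<tau>\<close> for which \<open>s < t\<close> is strict.\<close>

lemma hitting_time_eq_min:
  assumes f: "right_const (\<lambda>t. X t \<omega>)" and tau: "\<tau> \<in> visits (\<lambda>t. X t \<omega>) D"
    and min: "\<And>t. t \<in> visits (\<lambda>t. X t \<omega>) D \<Longrightarrow> \<tau> \<le> t"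
  shows "hitting_time X D \<omega> = ereal \<tau>"
proof -
  let ?H = "{t. 0 < t \<and> X t \<omega> \<in> D \<and> (\<exists>s. 0 < s \<and> s < t \<and> X s \<omega> \<noteq> X 0 \<omega>)}"
  have sub: "?H \<subseteq> visits (\<lambda>t. X t \<omega>) D"
    unfolding visits_def using less_imp_le by blast
  from tau obtain s where s: "0 \<le> s" "s \<le> \<tau>" "X s \<omega> \<noteq> X 0 \<omega>" and D: "X \<tau> \<omega> \<in> D" and t0: "0 \<le> \<tau>"
    by (auto simp: visits_def)
  have s0: "0 < s" using s by (cases "s = 0") auto
  obtain e where e: "0 < e" "\<And>s. \<lbrakk>\<tau> \<le> s; s < \<tau> + e\<rbrakk> \<Longrightarrow> X s \<omega> = X \<tau> \<omega>"
    using right_constD[OF f t0] by blast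
  show ?thesis
  proof (rule antisym)
    show "ereal \<tau> \<le> hitting_time X D \<omega>"
      unfolding hitting_time_def using sub min by (auto intro!: Inf_greatest)
    show "hitting_time X D \<omega> \<le> ereal \<tau>"
    proof (rule ereal_le_epsilon2)
      fix d :: real assume "0 < d"
      \<comment> \<open>a time after \<open>\<tau>\<close>, still within the interval of constancy and within the tolerance\<close>
      define t where "t = \<tau> + min d e / 2"
      have "\<tau> < t" "t < \<tau> + e" "t \<le> \<tau> + d" using \<open>0 < d\<close> e(1) by (auto simp: t_def min_def)
      then have "t \<in> ?H" using e(2)[of t] D s s0 by force
      then have "hitting_time X D \<omega> \<le> ereal t" unfolding hitting_time_def by (intro Inf_lower) blast
      also have "\<dots> \<le> ereal \<tau> + ereal d" using \<open>t \<le> \<tau> + d\<close> by simp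
      finally show "hitting_time X D \<omega> \<le> ereal \<tau> + ereal d" .
    qed
  qed
qed

section \<open>From time grids to continuous time\<close>

abbreviation mesh :: "nat \<Rightarrow> real" where "mesh m \<equiv> inverse (real (Suc m))"

lemma past_running_start: "determined_by N (\<lambda>y. running (y 0) D y N \<and> y N = b)"
  unfolding determined_by_def
proof (intro allI impI)
  fix a c :: "nat \<Rightarrow> 'a" assume e: "\<forall>i\<le>N. a i = c i"
  then have "a 0 = c 0" by simp
  moreover have "(running (a 0) D a N \<and> a N = b) = (running (a 0) D c N \<and> c N = b)"
    by (rule past_running[of N "a 0" D b, unfolded determined_by_def, rule_format]) (use e in simp)
  ultimately show "(running (a 0) D a N \<and> a N = b) = (running (c 0) D c N \<and> c N = b)" by simp
qed

text \<open>Let \<open>\<tau>\<close> be the first visit and \<open>s \<le> \<tau>\<close> a time at which the initial value has been left. Once the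
mesh is smaller than the lengths of the intervals of constancy that start at \<open>s\<close> and at \<open>\<tau>\<close>, the
grid sees both values, and the first grid point at or after \<open>\<tau>\<close> is the first hit on the grid: hits on
the grid are visits, so there is none before \<open>\<tau>\<close>. Accumulation of jumps from the left is harmless.\<close>

lemma grid_first_hit:
  fixes f :: "real \<Rightarrow> 's"
  assumes f: "right_const f" and z: "z \<in> D"
  shows "\<forall>\<^sub>F m in sequentially.
    (\<exists>N. running (f 0) D (\<lambda>i. f (real i * mesh m)) N \<and> f (real N * mesh m) = z)
      \<longleftrightarrow> (\<exists>\<tau>. \<tau> \<in> visits f D \<and> (\<forall>t\<in>visits f D. \<tau> \<le> t) \<and> f \<tau> = z)"
proof -
  have grid_visit: "real N * d \<in> visits f D"
    if d0: "0 < d" and v: "vacated (f 0) (\<lambda>i. f (real i * d)) N" and D: "f (real N * d) \<in> D" for d N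
  proof -
    obtain i where i: "i \<le> N" "f (real i * d) \<noteq> f 0" using v by (auto simp: vacated_def)
    have "real i * d \<le> real N * d" using i(1) d0 by simp
    then show ?thesis using d0 D i unfolding visits_def by (auto intro!: exI[of _ "real i * d"])
  qed
  show ?thesis
  proof (cases "visits f D = {}")
    case True
    have "\<not> (\<exists>N. running (f 0) D (\<lambda>i. f (real i * mesh m)) N \<and> f (real N * mesh m) = z)" for m
    proof
      assume "\<exists>N. running (f 0) D (\<lambda>i. f (real i * mesh m)) N \<and> f (real N * mesh m) = z"
      then obtain N where "vacated (f 0) (\<lambda>i. f (real i * mesh m)) N" "f (real N * mesh m) = z"
        by (auto simp: running_def)
      then show False using grid_visit[of "mesh m" N] z True by simp
    qed
    then show ?thesis using True by simp
  next
    case False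
    obtain \<tau> where \<tau>: "\<tau> \<in> visits f D" "\<And>t. t \<in> visits f D \<Longrightarrow> \<tau> \<le> t"
      using visits_has_min[OF f False] by blast
    obtain s where s: "0 \<le> s" "s \<le> \<tau>" "f s \<noteq> f 0" and D: "f \<tau> \<in> D" and t0: "0 \<le> \<tau>"
      using \<tau>(1) by (auto simp: visits_def)
    obtain e where e: "0 < e" "\<And>t. \<lbrakk>\<tau> \<le> t; t < \<tau> + e\<rbrakk> \<Longrightarrow> f t = f \<tau>"
      using right_constD[OF f t0] by blast
    obtain e' where e': "0 < e'" "\<And>t. \<lbrakk>s \<le> t; t < s + e'\<rbrakk> \<Longrightarrow> f t = f s"
      using right_constD[OF f s(1)] by blast
    have rhs: "(\<exists>\<tau>. \<tau> \<in> visits f D \<and> (\<forall>t\<in>visits f D. \<tau> \<le> t) \<and> f \<tau> = z) \<longleftrightarrow> f \<tau> = z"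
      using \<tau> by (metis order_antisym)
    have "\<forall>\<^sub>F m in sequentially. mesh m < min e e'"
      using LIMSEQ_inverse_real_of_nat e e' by (intro order_tendstoD) auto
    then show ?thesis
    proof eventually_elim
      case (elim m)
      define d where "d = mesh m"
      have d: "0 < d" "d < e" "d < e'" using elim by (auto simp: d_def)
      have ceil: "t \<le> real (nat \<lceil>t / d\<rceil>) * d \<and> real (nat \<lceil>t / d\<rceil>) * d < t + d" if "0 \<le> t" for t
      proof -
        have "0 \<le> t / d" using that d by simp
        then have "0 \<le> \<lceil>t / d\<rceil>" by linarith
        then have "real (nat \<lceil>t / d\<rceil>) = real_of_int \<lceil>t / d\<rceil>" by simp
        moreover have "t / d \<le> real_of_int \<lceil>t / d\<rceil>" "real_of_int \<lceil>t / d\<rceil> < t / d + 1" by linarith+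
        moreover from le_of_int_ceiling[of "t / d"] have "t \<le> real_of_int \<lceil>t / d\<rceil> * d"
          using d by (simp only: pos_divide_le_eq)
        ultimately show ?thesis using d by (simp add: field_simps)
      qed
      define j where "j = nat \<lceil>\<tau> / d\<rceil>"
      define i where "i = nat \<lceil>s / d\<rceil>"
      have ij: "i \<le> j" unfolding i_def j_def using s(2) d by (intro nat_mono ceiling_mono divide_right_mono) auto
      have fj: "f (real j * d) = f \<tau>" using ceil[OF t0] e(2)[of "real j * d"] d unfolding j_def by auto
      have fi: "f (real i * d) = f s" using ceil[OF s(1)] e'(2)[of "real i * d"] d unfolding i_def by auto
      have vj: "vacated (f 0) (\<lambda>i. f (real i * d)) j" using ij fi s(3) unfolding vacated_def by metis
      have before: "l < j \<Longrightarrow> \<not> (f (real l * d) \<in> D \<and> vacated (f 0) (\<lambda>i. f (real i * d)) l)" for l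
      proof
        assume l: "l < j" and "f (real l * d) \<in> D \<and> vacated (f 0) (\<lambda>i. f (real i * d)) l"
        then have "\<tau> \<le> real l * d" using grid_visit[OF d(1)] \<tau>(2) by blast
        then have "\<tau> / d \<le> real l" using d by (simp add: field_simps)
        then have "\<lceil>\<tau> / d\<rceil> \<le> int l" by linarith
        then show False using l unfolding j_def by linarith
      qed
      have run_j: "running (f 0) D (\<lambda>i. f (real i * d)) j" using vj before by (simp add: running_def)
      have "(\<exists>N. running (f 0) D (\<lambda>i. f (real i * d)) N \<and> f (real N * d) = z) \<longleftrightarrow> f \<tau> = z"
      proof
        assume "\<exists>N. running (f 0) D (\<lambda>i. f (real i * d)) N \<and> f (real N * d) = z"
        then obtain N where N: "running (f 0) D (\<lambda>i. f (real i * d)) N" "f (real N * d) = z" by blast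
        have "\<not> j < N" using N(1) vj fj D unfolding running_def by metis
        moreover have "\<not> N < j" using before[of N] N z unfolding running_def by blast
        ultimately have "N = j" by simp
        then show "f \<tau> = z" using N fj by simp
      qed (use run_j fj in auto)
      then show ?case unfolding rhs d_def .
    qed
  qed
qed

lemma exits_at_iff_visit:
  assumes f: "right_const (\<lambda>t. X t \<omega>)"
  shows "(hitting_time X D \<omega> < \<infinity> \<and> X (real_of_ereal (hitting_time X D \<omega>)) \<omega> = z) \<longleftrightarrow>
    (\<exists>\<tau>. \<tau> \<in> visits (\<lambda>t. X t \<omega>) D \<and> (\<forall>t\<in>visits (\<lambda>t. X t \<omega>) D. \<tau> \<le> t) \<and> X \<tau> \<omega> = z)"
proof (cases "visits (\<lambda>t. X t \<omega>) D = {}")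
  case True
  then show ?thesis using hitting_time_no_visit[of X \<omega> D] by simp
next
  case False
  obtain \<tau> where \<tau>: "\<tau> \<in> visits (\<lambda>t. X t \<omega>) D" "\<And>t. t \<in> visits (\<lambda>t. X t \<omega>) D \<Longrightarrow> \<tau> \<le> t"
    using visits_has_min[OF f False] by blast
  have "hitting_time X D \<omega> = ereal \<tau>" using hitting_time_eq_min[of X \<omega> \<tau> D] f \<tau> by blast
  moreover have "(\<tau>' \<in> visits (\<lambda>t. X t \<omega>) D \<and> (\<forall>t\<in>visits (\<lambda>t. X t \<omega>) D. \<tau>' \<le> t)) \<longleftrightarrow> \<tau>' = \<tau>" for \<tau>'
    using \<tau> by (metis order_antisym)
  ultimately show ?thesis by (simp flip: conj_assoc)
qed

definition exit_event :: "'w measure \<Rightarrow> (real \<Rightarrow> 'w \<Rightarrow> 's) \<Rightarrow> 's set \<Rightarrow> 's \<Rightarrow> 'w set" where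
  "exit_event M X D z = {\<omega>\<in>space M. hitting_time X D \<omega> < \<infinity> \<and> X (real_of_ereal (hitting_time X D \<omega>)) \<omega> = z}"

lemma markov_process_grid:
  assumes mp: "markov_process M X S c x0" and S: "finite S" "D \<subseteq> S" "x0 \<in> S" and d: "0 < d"
  shows "exit_chain M (\<lambda>i. X (real i * d)) S D (transition_prob S c d) x0"
proof -
  interpret prob_space M using mp by (simp add: markov_process_def)
  show ?thesis
  proof unfold_locales
    show "finite S" "D \<subseteq> S" "x0 \<in> S" by fact+
    show "X (real i * d) \<in> measurable M (count_space S)" for i
      using mp d by (simp add: markov_process_def)
    show "AE \<omega> in M. X (real 0 * d) \<omega> = x0" using mp by (simp add: markov_process_def)
    fix k :: nat and a y assume a: "\<And>i. i \<le> k \<Longrightarrow> a i \<in> S" and y: "y \<in> S"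
    have m: "0 \<le> t 0 \<and> strict_mono_on {..k} t \<and> (\<forall>i\<le>k. a i \<in> S) \<and> 0 \<le> s \<and> y \<in> S \<longrightarrow>
        \<P>(\<omega> in M. (\<forall>i\<le>k. X (t i) \<omega> = a i) \<and> X (t k + s) \<omega> = y) =
        \<P>(\<omega> in M. \<forall>i\<le>k. X (t i) \<omega> = a i) * transition_prob S c s (a k) y" for t :: "nat \<Rightarrow> real" and s
      using mp unfolding markov_process_def by blast
    have "strict_mono_on {..k} (\<lambda>i. real i * d)" using d by (simp add: strict_mono_on_def)
    moreover have "real k * d + d = real (Suc k) * d" by (simp add: algebra_simps)
    ultimately show "\<P>(\<omega> in M. (\<forall>i\<le>k. X (real i * d) \<omega> = a i) \<and> X (real (Suc k) * d) \<omega> = y) =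
        \<P>(\<omega> in M. \<forall>i\<le>k. X (real i * d) \<omega> = a i) * transition_prob S c d (a k) y"
      using m[of "\<lambda>i. real i * d" d] a y d by simp
  qed
qed

lemma markov_process_right_const:
  "\<lbrakk>markov_process M X S c x0; \<omega> \<in> space M\<rbrakk> \<Longrightarrow> right_const (\<lambda>t. X t \<omega>)"
  by (simp add: markov_process_def right_const_def)

lemma grid_exit_eventually:
  assumes mp: "markov_process M X S c x0" and z: "z \<in> D" and w: "\<omega> \<in> space M"
  shows "\<forall>\<^sub>F m in sequentially.
    (\<exists>N. running (X 0 \<omega>) D (\<lambda>i. X (real i * mesh m) \<omega>) N \<and>
         X (real N * mesh m) \<omega> = z) \<longleftrightarrow> \<omega> \<in> exit_event M X D z"
proof -
  note rc = markov_process_right_const[OF mp w]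
  show ?thesis
    using grid_first_hit[of "\<lambda>t. X t \<omega>", OF rc z]
    unfolding exit_event_def mem_Collect_eq exits_at_iff_visit[of X \<omega>, OF rc]
    by (simp only: w simp_thms)
qed

lemma sets_of_eventually_iff:
  assumes G: "\<And>m :: nat. G m \<in> sets M" and B: "B \<subseteq> space M"
    and ev: "\<And>\<omega>. \<omega> \<in> space M \<Longrightarrow> \<forall>\<^sub>F m in sequentially. \<omega> \<in> G m \<longleftrightarrow> \<omega> \<in> B"
  shows "B \<in> sets M"
proof -
  have "B = {\<omega>\<in>space M. \<exists>k. \<forall>m. k \<le> m \<longrightarrow> \<omega> \<in> G m}"
  proof (intro set_eqI iffI)
    fix \<omega> assume "\<omega> \<in> B"
    moreover from this have "\<omega> \<in> space M" using B by blast
    ultimately show "\<omega> \<in> {\<omega>\<in>space M. \<exists>k. \<forall>m. k \<le> m \<longrightarrow> \<omega> \<in> G m}"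
      using ev[of \<omega>] by (simp add: eventually_sequentially)
  next
    fix \<omega> assume w: "\<omega> \<in> {\<omega>\<in>space M. \<exists>k. \<forall>m. k \<le> m \<longrightarrow> \<omega> \<in> G m}"
    then have "\<forall>\<^sub>F m in sequentially. \<omega> \<in> G m" by (simp add: eventually_sequentially)
    moreover have "\<forall>\<^sub>F m in sequentially. \<omega> \<in> G m \<longleftrightarrow> \<omega> \<in> B" using ev w by blast
    ultimately have "\<forall>\<^sub>F m in sequentially. \<omega> \<in> B" by eventually_elim simp
    then show "\<omega> \<in> B" by simp
  qed
  also have "\<dots> = {\<omega>\<in>space M. \<exists>k. \<forall>m\<in>{k..}. \<omega> \<in> G m}" by auto
  also have "\<dots> \<in> sets M"
  proof (intro sets.sets_Collect_countable_Ex sets.sets_Collect_countable_Ball)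
    show "{\<omega>\<in>space M. \<omega> \<in> G m} \<in> sets M" for m
      using G[of m] sets.sets_into_space[OF G[of m]] by (simp add: Collect_conj_eq Int_absorb1)
  qed
  finally show ?thesis .
qed

text \<open>Membership is the eventual value of events that depend on countably many grid points, whence the
measurability.\<close>

lemma exit_event_sets:
  assumes mp: "markov_process M X S c x0" and S: "finite S" "D \<subseteq> S" "x0 \<in> S" and z: "z \<in> D"
  shows "exit_event M X D z \<in> sets M"
proof (rule sets_of_eventually_iff)
  define Q where "Q m N \<omega> \<longleftrightarrow> running (X 0 \<omega>) D (\<lambda>i. X (real i * mesh m) \<omega>) N \<and>
         X (real N * mesh m) \<omega> = z" for m N :: nat and \<omega>
  have Q: "{\<omega>\<in>space M. Q m N \<omega>} \<in> sets M" for m N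
  proof -
    interpret exit_chain M "\<lambda>i. X (real i * mesh m)" S D "transition_prob S c (mesh m)" x0
      by (rule markov_process_grid[OF mp S]) simp
    show ?thesis unfolding Q_def using past_sets[OF past_running_start[of N D z]]
      by (simp only: of_nat_0 mult_zero_left)
  qed
  then show "{\<omega>\<in>space M. \<exists>N. Q m N \<omega>} \<in> sets M" for m
    by (rule sets.sets_Collect_countable_Ex)
  show "exit_event M X D z \<subseteq> space M" by (simp add: exit_event_def)
  fix \<omega> assume w: "\<omega> \<in> space M"
  show "\<forall>\<^sub>F m in sequentially. \<omega> \<in> {\<omega>\<in>space M. \<exists>N. Q m N \<omega>} \<longleftrightarrow> \<omega> \<in> exit_event M X D z"
    using grid_exit_eventually[OF mp z w] by (simp only: Q_def mem_Collect_eq w simp_thms)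
qed

lemma (in prob_space) prob_tendsto_of_eventually:
  assumes A: "\<And>m. A m \<in> sets M" and B: "B \<in> sets M"
    and ev: "AE \<omega> in M. \<forall>\<^sub>F m in sequentially. \<omega> \<in> A m \<longleftrightarrow> \<omega> \<in> B"
  shows "(\<lambda>m. prob (A m)) \<longlonglongrightarrow> prob B"
proof -
  have "(\<lambda>m. \<integral>\<omega>. (indicator (A m) \<omega> :: real) \<partial>M) \<longlonglongrightarrow> (\<integral>\<omega>. indicator B \<omega> \<partial>M)"
  proof (rule integral_dominated_convergence[where w = "\<lambda>_. 1"])
    show "AE \<omega> in M. (\<lambda>m. indicator (A m) \<omega> :: real) \<longlonglongrightarrow> indicator B \<omega>"
      using ev
    proof eventually_elim
      case (elim \<omega>)
      then have "\<forall>\<^sub>F m in sequentially. (indicator (A m) \<omega> :: real) = indicator B \<omega>"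
        by eventually_elim (simp add: indicator_def)
      then show ?case by (rule tendsto_eventually)
    qed
  qed (use A B in auto)
  then show ?thesis using A B by simp
qed

lemma grid_exit_tendsto:
  assumes mp: "markov_process M X S c x0" and S: "finite S" "D \<subseteq> S" "x0 \<in> S" and z: "z \<in> D"
  shows "(\<lambda>m. \<P>(\<omega> in M. \<exists>N. running x0 D (\<lambda>i. X (real i * mesh m) \<omega>) N \<and>
       X (real N * mesh m) \<omega> = z)) \<longlonglongrightarrow> measure M (exit_event M X D z)"
proof -
  interpret prob_space M using mp by (simp add: markov_process_def)
  show ?thesis
  proof (rule prob_tendsto_of_eventually)
    show "exit_event M X D z \<in> sets M" by (rule exit_event_sets[OF mp S z])
    fix m :: nat
    interpret exit_chain M "\<lambda>i. X (real i * mesh m)" S D "transition_prob S c (mesh m)" x0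
      by (rule markov_process_grid[OF mp S]) simp
    show "{\<omega>\<in>space M. \<exists>N. running x0 D (\<lambda>i. X (real i * mesh m) \<omega>) N \<and>
        X (real N * mesh m) \<omega> = z} \<in> sets M"
      by (rule sets.sets_Collect_countable_Ex, rule past_sets[OF past_running[of _ x0 D z]])
  next
    have "AE \<omega> in M. X 0 \<omega> = x0" using mp by (simp add: markov_process_def)
    then show "AE \<omega> in M. \<forall>\<^sub>F m in sequentially.
       \<omega> \<in> {\<omega>\<in>space M. \<exists>N. running x0 D (\<lambda>i. X (real i * mesh m) \<omega>) N \<and>
        X (real N * mesh m) \<omega> = z} \<longleftrightarrow> \<omega> \<in> exit_event M X D z"
      using AE_space
    proof eventually_elim
      case (elim \<omega>)
      note ev = grid_exit_eventually[OF mp z elim(2), unfolded elim(1)]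
      show ?case
        using ev by (rule eventually_mono) (use elim(2) in blast)
    qed
  qed
qed

text \<open>With mesh \<open>d\<close> the kernel changes \<open>u\<close> by \<open>O(d\<^sup>2)\<close> off \<open>D\<close> and lowers \<open>t\<close> by at least \<open>d / 2\<close>, so
\<open>exit_estimate\<close> bounds the error by a multiple of \<open>d\<^sup>2 / d\<close>. The first step of the chain away from
\<open>x0\<close> has, after division by \<open>d\<close>, the distribution of the first jump in the limit.\<close>

theorem exit_identity:
  assumes mp: "markov_process M X S c x0" and S: "finite S" "D \<subseteq> S" "x0 \<in> S"
    and rate: "0 < (\<Sum>y\<in>S-{x0}. c x0 y)"
    and u: "\<And>x. x \<in> S - D \<Longrightarrow> gen_op S c u x = 0"
    and t0: "\<And>x. x \<in> S \<Longrightarrow> 0 \<le> t x"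
    and t: "\<And>x. x \<in> S - D \<Longrightarrow> gen_op S c t x \<le> -1"
  shows "(\<Sum>z\<in>D. measure M (exit_event M X D z) * u z) * (\<Sum>y\<in>S-{x0}. c x0 y)
     = (\<Sum>y\<in>S-{x0}. c x0 y * u y)"
proof -
  define r where "r = (\<Sum>y\<in>S-{x0}. c x0 y)"
  have r: "0 < r" using rate by (simp add: r_def)
  let ?p = "transition_prob S c"
  obtain K where K: "0 \<le> K" "\<And>d x y. \<lbrakk>0 \<le> d; d \<le> 1; x \<in> S; y \<in> S\<rbrakk> \<Longrightarrow>
    \<bar>?p d x y - (if x = y then 1 else 0) - d * generator S c x y\<bar> \<le> K * d\<^sup>2"
    using transition_prob_expansion[OF S(1), where c = c] by blast
  obtain Ku where Ku: "0 \<le> Ku" "\<And>d x. \<lbrakk>0 \<le> d; d \<le> 1; x \<in> S\<rbrakk> \<Longrightarrow>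
    \<bar>(\<Sum>y\<in>S. ?p d x y * u y) - u x - d * gen_op S c u x\<bar> \<le> Ku * d\<^sup>2"
    using transition_prob_apply[OF S(1), where c = c and u = u] by blast
  obtain Kt where Kt: "0 \<le> Kt" "\<And>d x. \<lbrakk>0 \<le> d; d \<le> 1; x \<in> S\<rbrakk> \<Longrightarrow>
    \<bar>(\<Sum>y\<in>S. ?p d x y * t y) - t x - d * gen_op S c t x\<bar> \<le> Kt * d\<^sup>2"
    using transition_prob_apply[OF S(1), where c = c and u = t] by blast
  \<comment> \<open>\<open>d * C\<close> bounds the mean of \<open>t\<close> over the first step of the chain of mesh \<open>d\<close>\<close>
  define C where "C = (\<Sum>y\<in>S-{x0}. (c x0 y + K) * t y)"
  define d where "d m = inverse (real (Suc m))" for m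
  define Q where "Q m = (\<Sum>z\<in>D. \<P>(\<omega> in M. \<exists>N. running x0 D (\<lambda>i. X (real i * d m) \<omega>) N \<and>
       X (real N * d m) \<omega> = z) * u z)" for m
  define R where "R m = (\<Sum>b\<in>S-{x0}. ?p (d m) x0 b * u b) / (1 - ?p (d m) x0 x0)" for m
  have d: "0 < d m" "d m \<le> 1" for m by (auto simp: d_def divide_simps)
  have d_lim: "d \<longlonglongrightarrow> 0" unfolding d_def by (rule LIMSEQ_inverse_real_of_nat)
  have off: "\<bar>?p (d m) x0 b - d m * c x0 b\<bar> \<le> K * (d m)\<^sup>2" if "b \<in> S - {x0}" for b m
    using K(2)[of "d m" x0 b] d[of m] S that by (auto simp: generator_def)
  have diag: "\<bar>?p (d m) x0 x0 - 1 + d m * r\<bar> \<le> K * (d m)\<^sup>2" for m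
    using K(2)[of "d m" x0 x0] d[of m] S by (simp add: generator_def r_def)
  have small: "\<forall>\<^sub>F m in sequentially. K * d m \<le> r / 2 \<and> Kt * d m \<le> 1 / 2"
  proof (intro eventually_conj)
    have l: "(\<lambda>m. K * d m) \<longlonglongrightarrow> K * 0" "(\<lambda>m. Kt * d m) \<longlonglongrightarrow> Kt * 0" by (intro tendsto_intros d_lim)+
    have "\<forall>\<^sub>F m in sequentially. K * d m < r / 2"
      by (rule order_tendstoD(2)[OF l(1)]) (use r in simp)
    moreover have "\<forall>\<^sub>F m in sequentially. Kt * d m < 1 / 2"
      by (rule order_tendstoD(2)[OF l(2)]) simp
    ultimately show "\<forall>\<^sub>F m in sequentially. K * d m \<le> r / 2" "\<forall>\<^sub>F m in sequentially. Kt * d m \<le> 1 / 2"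
      by (auto elim: eventually_mono)
  qed
  have est: "\<forall>\<^sub>F m in sequentially. \<bar>Q m - R m\<bar> \<le> (4 * Ku * C / r) * d m"
    using small
  proof eventually_elim
    case (elim m)
    interpret exit_chain M "\<lambda>i. X (real i * d m)" S D "?p (d m)" x0
      by (rule markov_process_grid[OF mp S d(1)])
    have Kd: "K * (d m)\<^sup>2 \<le> r / 2 * d m" "Kt * (d m)\<^sup>2 \<le> 1 / 2 * d m"
      using elim d[of m] by (auto simp: power2_eq_square mult.assoc[symmetric] intro!: mult_right_mono)
    have q: "d m * r / 2 \<le> 1 - ?p (d m) x0 x0" using diag[of m] Kd by (simp add: field_simps)
    have q0: "0 < d m * r / 2" using d r by simp
    have st: "(\<Sum>b\<in>S-{x0}. ?p (d m) x0 b * t b) \<le> d m * C"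
    proof -
      have "(\<Sum>b\<in>S-{x0}. ?p (d m) x0 b * t b) \<le> (\<Sum>b\<in>S-{x0}. d m * ((c x0 b + K) * t b))"
      proof (rule sum_mono)
        fix b assume b: "b \<in> S - {x0}"
        have "K * (d m)\<^sup>2 \<le> K * d m" using K(1) d[of m]
          by (intro mult_left_mono) (auto simp: power2_eq_square mult_left_le)
        then have "?p (d m) x0 b \<le> d m * (c x0 b + K)" using off[OF b, of m] by (simp add: algebra_simps)
        then show "?p (d m) x0 b * t b \<le> d m * ((c x0 b + K) * t b)"
          using t0[of b] b by (simp add: mult.assoc[symmetric] mult_right_mono)
      qed
      then show ?thesis by (simp add: C_def sum_distrib_left)
    qed
    have st0: "0 \<le> (\<Sum>b\<in>S-{x0}. ?p (d m) x0 b * t b)"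
      by (rule first_step_nonneg[of t, OF t0])
    have "(\<Sum>b\<in>S-{x0}. ?p (d m) x0 b * t b) / (1 - ?p (d m) x0 x0) \<le> d m * C / (d m * r / 2)"
      using st st0 q q0 by (intro frac_le) auto
    also have "\<dots> = 2 * C / r" using d[of m] by simp
    finally have T: "(\<Sum>b\<in>S-{x0}. ?p (d m) x0 b * t b) / (1 - ?p (d m) x0 x0) \<le> 2 * C / r" .
    have "\<bar>Q m - R m\<bar> \<le> Ku * (d m)\<^sup>2 * ((2 * C / r) / (d m / 2))"
      unfolding Q_def R_def
    proof (rule exit_estimate[where t = t])
      show "?p (d m) x0 x0 < 1" using q q0 by linarith
      show "\<bar>(\<Sum>b\<in>S. ?p (d m) a b * u b) - u a\<bar> \<le> Ku * (d m)\<^sup>2" if "a \<in> S - D" for a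
        using Ku(2)[of "d m" a] u[OF that] d[of m] that by simp
      show "(\<Sum>b\<in>S. ?p (d m) a b * t b) - t a \<le> - (d m / 2)" if "a \<in> S - D" for a
      proof -
        have "d m * gen_op S c t a \<le> d m * (-1)" using t[OF that] d[of m] by (intro mult_left_mono) auto
        then show ?thesis using Kt(2)[of "d m" a] d[of m] that Kd(2) by (simp add: abs_le_iff)
      qed
    qed (use d[of m] t0 Ku T in auto)
    also have "\<dots> = (4 * Ku * C / r) * d m" using d[of m] by (simp add: power2_eq_square field_simps)
    finally show ?case .
  qed
  have "(\<lambda>m. (4 * Ku * C / r) * d m) \<longlonglongrightarrow> (4 * Ku * C / r) * 0" by (intro tendsto_intros d_lim)
  then have diff0: "(\<lambda>m. Q m - R m) \<longlonglongrightarrow> 0"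
    using est by (intro Lim_null_comparison[of "\<lambda>m. Q m - R m"]) simp_all
  have quot: "(\<lambda>m. f m / d m) \<longlonglongrightarrow> l" if "\<And>m. \<bar>f m - d m * l\<bar> \<le> K * (d m)\<^sup>2" for f l
  proof -
    have "\<bar>f m / d m - l\<bar> \<le> K * d m" for m
    proof -
      have "\<bar>f m / d m - l\<bar> = \<bar>f m - d m * l\<bar> / d m" using d[of m] by (simp add: field_simps abs_divide)
      also have "\<dots> \<le> K * (d m)\<^sup>2 / d m" using that d[of m] by (intro divide_right_mono) auto
      finally show ?thesis using d[of m] by (simp add: power2_eq_square)
    qed
    moreover have "(\<lambda>m. K * d m) \<longlonglongrightarrow> K * 0" by (intro tendsto_intros d_lim)
    ultimately have "(\<lambda>m. f m / d m - l) \<longlonglongrightarrow> 0"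
      by (intro Lim_null_comparison[of "\<lambda>m. f m / d m - l"]) simp_all
    then show ?thesis by (simp add: LIM_zero_iff)
  qed
  have "(\<lambda>m. (\<Sum>b\<in>S-{x0}. ?p (d m) x0 b / d m * u b) / ((1 - ?p (d m) x0 x0) / d m)) \<longlonglongrightarrow>
      (\<Sum>b\<in>S-{x0}. c x0 b * u b) / r"
  proof (intro tendsto_intros quot off)
    show "\<bar>1 - ?p (d m) x0 x0 - d m * r\<bar> \<le> K * (d m)\<^sup>2" for m using diag[of m] by (simp add: abs_le_iff)
  qed (use r in auto)
  moreover have "(\<Sum>b\<in>S-{x0}. ?p (d m) x0 b / d m * u b) / ((1 - ?p (d m) x0 x0) / d m) = R m" for m
  proof -
    have "(\<Sum>b\<in>S-{x0}. ?p (d m) x0 b / d m * u b) = (\<Sum>b\<in>S-{x0}. ?p (d m) x0 b * u b) / d m"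
      by (simp add: sum_divide_distrib)
    then show ?thesis using d[of m] by (simp add: R_def)
  qed
  ultimately have R: "R \<longlonglongrightarrow> (\<Sum>b\<in>S-{x0}. c x0 b * u b) / r" by simp
  have "Q \<longlonglongrightarrow> (\<Sum>z\<in>D. measure M (exit_event M X D z) * u z)"
    unfolding Q_def d_def by (intro tendsto_sum tendsto_mult tendsto_const grid_exit_tendsto[OF mp S])
  then have "(\<lambda>m. Q m - R m) \<longlonglongrightarrow> (\<Sum>z\<in>D. measure M (exit_event M X D z) * u z) - (\<Sum>b\<in>S-{x0}. c x0 b * u b) / r"
    using R by (rule tendsto_diff)
  from LIMSEQ_unique[OF this diff0] have "(\<Sum>z\<in>D. measure M (exit_event M X D z) * u z) = (\<Sum>b\<in>S-{x0}. c x0 b * u b) / r"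
    by simp
  then show ?thesis using r by (simp add: r_def)
qed

section \<open>Potential theory on a finite state space\<close>

lemma gen_op_eq: "gen_op S c u x = (\<Sum>y\<in>S-{x}. c x y * u y) - (\<Sum>y\<in>S-{x}. c x y) * u x"
  by (simp add: gen_op_def right_diff_distrib sum_subtractf sum_distrib_right)

text \<open>Take \<open>t x = R ^ N - R ^ (N - lev x)\<close> with \<open>N\<close> at least every level. The step to a lower level
decreases \<open>t\<close> by at least \<open>R - 1\<close> times \<open>R ^ (N - lev x)\<close>, whereas no step increases it by more than
\<open>R ^ (N - lev x)\<close>; a large \<open>R\<close> outweighs all rates.\<close>

lemma exists_drift_function:
  assumes S: "finite S" and c: "\<And>x y. \<lbrakk>x \<in> S; y \<in> S\<rbrakk> \<Longrightarrow> 0 \<le> c x y"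
    and lev: "\<And>x. x \<in> S - D \<Longrightarrow> \<exists>y\<in>S. lev y < (lev x :: nat) \<and> 0 < c x y"
  obtains t where "\<And>x. x \<in> S \<Longrightarrow> 0 \<le> t x" "\<And>x. x \<in> S - D \<Longrightarrow> gen_op S c t x \<le> (-1 :: real)"
proof -
  define N where "N = Max (insert 0 (lev ` S))"
  have N: "lev x \<le> N" if "x \<in> S" for x unfolding N_def using S that by (intro Max_ge) auto
  define L where "L = (\<Sum>x\<in>S. \<Sum>y\<in>S. c x y)"
  have L0: "0 \<le> L" unfolding L_def by (intro sum_nonneg c)
  define m where "m = Min (insert 1 {c x y | x y. x \<in> S \<and> y \<in> S \<and> 0 < c x y})"
  have fin: "finite {c x y | x y. x \<in> S \<and> y \<in> S \<and> 0 < c x y}"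
    by (rule finite_subset[of _ "(\<lambda>(x, y). c x y) ` (S \<times> S)"]) (use S in auto)
  have m0: "0 < m" unfolding m_def using fin by (subst Min_gr_iff) auto
  have m_le: "m \<le> c x y" if "x \<in> S" "y \<in> S" "0 < c x y" for x y
    unfolding m_def using fin that by (intro Min_le) auto
  \<comment> \<open>chosen so that \<open>m * (1 - R) + L = -1\<close>\<close>
  define R where "R = (L + m + 1) / m"
  have R: "1 \<le> R" "m * R = L + m + 1" using m0 L0 by (auto simp: R_def field_simps)
  define t where "t x = R ^ N - R ^ (N - lev x)" for x
  show thesis
  proof (rule that[of t])
    show "0 \<le> t x" if "x \<in> S" for x
      unfolding t_def using R(1) by (simp add: power_increasing)
    fix x assume x: "x \<in> S - D"
    obtain y where y: "y \<in> S" "lev y < lev x" "0 < c x y" using lev[OF x] by blast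
    let ?P = "R ^ (N - lev x)"
    have P1: "1 \<le> ?P" using R(1) by (rule one_le_power)
    have yx: "y \<in> S - {x}" using y by auto
    have "gen_op S c t x = c x y * (t y - t x) + (\<Sum>z\<in>S-{x}-{y}. c x z * (t z - t x))"
      unfolding gen_op_def using S yx by (intro sum.remove) auto
    also have "(\<Sum>z\<in>S-{x}-{y}. c x z * (t z - t x)) \<le> (\<Sum>z\<in>S-{x}-{y}. c x z * ?P)"
    proof (intro sum_mono mult_left_mono c)
      fix z
      have "0 \<le> R ^ (N - lev z)" using R(1) by simp
      then show "t z - t x \<le> ?P" by (simp add: t_def)
    qed (use x in auto)
    also have "\<dots> \<le> L * ?P"
    proof -
      have "(\<Sum>z\<in>S-{x}-{y}. c x z) \<le> (\<Sum>z\<in>S. c x z)" using S x c by (intro sum_mono2) auto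
      also have "\<dots> \<le> L"
        unfolding L_def using S x c by (intro member_le_sum[where f = "\<lambda>x. sum (c x) S"]) (auto intro: sum_nonneg)
      finally show ?thesis using P1 by (simp add: sum_distrib_right[symmetric] mult_right_mono)
    qed
    also have "c x y * (t y - t x) \<le> m * (?P - R * ?P)"
    proof -
      have "R * ?P = R ^ Suc (N - lev x)" by simp
      also have "\<dots> \<le> R ^ (N - lev y)" using R(1) y(2) N[of x] x by (intro power_increasing) auto
      finally have "t y - t x \<le> ?P - R * ?P" by (simp add: t_def)
      then have "c x y * (t y - t x) \<le> c x y * (?P - R * ?P)" using y(3) by simp
      also have "\<dots> \<le> m * (?P - R * ?P)"
        using m_le[of x y] x y R(1) P1 by (intro mult_right_mono_neg) auto
      finally show ?thesis .
    qed
    also have "m * (?P - R * ?P) + L * ?P = - ?P" 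
    proof -
      have "m * (?P - R * ?P) + L * ?P = (m - m * R + L) * ?P" by (simp add: algebra_simps)
      then show ?thesis using R(2) by simp
    qed
    finally show "gen_op S c t x \<le> -1" using P1 by simp
  qed
qed

text \<open>Subtracting a small multiple of \<open>t\<close> makes \<open>f\<close> strictly subharmonic off \<open>D\<close>, so its maximum is
attained in \<open>D\<close>.\<close>

lemma maximum_principle:
  assumes S: "finite S" "D \<subseteq> S" and c: "\<And>x y. \<lbrakk>x \<in> S; y \<in> S\<rbrakk> \<Longrightarrow> 0 \<le> c x y"
    and t0: "\<And>x. x \<in> S \<Longrightarrow> 0 \<le> t x" and t: "\<And>x. x \<in> S - D \<Longrightarrow> gen_op S c t x \<le> -1"
    and f: "\<And>x. x \<in> S - D \<Longrightarrow> 0 \<le> gen_op S c f x" and fD: "\<And>x. x \<in> D \<Longrightarrow> f x \<le> 0"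
    and x: "x \<in> S"
  shows "f x \<le> (0 :: real)"
proof -
  have *: "f x \<le> e * t x" if e: "0 < e" for e
  proof -
    define g where "g y = f y - e * t y" for y
    have "finite (g ` S)" "g ` S \<noteq> {}" using S x by auto
    from Max_in[OF this] obtain z where z: "z \<in> S" "g z = Max (g ` S)" by auto
    then have max: "g y \<le> g z" if "y \<in> S" for y using S that by simp
    have "z \<in> D"
    proof (rule ccontr)
      assume "z \<notin> D"
      then have zD: "z \<in> S - D" using z by blast
      have "gen_op S c g z = gen_op S c f z - e * gen_op S c t z"
        by (simp add: gen_op_def g_def sum_distrib_left sum_subtractf[symmetric] algebra_simps)
      moreover have "e * gen_op S c t z \<le> e * (-1)" using t[OF zD] e by (intro mult_left_mono) auto
      moreover have "gen_op S c g z \<le> 0"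
        unfolding gen_op_def using max z c by (intro sum_nonpos mult_nonneg_nonpos) auto
      ultimately show False using f[OF zD] e by simp
    qed
    moreover have "0 \<le> e * t z" using t0[OF z(1)] e by simp
    ultimately have "g z \<le> 0" using fD[of z] unfolding g_def by linarith
    then show ?thesis using max[OF x] by (simp add: g_def)
  qed
  show ?thesis
  proof (rule field_le_epsilon)
    fix e :: real assume e: "0 < e"
    have "f x \<le> e / (t x + 1) * t x" using t0[OF x] e by (intro *) auto
    also have "\<dots> \<le> e" using t0[OF x] e by (simp add: field_simps)
    finally show "f x \<le> 0 + e" by simp
  qed
qed

text \<open>With \<open>L\<close> larger than all total rates, the map \<open>T\<close> that fixes the boundary values and otherwise
adds the generator divided by \<open>L\<close> is monotone. Iterating it from zero off \<open>D\<close> gives an increasing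
bounded sequence, and its limit is a fixed point.\<close>

lemma exists_harmonic:
  assumes S: "finite S" "D \<subseteq> S" and c: "\<And>x y. \<lbrakk>x \<in> S; y \<in> S\<rbrakk> \<Longrightarrow> 0 \<le> c x y"
    and b: "\<And>x. x \<in> D \<Longrightarrow> 0 \<le> b x \<and> b x \<le> (1 :: real)"
  obtains u where "\<And>x. x \<in> D \<Longrightarrow> u x = b x" "\<And>x. x \<in> S \<Longrightarrow> 0 \<le> u x \<and> u x \<le> 1"
    "\<And>x. x \<in> S - D \<Longrightarrow> gen_op S c u x = 0"
proof -
  define L where "L = (\<Sum>x\<in>S. \<Sum>y\<in>S. c x y) + 1"
  have L0: "0 < L" unfolding L_def using c by (intro add_nonneg_pos sum_nonneg) auto
  have r_le: "(\<Sum>y\<in>S-{x}. c x y) \<le> L" if "x \<in> S" for x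
  proof -
    have "(\<Sum>y\<in>S-{x}. c x y) \<le> (\<Sum>y\<in>S. c x y)" using S that c by (intro sum_mono2) auto
    also have "\<dots> \<le> (\<Sum>x\<in>S. \<Sum>y\<in>S. c x y)"
      using S that c by (intro member_le_sum[where f = "\<lambda>x. sum (c x) S"]) (auto intro: sum_nonneg)
    finally show ?thesis by (simp add: L_def)
  qed
  define T where "T u x = (if x \<in> D then b x else u x + gen_op S c u x / L)" for u x
  have mono: "T u x \<le> T v x" if uv: "\<And>y. y \<in> S \<Longrightarrow> u y \<le> v y" and x: "x \<in> S" for u v x
  proof (cases "x \<in> D")
    case False
    have "gen_op S c v x - gen_op S c u x
       = (\<Sum>y\<in>S-{x}. c x y * (v y - u y)) - (\<Sum>y\<in>S-{x}. c x y) * (v x - u x)"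
      by (simp add: gen_op_eq right_diff_distrib sum_subtractf)
    moreover have "0 \<le> (\<Sum>y\<in>S-{x}. c x y * (v y - u y))" using x uv c by (intro sum_nonneg mult_nonneg_nonneg) auto
    moreover have "(\<Sum>y\<in>S-{x}. c x y) * (v x - u x) \<le> L * (v x - u x)"
      using r_le[OF x] uv[OF x] by (intro mult_right_mono) auto
    ultimately have "- (L * (v x - u x)) \<le> gen_op S c v x - gen_op S c u x" by linarith
    then have "(gen_op S c u x - gen_op S c v x) / L \<le> v x - u x"
      unfolding pos_divide_le_eq[OF L0] by (simp add: algebra_simps)
    then have "u x + gen_op S c u x / L \<le> v x + gen_op S c v x / L"
      by (simp add: diff_divide_distrib)
    then show ?thesis using False by (simp add: T_def)
  qed (simp add: T_def)
  define w where "w k = (T ^^ k) (\<lambda>x. if x \<in> D then b x else 0)" for k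
  have w_Suc: "w (Suc k) = T (w k)" for k by (simp add: w_def)
  have w_D: "w k x = b x" if "x \<in> D" for k x
    using that by (cases k) (simp_all add: w_def T_def)
  have T_one: "T u x \<le> 1" if u: "\<And>y. y \<in> S \<Longrightarrow> u y \<le> 1" and x: "x \<in> S" for u x
  proof -
    have "T u x \<le> T (\<lambda>_. 1) x" by (rule mono) (use u x in auto)
    also have "\<dots> \<le> 1" using b[of x] by (simp add: T_def gen_op_def)
    finally show ?thesis .
  qed
  have T_zero: "0 \<le> T u x" if u: "\<And>y. y \<in> S \<Longrightarrow> 0 \<le> u y" and x: "x \<in> S" for u x
  proof -
    have "0 \<le> T (\<lambda>_. 0) x" using b[of x] by (simp add: T_def gen_op_def)
    also have "\<dots> \<le> T u x" by (rule mono) (use u x in auto)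
    finally show ?thesis .
  qed
  have w01: "x \<in> S \<Longrightarrow> 0 \<le> w k x \<and> w k x \<le> 1" for k x
  proof (induction k arbitrary: x)
    case 0 then show ?case using b by (auto simp: w_def)
  next
    case (Suc k) then show ?case using T_one[of "w k"] T_zero[of "w k"] by (auto simp: w_Suc)
  qed
  have w_mono: "x \<in> S \<Longrightarrow> w k x \<le> w (Suc k) x" for k x
  proof (induction k arbitrary: x)
    case 0
    then show ?case
    proof (cases "x \<in> D")
      case True then show ?thesis by (simp add: w_D)
    next
      case False
      then show ?thesis using w01[OF 0, of 1] by (simp add: w_def)
    qed
  next
    case (Suc k) then show ?case using mono[of "w k" "w (Suc k)"] by (simp add: w_Suc)
  qed
  define u where "u x = lim (\<lambda>k. w k x)" for x
  have lim: "(\<lambda>k. w k x) \<longlonglongrightarrow> u x" if x: "x \<in> S" for x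
  proof -
    have "incseq (\<lambda>k. w k x)" using w_mono[OF x] by (rule incseq_SucI)
    then have "convergent (\<lambda>k. w k x)"
      by (rule incseq_convergent[of _ 1, THEN exE]) (use w01[OF x] in \<open>auto simp: convergent_def\<close>)
    then show ?thesis unfolding u_def by (rule convergent_LIMSEQ_iff[THEN iffD1])
  qed
  show thesis
  proof (rule that[of u])
    show "u x = b x" if "x \<in> D" for x using that by (simp add: u_def w_D)
    show "0 \<le> u x \<and> u x \<le> 1" if x: "x \<in> S" for x
      using LIMSEQ_le_const[OF lim[OF x], of 0] LIMSEQ_le_const2[OF lim[OF x], of 1] w01[OF x] by blast
    fix x assume x: "x \<in> S - D"
    have "(\<lambda>k. T (w k) x) \<longlonglongrightarrow> u x + gen_op S c u x / L"
      using x L0 unfolding T_def gen_op_def by (auto intro!: tendsto_intros lim)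
    moreover have "(\<lambda>k. T (w k) x) \<longlonglongrightarrow> u x"
      using LIMSEQ_Suc[OF lim[of x]] x by (simp add: w_Suc)
    ultimately have "u x + gen_op S c u x / L = u x" by (rule LIMSEQ_unique)
    then show "gen_op S c u x = 0" using L0 by simp
  qed
qed

lemma green_identity:
  fixes mu :: "'s \<Rightarrow> real"
  assumes S: "finite S" and rev: "\<And>x y. \<lbrakk>x \<in> S; y \<in> S\<rbrakk> \<Longrightarrow> mu x * c x y = mu y * c y x"
  shows "2 * (\<Sum>x\<in>S. mu x * g x * gen_op S c f x) =
    - (\<Sum>x\<in>S. \<Sum>y\<in>S. mu x * c x y * (f y - f x) * (g y - g x))"
proof -
  have full: "gen_op S c f x = (\<Sum>y\<in>S. c x y * (f y - f x))" if "x \<in> S" for x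
    unfolding gen_op_def using S that by (subst sum.remove[of S x]) auto
  let ?A = "\<Sum>x\<in>S. \<Sum>y\<in>S. mu x * c x y * (f y - f x) * g x"
  have 1: "(\<Sum>x\<in>S. mu x * g x * gen_op S c f x) = ?A"
    by (intro sum.cong refl) (simp add: full sum_distrib_left algebra_simps)
  have "?A = (\<Sum>y\<in>S. \<Sum>x\<in>S. mu x * c x y * (f y - f x) * g x)" by (rule sum.swap)
  also have "\<dots> = (\<Sum>y\<in>S. \<Sum>x\<in>S. - (mu y * c y x * (f x - f y) * g x))"
    by (intro sum.cong refl) (simp add: rev algebra_simps)
  finally have 2: "?A = - (\<Sum>x\<in>S. \<Sum>y\<in>S. mu x * c x y * (f y - f x) * g y)"
    by (simp add: sum_negf)
  have "(\<Sum>x\<in>S. \<Sum>y\<in>S. mu x * c x y * (f y - f x) * (g y - g x)) =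
     (\<Sum>x\<in>S. \<Sum>y\<in>S. mu x * c x y * (f y - f x) * g y) - ?A"
    by (simp add: right_diff_distrib sum_subtractf)
  then show ?thesis using 1 2 by simp
qed

lemma sum_gen_op_eq_0:
  fixes mu :: "'s \<Rightarrow> real"
  assumes "finite S" and "\<And>x y. \<lbrakk>x \<in> S; y \<in> S\<rbrakk> \<Longrightarrow> mu x * c x y = mu y * c y x"
  shows "(\<Sum>x\<in>S. mu x * gen_op S c f x) = 0"
  using green_identity[where g = "\<lambda>_. 1" and f = f and mu = mu and c = c, OF assms] by simp

text \<open>The total flux vanishes, so what leaves \<open>a\<close> arrives in \<open>B\<close>, and there it is at most the
equilibrium rate of leaving \<open>B\<close>.\<close>

lemma flux_upper_bound:
  fixes mu :: "'s \<Rightarrow> real"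
  assumes S: "finite S" and rev: "\<And>x y. \<lbrakk>x \<in> S; y \<in> S\<rbrakk> \<Longrightarrow> mu x * c x y = mu y * c y x"
    and c: "\<And>x y. \<lbrakk>x \<in> S; y \<in> S\<rbrakk> \<Longrightarrow> 0 \<le> c x y" and mu: "\<And>x. x \<in> S \<Longrightarrow> 0 \<le> mu x"
    and B: "B \<subseteq> S" "a \<in> S - B"
    and v: "\<And>x. x \<in> S - insert a B \<Longrightarrow> gen_op S c v x = 0" "\<And>x. x \<in> S \<Longrightarrow> 0 \<le> v x"
    and vB: "\<And>x. x \<in> B \<Longrightarrow> v x = 1"
  shows "mu a * gen_op S c v a \<le> (\<Sum>x\<in>B. \<Sum>y\<in>S. mu x * c x y)"
proof -
  have fB: "finite B" using B S finite_subset by blast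
  have "0 = (\<Sum>x\<in>S. mu x * gen_op S c v x)" using sum_gen_op_eq_0[OF S rev] by simp
  also have "\<dots> = (\<Sum>x\<in>insert a B. mu x * gen_op S c v x)"
    using S B v(1) by (intro sum.mono_neutral_right) auto
  also have "\<dots> = mu a * gen_op S c v a + (\<Sum>x\<in>B. mu x * gen_op S c v x)"
    using fB B by simp
  finally have "mu a * gen_op S c v a = (\<Sum>x\<in>B. mu x * (- gen_op S c v x))" by (simp add: sum_negf)
  also have "\<dots> \<le> (\<Sum>x\<in>B. \<Sum>y\<in>S. mu x * c x y)"
  proof (rule sum_mono)
    fix x assume x: "x \<in> B"
    then have xS: "x \<in> S" using B by blast
    have "- gen_op S c v x = (\<Sum>y\<in>S-{x}. c x y * (1 - v y))"
      by (simp add: gen_op_def vB[OF x] sum_negf[symmetric] algebra_simps)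
    also have "\<dots> \<le> (\<Sum>y\<in>S-{x}. c x y * 1)"
      using xS c v(2) by (intro sum_mono mult_left_mono) auto
    also have "\<dots> \<le> (\<Sum>y\<in>S. c x y)" using S xS c by (simp, intro sum_mono2) auto
    finally have "- gen_op S c v x \<le> (\<Sum>y\<in>S. c x y)" .
    from mult_left_mono[OF this mu[OF xS]] show "mu x * - gen_op S c v x \<le> (\<Sum>y\<in>S. mu x * c x y)"
      by (simp add: sum_distrib_left)
  qed
  finally show ?thesis .
qed

lemma abs_increment_le:
  fixes u :: "'s \<Rightarrow> real"
  assumes "successively (\<lambda>x y. \<bar>u y - u x\<bar> \<le> e) p" "p \<noteq> []"
  shows "\<bar>u (last p) - u (hd p)\<bar> \<le> (real (length p) - 1) * e"
  using assms
proof (induction p)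
  case (Cons x p)
  show ?case
  proof (cases "p = []")
    case False
    then have "\<bar>u (last p) - u (hd p)\<bar> \<le> (real (length p) - 1) * e" "\<bar>u (hd p) - u x\<bar> \<le> e"
      using Cons by (auto simp: successively_Cons)
    then show ?thesis using False by (simp add: algebra_simps)
  qed simp
qed simp

text \<open>The flux is the Dirichlet energy of \<open>u\<close>. Since \<open>u\<close> grows from 0 to 1 along the path, on some edge
of it the increment exceeds the inverse length, and this edge alone contributes enough.\<close>

lemma flux_lower_bound:
  fixes mu :: "'s \<Rightarrow> real"
  assumes S: "finite S" and rev: "\<And>x y. \<lbrakk>x \<in> S; y \<in> S\<rbrakk> \<Longrightarrow> mu x * c x y = mu y * c y x"
    and c: "\<And>x y. \<lbrakk>x \<in> S; y \<in> S\<rbrakk> \<Longrightarrow> 0 \<le> c x y" and mu: "\<And>x. x \<in> S \<Longrightarrow> 0 \<le> mu x"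
    and ab: "a \<in> S" "b \<in> S" "a \<noteq> b"
    and u: "\<And>x. x \<in> S - {a, b} \<Longrightarrow> gen_op S c u x = 0" "u a = 0" "u b = 1"
    and p: "set p \<subseteq> S" "p \<noteq> []" "hd p = a" "last p = b" "successively (\<lambda>x y. k \<le> mu x * c x y) p"
    and k: "0 \<le> k"
  shows "k / (2 * (real (length p))\<^sup>2) \<le> mu a * gen_op S c u a"
proof -
  have two: "(\<Sum>x\<in>S. mu x * g x * gen_op S c u x) = mu a * g a * gen_op S c u a + mu b * g b * gen_op S c u b" for g
  proof -
    have "(\<Sum>x\<in>S. mu x * g x * gen_op S c u x) = (\<Sum>x\<in>{a, b}. mu x * g x * gen_op S c u x)"
      using S ab u(1) by (intro sum.mono_neutral_right) auto
    then show ?thesis using ab by simp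
  qed
  have "mu a * gen_op S c u a = - (mu b * gen_op S c u b)"
    using two[of "\<lambda>_. 1"] sum_gen_op_eq_0[of S mu c u, OF S rev] by simp
  then have energy: "2 * (mu a * gen_op S c u a) = (\<Sum>x\<in>S. \<Sum>y\<in>S. mu x * c x y * (u y - u x)\<^sup>2)"
    using green_identity[of S mu c u u, OF S rev] two[of u] u by (simp add: power2_eq_square mult.assoc)
  have l0: "0 < real (length p)" using p(2) by simp
  have "\<not> successively (\<lambda>x y. \<bar>u y - u x\<bar> \<le> 1 / real (length p)) p"
  proof
    assume "successively (\<lambda>x y. \<bar>u y - u x\<bar> \<le> 1 / real (length p)) p"
    from abs_increment_le[OF this p(2)] show False using p(3,4) u l0 by (simp add: field_simps)
  qed
  then obtain x y where xy: "x \<in> S" "y \<in> S" "k \<le> mu x * c x y" "1 / real (length p) < \<bar>u y - u x\<bar>"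
  proof -
    have "\<exists>x y. x \<in> S \<and> y \<in> S \<and> k \<le> mu x * c x y \<and> 1 / real (length p) < \<bar>u y - u x\<bar>"
    proof (rule ccontr)
      assume a: "\<not> ?thesis"
      have "successively (\<lambda>x y. \<bar>u y - u x\<bar> \<le> 1 / real (length p)) p"
        by (rule successively_mono[OF p(5)]) (use a p(1) in force)
      then show False using \<open>\<not> successively (\<lambda>x y. \<bar>u y - u x\<bar> \<le> 1 / real (length p)) p\<close> by simp
    qed
    then show thesis using that by blast
  qed
  have "k * (1 / real (length p))\<^sup>2 \<le> mu x * c x y * (u y - u x)\<^sup>2"
  proof (rule mult_mono)
    show "(1 / real (length p))\<^sup>2 \<le> (u y - u x)\<^sup>2"
      using power_mono[of "1 / real (length p)" "\<bar>u y - u x\<bar>" 2] xy(4) l0 by simp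
  qed (use xy k in auto)
  also have "\<dots> \<le> (\<Sum>y\<in>S. mu x * c x y * (u y - u x)\<^sup>2)"
    using S xy c mu by (intro member_le_sum[where f = "\<lambda>y. mu x * c x y * (u y - u x)\<^sup>2"]) auto
  also have "\<dots> \<le> (\<Sum>x\<in>S. \<Sum>y\<in>S. mu x * c x y * (u y - u x)\<^sup>2)"
    using S xy c mu
    by (intro member_le_sum[where f = "\<lambda>x. \<Sum>y\<in>S. mu x * c x y * (u y - u x)\<^sup>2"]) (auto intro!: sum_nonneg)
  finally have "k * (1 / real (length p))\<^sup>2 \<le> 2 * (mu a * gen_op S c u a)" using energy by simp
  moreover have "k * (1 / real (length p))\<^sup>2 = 2 * (k / (2 * (real (length p))\<^sup>2))"
    by (simp add: power_divide)
  ultimately show ?thesis by linarith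
qed

section \<open>Exit events as comparisons of hitting times\<close>

lemma hitting_time_Un: "hitting_time X (A \<union> B) \<omega> = min (hitting_time X A \<omega>) (hitting_time X B \<omega>)"
proof -
  let ?H = "\<lambda>A. {t. 0 < t \<and> X t \<omega> \<in> A \<and> (\<exists>s. 0 < s \<and> s < t \<and> X s \<omega> \<noteq> X 0 \<omega>)}"
  have "?H (A \<union> B) = ?H A \<union> ?H B" by blast
  then show ?thesis
    unfolding hitting_time_def by (simp only: image_Un Inf_union_distrib inf_min)
qed

lemma hitting_time_cases:
  assumes f: "right_const (\<lambda>t. X t \<omega>)"
  obtains "visits (\<lambda>t. X t \<omega>) D = {}" "hitting_time X D \<omega> = \<infinity>"
  | \<tau> where "\<tau> \<in> visits (\<lambda>t. X t \<omega>) D" "\<forall>t\<in>visits (\<lambda>t. X t \<omega>) D. \<tau> \<le> t" "hitting_time X D \<omega> = ereal \<tau>"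
proof (cases "visits (\<lambda>t. X t \<omega>) D = {}")
  case True
  then show thesis using that(1) hitting_time_no_visit[of X \<omega> D] by blast
next
  case False
  obtain \<tau> where \<tau>: "\<tau> \<in> visits (\<lambda>t. X t \<omega>) D" "\<And>t. t \<in> visits (\<lambda>t. X t \<omega>) D \<Longrightarrow> \<tau> \<le> t"
    using visits_has_min[OF f False] by blast
  have "hitting_time X D \<omega> = ereal \<tau>" using hitting_time_eq_min[of X \<omega> \<tau> D] f \<tau> by blast
  then show thesis using that(2) \<tau> by blast
qed

lemma hitting_times_differ:
  assumes "right_const (\<lambda>t. X t \<omega>)" "A \<inter> B = {}" "hitting_time X A \<omega> < \<infinity>"
  shows "hitting_time X A \<omega> \<noteq> hitting_time X B \<omega>"
proof
  assume e: "hitting_time X A \<omega> = hitting_time X B \<omega>"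
  have "\<exists>\<tau>. hitting_time X A \<omega> = ereal \<tau> \<and> X \<tau> \<omega> \<in> A"
    using assms(1)
    by (rule hitting_time_cases[where D = A and X = X and \<omega> = \<omega>]) (use assms(3) in \<open>auto simp: visits_def\<close>)
  moreover have "\<exists>\<tau>. hitting_time X B \<omega> = ereal \<tau> \<and> X \<tau> \<omega> \<in> B"
    using assms(1)
    by (rule hitting_time_cases[where D = B and X = X and \<omega> = \<omega>]) (use assms(3) e in \<open>auto simp: visits_def\<close>)
  ultimately show False using e assms(2) by auto
qed

text \<open>The first entrance into the union of \<open>{z}\<close> and \<open>B\<close> is at \<open>z\<close> precisely when \<open>z\<close> comes first;
ties are excluded because hitting times are attained.\<close>

lemma exits_at_iff_less:
  assumes f: "right_const (\<lambda>t. X t \<omega>)" and z: "z \<notin> B"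
  shows "(hitting_time X (insert z B) \<omega> < \<infinity> \<and> X (real_of_ereal (hitting_time X (insert z B) \<omega>)) \<omega> = z)
    \<longleftrightarrow> hitting_time X {z} \<omega> < hitting_time X B \<omega>"
proof -
  let ?h = "hitting_time X" and ?v = "\<lambda>A. visits (\<lambda>t. X t \<omega>) A"
  have m: "?h (insert z B) \<omega> = min (?h {z} \<omega>) (?h B \<omega>)"
    using hitting_time_Un[of X "{z}" B \<omega>] by simp
  have inA: "\<exists>\<tau>. ?h A \<omega> = ereal \<tau> \<and> X \<tau> \<omega> \<in> A" if "?h A \<omega> < \<infinity>" for A
    using f by (rule hitting_time_cases[where D = A and X = X and \<omega> = \<omega>]) (use that in \<open>auto simp: visits_def\<close>)
  show ?thesis
  proof
    assume a: "?h (insert z B) \<omega> < \<infinity> \<and> X (real_of_ereal (?h (insert z B) \<omega>)) \<omega> = z"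
    show "?h {z} \<omega> < ?h B \<omega>"
    proof (rule ccontr)
      assume "\<not> ?thesis"
      then have e: "?h (insert z B) \<omega> = ?h B \<omega>" using m by (simp add: min_def)
      then obtain \<tau> where "?h B \<omega> = ereal \<tau>" "X \<tau> \<omega> \<in> B" using inA[of B] a by auto
      then show False using a e z by simp
    qed
  next
    assume l: "?h {z} \<omega> < ?h B \<omega>"
    then have e: "?h (insert z B) \<omega> = ?h {z} \<omega>" using m by (simp add: min_absorb1 less_imp_le)
    have "?h {z} \<omega> < \<infinity>" using l by auto
    then obtain \<tau> where "?h {z} \<omega> = ereal \<tau>" "X \<tau> \<omega> = z" using inA[of "{z}"] by auto
    then show "?h (insert z B) \<omega> < \<infinity> \<and> X (real_of_ereal (?h (insert z B) \<omega>)) \<omega> = z" using e by simp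
  qed
qed

lemma exit_event_eq_less:
  assumes mp: "markov_process M X S c x0" and z: "z \<notin> B"
  shows "exit_event M X (insert z B) z = {\<omega>\<in>space M. hitting_time X {z} \<omega> < hitting_time X B \<omega>}"
  unfolding exit_event_def
  using exits_at_iff_less[OF markov_process_right_const[OF mp] z] by (intro Collect_cong conj_cong refl) simp

section \<open>The Glauber dynamics\<close>

context ising_cube
begin

abbreviation rate :: "real \<Rightarrow> config \<Rightarrow> config \<Rightarrow> real" where
  "rate \<beta> \<equiv> glauber_rate n h \<beta>"

abbreviation gen :: "real \<Rightarrow> (config \<Rightarrow> real) \<Rightarrow> config \<Rightarrow> real" where
  "gen \<beta> \<equiv> gen_op (Conf n) (rate \<beta>)"

text \<open>The reversible weight of the dynamics, without normalisation.\<close>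

definition gibbs :: "real \<Rightarrow> config \<Rightarrow> real" where
  "gibbs \<beta> x = exp (- \<beta> * energy_h x)"

lemma rate_nonneg: "0 \<le> rate \<beta> x y" by (simp add: glauber_rate_def)

lemma rate_pos: "flip x y \<Longrightarrow> 0 < rate \<beta> x y" by (simp add: glauber_rate_def)

lemma rate_le_1: "0 \<le> \<beta> \<Longrightarrow> rate \<beta> x y \<le> 1" by (simp add: glauber_rate_def)

lemma gibbs_rate:
  "flip x y \<Longrightarrow> gibbs \<beta> x * rate \<beta> x y = exp (- \<beta> * max (energy_h x) (energy_h y))"
proof -
  assume "flip x y"
  then have "gibbs \<beta> x * rate \<beta> x y = exp (- \<beta> * (energy_h x + max 0 (energy_h y - energy_h x)))"
    by (simp add: gibbs_def glauber_rate_def exp_add[symmetric] algebra_simps)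
  also have "energy_h x + max 0 (energy_h y - energy_h x) = max (energy_h x) (energy_h y)" by (simp add: max_def)
  finally show ?thesis .
qed

lemma gibbs_reversible: "gibbs \<beta> x * rate \<beta> x y = gibbs \<beta> y * rate \<beta> y x"
proof (cases "flip x y")
  case True
  then have "flip y x" using flip_sym by blast
  then show ?thesis using gibbs_rate[OF True] gibbs_rate[of y x] by (simp add: max.commute)
next
  case False
  then have "\<not> flip y x" using flip_sym by blast
  then show ?thesis using False by (simp add: glauber_rate_def)
qed

text \<open>From every configuration some flip with positive rate approaches a given target. This provides the
levels for the drift function.\<close>

lemma flip_towards:
  assumes x: "x \<in> Conf n" "z \<in> Conf n" "x \<noteq> z"
  shows "\<exists>y\<in>Conf n. card (sym_diff y z) < card (sym_diff x z) \<and> 0 < rate \<beta> x y"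
proof -
  obtain v where v: "v \<in> sym_diff x z" using x(3) by blast
  define y where "y = sym_diff x {v}"
  have "sym_diff x y = {v}" unfolding y_def by blast
  then have "flip x y" unfolding flip_iff_adj adj_def by blast
  moreover have "y \<in> Conf n" using x v unfolding y_def Conf_def by blast
  moreover have "card (sym_diff y z) < card (sym_diff x z)"
  proof (rule psubset_card_mono)
    show "finite (sym_diff x z)" using x Conf_finite by blast
    have "sym_diff y z = sym_diff x z - {v}" using v unfolding y_def by blast
    then show "sym_diff y z \<subset> sym_diff x z" using v by blast
  qed
  ultimately show ?thesis using rate_pos by blast
qed

lemma drift_function:
  assumes "z \<in> D" "D \<subseteq> Conf n"
  shows "\<exists>t. (\<forall>x\<in>Conf n. 0 \<le> t x) \<and> (\<forall>x\<in>Conf n - D. gen \<beta> t x \<le> -1)"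
proof -
  have "\<exists>y\<in>Conf n. card (sym_diff y z) < card (sym_diff x z) \<and> 0 < rate \<beta> x y" if "x \<in> Conf n - D" for x
    using that assms by (intro flip_towards) auto
  from exists_drift_function[of "Conf n" "rate \<beta>" D "\<lambda>x. card (sym_diff x z)", OF finite_Conf rate_nonneg this]
  show ?thesis by metis
qed

definition escape_rate :: "real \<Rightarrow> real" where
  "escape_rate \<beta> = (\<Sum>y\<in>Conf n - {{}}. rate \<beta> {} y)"

lemma escape_rate_pos: "0 < escape_rate \<beta>"
proof -
  have "V n \<noteq> {}" using card_V[of n] by auto
  then obtain v where v: "v \<in> V n" by blast
  have "flip {} {v}" using flip_insert[of v "{}"] by simp
  then show ?thesis
    unfolding escape_rate_def using v finite_Conf rate_pos rate_nonneg
    by (intro sum_pos2[of _ "{v}"]) (auto simp: Conf_def)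
qed

lemma glauber_exit_identity:
  assumes X: "glauber_dynamics n h \<beta> {} M X" and D: "z \<in> D" "D \<subseteq> Conf n"
    and u: "\<And>x. x \<in> Conf n - D \<Longrightarrow> gen \<beta> u x = 0"
  shows "(\<Sum>z\<in>D. measure M (exit_event M X D z) * u z) * escape_rate \<beta> = (\<Sum>y\<in>Conf n - {{}}. rate \<beta> {} y * u y)"
proof -
  obtain t where "\<forall>x\<in>Conf n. 0 \<le> t x" "\<forall>x\<in>Conf n - D. gen \<beta> t x \<le> -1"
    using drift_function[OF D, of \<beta>] by blast
  note t = this[rule_format]
  have mp: "markov_process M X (Conf n) (rate \<beta>) {}" using X by (simp add: glauber_dynamics_def)
  show ?thesis
    unfolding escape_rate_def
    by (rule exit_identity[OF mp finite_Conf D(2) empty_Conf escape_rate_pos[unfolded escape_rate_def] u t])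
qed

text \<open>The boundary values single out one entrance point.\<close>

lemma glauber_exit_prob:
  assumes X: "glauber_dynamics n h \<beta> {} M X" and D: "z \<in> D" "D \<subseteq> Conf n"
    and u: "\<And>x. x \<in> Conf n - D \<Longrightarrow> gen \<beta> u x = 0"
    and b: "\<And>x. x \<in> D \<Longrightarrow> u x = of_bool (x = z)"
  shows "measure M (exit_event M X D z) * escape_rate \<beta> = (\<Sum>y\<in>Conf n - {{}}. rate \<beta> {} y * u y)"
proof -
  have "finite D" using D(2) finite_Conf finite_subset by blast
  then have "(\<Sum>x\<in>D. measure M (exit_event M X D x) * u x) = measure M (exit_event M X D z)"
    using D(1) b by (subst sum.remove[of D z]) auto
  then show ?thesis using glauber_exit_identity[OF X D u] by simp
qed

lemma harmonic_function:
  assumes "D \<subseteq> Conf n" "\<And>x. x \<in> D \<Longrightarrow> 0 \<le> b x \<and> b x \<le> 1"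
  shows "\<exists>u. (\<forall>x\<in>D. u x = b x) \<and> (\<forall>x\<in>Conf n. 0 \<le> u x \<and> u x \<le> 1) \<and>
    (\<forall>x\<in>Conf n - D. gen \<beta> u x = 0)"
  using exists_harmonic[of "Conf n" D "rate \<beta>" b, OF finite_Conf assms(1) rate_nonneg assms(2)] by metis

lemma automorphism_permutes: "automorphism n g \<Longrightarrow> bij_betw (image g) (Conf n) (Conf n)"
proof (rule bij_betw_byWitness[where f' = "image (inv_into (V n) g)"])
  assume g: "automorphism n g"
  show "\<forall>a\<in>Conf n. inv_into (V n) g ` g ` a = a" "\<forall>a\<in>Conf n. g ` inv_into (V n) g ` a = a"
    using automorphism_image_inverse[OF g] by (simp_all add: Conf_def)
  show "image g ` Conf n \<subseteq> Conf n" "image (inv_into (V n) g) ` Conf n \<subseteq> Conf n"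
    using automorphism_Conf[OF g] automorphism_Conf[OF automorphism_inverse[OF g]] by blast+
qed

lemma automorphism_rate:
  assumes g: "automorphism n g" and xy: "x \<in> Conf n" "y \<in> Conf n"
  shows "rate \<beta> (g ` x) (g ` y) = rate \<beta> x y"
  using automorphism_flip[OF g xy] automorphism_energy[OF g, of x h] automorphism_energy[OF g, of y h] xy
  by (simp add: glauber_rate_def Conf_def)

lemma automorphism_sum:
  assumes g: "automorphism n g" and x: "x \<in> Conf n"
  shows "(\<Sum>y\<in>Conf n - {x}. rate \<beta> x y * f (g ` y)) = (\<Sum>y\<in>Conf n - {g ` x}. rate \<beta> (g ` x) y * f y)"
proof -
  note b = automorphism_permutes[OF g]
  have "bij_betw (image g) (Conf n - {x}) (Conf n - {g ` x})"
    using bij_betw_DiffI[OF b, of "{x}" "{g ` x}"] x automorphism_Conf[OF g x] by (simp add: bij_betw_def)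
  from sum.reindex_bij_betw[OF this, of "\<lambda>y. rate \<beta> (g ` x) y * f y"]
  show ?thesis using automorphism_rate[OF g x] by simp
qed

lemma automorphism_gen_op:
  assumes g: "automorphism n g" and x: "x \<in> Conf n"
  shows "gen \<beta> (\<lambda>y. u (g ` y)) x = gen \<beta> u (g ` x)"
  unfolding gen_op_def using automorphism_sum[OF g x, where f = "\<lambda>y. u y - u (g ` x)"] by simp

text \<open>For two critical configurations take an automorphism \<open>g\<close> mapping one to the other. Composition
with \<open>g\<close> carries the harmonic function of the one to that of the other and does not change the
average over the first jump, because \<open>g\<close> fixes \<open>{}\<close>. The function \<open>1\<close> shows that the probabilities
add up to one.\<close>

lemma entrance_uniform:
  assumes X: "glauber_dynamics n h \<beta> {} M X" and x: "x \<in> crit"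
  shows "measure M (exit_event M X (crit) x) = 1 / real (card (crit))"
proof -
  let ?C = "crit"
  let ?p = "\<lambda>z. measure M (exit_event M X ?C z)"
  have fC: "finite ?C" using critical_set_Conf finite_Conf finite_subset by blast
  obtain u where "\<forall>z\<in>?C. u z = of_bool (z = x)" "\<forall>z\<in>Conf n - ?C. gen \<beta> u z = 0"
    using harmonic_function[OF critical_set_Conf, of "\<lambda>z. of_bool (z = x)" \<beta>] by auto
  note u = this[rule_format]
  have px: "?p x * escape_rate \<beta> = (\<Sum>y\<in>Conf n - {{}}. rate \<beta> {} y * u y)"
    by (rule glauber_exit_prob[OF X x critical_set_Conf u(2,1)])
  have eq: "?p y = ?p x" if y: "y \<in> ?C" for y
  proof -
    obtain g where g: "automorphism n g" "g ` y = x" using critical_transitive[OF y x] by blast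
    have "?p y * escape_rate \<beta> = (\<Sum>z\<in>Conf n - {{}}. rate \<beta> {} z * u (g ` z))"
    proof (rule glauber_exit_prob[OF X y critical_set_Conf])
      fix z assume z: "z \<in> Conf n - ?C"
      have "g ` z \<notin> ?C"
      proof
        assume "g ` z \<in> ?C"
        then have "inv_into (V n) g ` g ` z \<in> ?C" by (rule automorphism_critical[OF automorphism_inverse[OF g(1)]])
        then show False using automorphism_image_inverse(1)[OF g(1), of z] z by (simp add: Conf_def)
      qed
      then have "gen \<beta> u (g ` z) = 0" using u(2) automorphism_Conf[OF g(1)] z by blast
      then show "gen \<beta> (\<lambda>y. u (g ` y)) z = 0" using automorphism_gen_op[OF g(1), of z \<beta> u] z by simp
    next
      fix z assume z: "z \<in> ?C"
      have "g ` z = x \<longleftrightarrow> z = y"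
        using bij_betw_imp_inj_on[OF automorphism_permutes[OF g(1)]] critical_set_Conf z y g(2) unfolding inj_on_def by blast
      then show "u (g ` z) = of_bool (z = y)" using u(1) automorphism_critical[OF g(1) z] by simp
    qed
    also have "\<dots> = ?p x * escape_rate \<beta>"
      using automorphism_sum[OF g(1) empty_Conf, of \<beta> u] px by simp
    finally show ?thesis using escape_rate_pos[of \<beta>] by simp
  qed
  have "(\<Sum>z\<in>?C. ?p z * 1) * escape_rate \<beta> = (\<Sum>y\<in>Conf n - {{}}. rate \<beta> {} y * 1)"
    by (rule glauber_exit_identity[OF X x critical_set_Conf]) (simp add: gen_op_def)
  then have "(\<Sum>z\<in>?C. ?p z) = 1" using escape_rate_pos[of \<beta>] by (simp add: escape_rate_def)
  moreover have "(\<Sum>z\<in>?C. ?p z) = real (card ?C) * ?p x" using eq by simp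
  ultimately have e: "?p x * real (card ?C) = 1" by (simp only: mult.commute)
  then have "real (card ?C) \<noteq> 0" by (intro notI) simp
  then show ?thesis using e by (rule eq_divide_imp)
qed

definition excited :: "config set" where
  "excited = {x \<in> Conf n. barrier < energy_h x}"

text \<open>On the set \<open>R\<close> of configurations that \<open>{}\<close> reaches at or below the barrier without critical ones,
compare \<open>w\<close> with \<open>v\<close>. Leaving \<open>R\<close> means becoming critical, where \<open>w\<close> vanishes, or excited, where \<open>v\<close>
is one. Since \<open>V n\<close> is not in \<open>R\<close>, the difference \<open>w - v\<close> is at most zero on \<open>R\<close> by the maximum
principle.\<close>

lemma avoiding_flux_le:
  assumes w: "\<And>x. x \<in> Conf n - insert (V n) (insert {} (crit)) \<Longrightarrow> gen \<beta> w x = 0"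
      "\<And>x. x \<in> Conf n \<Longrightarrow> w x \<le> 1" "w {} = 0" "\<And>x. x \<in> crit \<Longrightarrow> w x = 0"
    and v: "\<And>x. x \<in> Conf n - insert {} excited \<Longrightarrow> gen \<beta> v x = 0"
      "\<And>x. x \<in> Conf n \<Longrightarrow> 0 \<le> v x" "v {} = 0" "\<And>x. x \<in> excited \<Longrightarrow> v x = 1"
  shows "gen \<beta> w {} \<le> gen \<beta> v {}"
proof -
  let ?W = "sublevel barrier - crit"
  define R where "R = {x. joined ?W {} x}"
  have R_W: "R \<subseteq> ?W" using joined_in by (auto simp: R_def)
  then have R_Conf: "R \<subseteq> Conf n" using sublevel_Conf by blast
  have VR: "V n \<notin> R" using critical_set_separates by (simp add: R_def)
  have "{} \<in> ?W" using energy_empty_less_barrier empty_not_critical by (simp add: sublevel_def empty_Conf)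
  then have ER: "{} \<in> R" unfolding R_def by (simp add: joined_refl)
  have out: "w y \<le> v y" if xy: "x \<in> R" "flip x y" "y \<in> Conf n" "y \<notin> R" for x y
  proof -
    have "y \<notin> ?W" using joined_step[of ?W "{}" x y] xy by (auto simp: R_def)
    then consider "y \<in> crit" | "y \<in> excited" using xy(3) by (auto simp: sublevel_def excited_def)
    then show ?thesis
    proof cases
      case 1
      then show ?thesis using w(4) v(2)[OF xy(3)] by simp
    next
      case 2
      then show ?thesis using v(4) w(2)[OF xy(3)] by simp
    qed
  qed
  define D where "D = Conf n - (R - {{}})"
  \<comment> \<open>cut off outside \<open>R\<close>, where \<open>w - v\<close> may be positive; next to \<open>R\<close> the cut-off only increases it\<close>
  define f where "f x = (if x \<in> R then w x - v x else 0)" for x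
  have VD: "V n \<in> D" "D \<subseteq> Conf n" using VR V_Conf by (auto simp: D_def)
  obtain t where "\<forall>x\<in>Conf n. 0 \<le> t x" "\<forall>x\<in>Conf n - D. gen \<beta> t x \<le> -1"
    using drift_function[OF VD, of \<beta>] by blast
  note t = this[rule_format]
  have f_le: "f x \<le> 0" if "x \<in> Conf n" for x
  proof (rule maximum_principle[OF finite_Conf VD(2) rate_nonneg t _ _ that])
    fix x assume "x \<in> Conf n - D"
    then have x: "x \<in> R" "x \<noteq> {}" by (auto simp: D_def)
    then have xS: "x \<in> Conf n - insert (V n) (insert {} (crit))" "x \<in> Conf n - insert {} excited"
      using R_W VR by (auto simp: sublevel_def excited_def)
    have "0 = gen \<beta> w x - gen \<beta> v x" using w(1)[OF xS(1)] v(1)[OF xS(2)] by simp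
    also have "\<dots> = (\<Sum>y\<in>Conf n - {x}. rate \<beta> x y * ((w y - v y) - (w x - v x)))"
      unfolding gen_op_def sum_subtractf[symmetric] by (intro sum.cong refl) (simp add: algebra_simps)
    also have "\<dots> \<le> (\<Sum>y\<in>Conf n - {x}. rate \<beta> x y * (f y - f x))"
    proof (rule sum_mono)
      fix y assume y: "y \<in> Conf n - {x}"
      show "rate \<beta> x y * ((w y - v y) - (w x - v x)) \<le> rate \<beta> x y * (f y - f x)"
      proof (cases "flip x y")
        case True
        then have "w y - v y \<le> f y" using out[OF x(1) True] y by (auto simp: f_def)
        then show ?thesis using x(1) rate_nonneg by (intro mult_left_mono) (simp_all add: f_def)
      qed (simp add: glauber_rate_def)
    qed
    finally show "0 \<le> gen \<beta> f x" by (simp add: gen_op_def)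
  next
    fix x assume "x \<in> D"
    then show "f x \<le> 0" using w(3) v(3) by (auto simp: D_def f_def)
  qed auto
  have le: "w y \<le> v y" if "flip {} y" "y \<in> Conf n" for y
  proof (cases "y \<in> R")
    case True
    then show ?thesis using f_le[OF that(2)] by (simp add: f_def)
  qed (use out[OF ER] that in blast)
  show ?thesis
    unfolding gen_op_def
  proof (rule sum_mono)
    fix y assume y: "y \<in> Conf n - {{}}"
    show "rate \<beta> {} y * (w y - w {}) \<le> rate \<beta> {} y * (v y - v {})"
    proof (cases "flip {} y")
      case True
      then show ?thesis using le[of y] y w(3) v(3) rate_nonneg by (intro mult_left_mono) auto
    qed (simp add: glauber_rate_def)
  qed
qed

text \<open>Given a crossing, the conditional probability of avoiding the critical set is a quotient of two
fluxes out of \<open>{}\<close>. The numerator is bounded through \<open>avoiding_flux_le\<close> by the weight of the excited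
configurations, and the denominator from below by the conductance of a path of minimal height; its
length is independent of \<open>\<beta>\<close>.\<close>

lemma crossing_estimate:
  obtains K where "\<And>\<beta> (M :: 'w measure) X. \<lbrakk>0 \<le> \<beta>; glauber_dynamics n h \<beta> {} M X\<rbrakk> \<Longrightarrow>
    \<bar>\<P>(\<omega> in M. hitting_time X (crit) \<omega> < hitting_time X {V n} \<omega> \<bar>
         hitting_time X {V n} \<omega> < hitting_time X {{}} \<omega>) - 1\<bar>
      \<le> K * (\<Sum>x\<in>excited. exp (- \<beta> * (energy_h x - barrier)))"
proof -
  let ?C = "crit"
  obtain p where p: "is_path n p {} (V n)" "set p \<subseteq> sublevel barrier"
    using joined_barrier path_iff_joined[OF sublevel_Conf] by blast
  define l where "l = real (length p)"
  have l: "0 < l" using p by (simp add: l_def is_path_def)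
  define K where "K = real (card (Conf n)) * (2 * l\<^sup>2)"
  have EV: "{} \<noteq> V n" using card_V[of n] by auto
  have fin_exc: "finite excited" using finite_Conf by (simp add: excited_def)
  show thesis
  proof (rule that[of K])
    fix \<beta> and M :: "'w measure" and X
    assume b: "0 \<le> \<beta>" and X: "glauber_dynamics n h \<beta> {} M X"
    have mp: "markov_process M X (Conf n) (rate \<beta>) {}" using X by (simp add: glauber_dynamics_def)
    interpret prob_space M using mp by (simp add: markov_process_def)
    let ?G = "gen \<beta>"
    have D1: "V n \<in> {V n, {}}" "{V n, {}} \<subseteq> Conf n" by (simp_all add: V_Conf empty_Conf)
    have D2: "V n \<in> insert (V n) (insert {} ?C)" "insert (V n) (insert {} ?C) \<subseteq> Conf n"
      using critical_set_Conf by (simp_all add: V_Conf empty_Conf)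
    have D3: "insert {} excited \<subseteq> Conf n" by (auto simp: excited_def empty_Conf)
    obtain u where "\<forall>x\<in>{V n, {}}. u x = of_bool (x = V n)" "\<forall>x\<in>Conf n - {V n, {}}. ?G u x = 0"
      using harmonic_function[OF D1(2), of "\<lambda>x. of_bool (x = V n)" \<beta>] by auto
    note u = this[rule_format]
    obtain w where "\<forall>x\<in>insert (V n) (insert {} ?C). w x = of_bool (x = V n)" "\<forall>x\<in>Conf n. 0 \<le> w x \<and> w x \<le> 1"
        "\<forall>x\<in>Conf n - insert (V n) (insert {} ?C). ?G w x = 0"
      using harmonic_function[OF D2(2), of "\<lambda>x. of_bool (x = V n)" \<beta>] by auto
    note w = this[rule_format]
    obtain v where "\<forall>x\<in>insert {} excited. v x = of_bool (x \<noteq> {})" "\<forall>x\<in>Conf n. 0 \<le> v x \<and> v x \<le> 1"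
        "\<forall>x\<in>Conf n - insert {} excited. ?G v x = 0"
      using harmonic_function[OF D3, of "\<lambda>x. of_bool (x \<noteq> {})" \<beta>] by auto
    note v = this[rule_format]
    have e_exc: "{} \<notin> excited" using energy_empty_less_barrier by (simp add: excited_def)
    have u0: "u {} = 0" "u (V n) = 1" using u(1) EV by simp_all
    have w0: "w {} = 0" "\<And>x. x \<in> ?C \<Longrightarrow> w x = 0" using w(1) EV full_not_critical by auto
    have v0: "v {} = 0" "\<And>x. x \<in> excited \<Longrightarrow> v x = 1" using v(1) e_exc by auto
    \<comment> \<open>the crossings, and the crossings that avoid the critical set, as exit events\<close>
    define cross where "cross = exit_event M X {V n, {}} (V n)"
    define avoid where "avoid = exit_event M X (insert (V n) (insert {} ?C)) (V n)"
    have pu: "prob cross * escape_rate \<beta> = ?G u {}"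
      using glauber_exit_prob[OF X D1 u(2,1)] u0 by (simp add: cross_def gen_op_def)
    have pw: "prob avoid * escape_rate \<beta> = ?G w {}"
      using glauber_exit_prob[OF X D2 w(3,1)] w0 by (simp add: avoid_def gen_op_def)
    have wv: "?G w {} \<le> ?G v {}"
      by (rule avoiding_flux_le) (use w w0 v v0 in auto)
    have lower: "exp (- \<beta> * barrier) / (2 * l\<^sup>2) \<le> gibbs \<beta> {} * ?G u {}"
      unfolding l_def
    proof (rule flux_lower_bound[where b = "V n" and p = p])
      show "successively (\<lambda>x y. exp (- \<beta> * barrier) \<le> gibbs \<beta> x * rate \<beta> x y) p"
      proof (rule successively_mono)
        show "successively flip p" using p by (simp add: is_path_def)
        fix x y assume xy: "x \<in> set p" "y \<in> set p" "flip x y"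
        then have "max (energy_h x) (energy_h y) \<le> barrier" using p(2) by (auto simp: sublevel_def)
        then have "\<beta> * max (energy_h x) (energy_h y) \<le> \<beta> * barrier" using b by (rule mult_left_mono)
        then show "exp (- \<beta> * barrier) \<le> gibbs \<beta> x * rate \<beta> x y" unfolding gibbs_rate[OF xy(3)] by simp
      qed
      show "?G u x = 0" if "x \<in> Conf n - {{}, V n}" for x using u(2)[of x] that by blast
      show "gibbs \<beta> x * rate \<beta> x y = gibbs \<beta> y * rate \<beta> y x" for x y by (rule gibbs_reversible)
      show "set p \<subseteq> Conf n" "p \<noteq> []" "hd p = {}" "last p = V n" using p(1) by (simp_all add: is_path_def)
      show "0 \<le> gibbs \<beta> x" for x by (simp add: gibbs_def)
    qed (simp_all add: EV u0 finite_Conf rate_nonneg empty_Conf V_Conf)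
    have upper: "gibbs \<beta> {} * ?G v {} \<le> real (card (Conf n)) * (\<Sum>x\<in>excited. exp (- \<beta> * energy_h x))"
    proof -
      have "gibbs \<beta> {} * ?G v {} \<le> (\<Sum>x\<in>excited. \<Sum>y\<in>Conf n. gibbs \<beta> x * rate \<beta> x y)"
        by (rule flux_upper_bound[OF finite_Conf gibbs_reversible rate_nonneg])
          (use v v0 e_exc D3 in \<open>auto simp: gibbs_def empty_Conf\<close>)
      also have "\<dots> \<le> (\<Sum>x\<in>excited. \<Sum>y\<in>Conf n. gibbs \<beta> x * 1)"
        by (intro sum_mono mult_left_mono rate_le_1 b) (simp add: gibbs_def)
      also have "\<dots> = real (card (Conf n)) * (\<Sum>x\<in>excited. exp (- \<beta> * energy_h x))"
        by (simp add: gibbs_def sum_distrib_left)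
      finally show ?thesis .
    qed
    have g0: "0 < gibbs \<beta> {}" by (simp add: gibbs_def)
    have low0: "0 < exp (- \<beta> * barrier) / (2 * l\<^sup>2)" using l by simp
    have Gu: "0 < ?G u {}" using lower low0 g0 by (metis less_le_trans zero_less_mult_pos)
    have cross_pos: "0 < prob cross" using pu Gu escape_rate_pos[of \<beta>] by (metis zero_less_mult_pos2)
    have "prob avoid / prob cross = (prob avoid * escape_rate \<beta>) / (prob cross * escape_rate \<beta>)"
      using escape_rate_pos[of \<beta>] by simp
    also have "\<dots> = (gibbs \<beta> {} * ?G w {}) / (gibbs \<beta> {} * ?G u {})" unfolding pu pw using g0 by simp
    also have "\<dots> \<le> (real (card (Conf n)) * (\<Sum>x\<in>excited. exp (- \<beta> * energy_h x))) / (exp (- \<beta> * barrier) / (2 * l\<^sup>2))"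
    proof (rule frac_le[OF _ _ low0 lower])
      show "gibbs \<beta> {} * ?G w {} \<le> real (card (Conf n)) * (\<Sum>x\<in>excited. exp (- \<beta> * energy_h x))"
        using mult_left_mono[OF wv, of "gibbs \<beta> {}"] g0 upper by linarith
      show "0 \<le> real (card (Conf n)) * (\<Sum>x\<in>excited. exp (- \<beta> * energy_h x))" by (simp add: sum_nonneg)
    qed
    also have "\<dots> = K * ((\<Sum>x\<in>excited. exp (- \<beta> * energy_h x)) / exp (- \<beta> * barrier))"
      by (simp add: K_def)
    also have "(\<Sum>x\<in>excited. exp (- \<beta> * energy_h x)) / exp (- \<beta> * barrier) = (\<Sum>x\<in>excited. exp (- \<beta> * (energy_h x - barrier)))"
      unfolding sum_divide_distrib by (intro sum.cong refl) (simp add: exp_diff[symmetric] algebra_simps)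
    finally have ratio: "prob avoid / prob cross \<le> K * (\<Sum>x\<in>excited. exp (- \<beta> * (energy_h x - barrier)))" .
    have cross_eq: "cross = {\<omega>\<in>space M. hitting_time X {V n} \<omega> < hitting_time X {{}} \<omega>}"
      unfolding cross_def by (rule exit_event_eq_less[OF mp]) (use EV in simp)
    have avoid_eq: "avoid = {\<omega>\<in>space M. hitting_time X {V n} \<omega> < hitting_time X (insert {} ?C) \<omega>}"
      unfolding avoid_def by (rule exit_event_eq_less[OF mp]) (use EV full_not_critical in simp)
    have both: "{\<omega>\<in>space M. hitting_time X ?C \<omega> < hitting_time X {V n} \<omega> \<and> hitting_time X {V n} \<omega> < hitting_time X {{}} \<omega>}
        = cross - avoid"
    proof -
      have "hitting_time X ?C \<omega> < hitting_time X {V n} \<omega> \<longleftrightarrow> \<not> hitting_time X {V n} \<omega> < hitting_time X (insert {} ?C) \<omega>"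
        if w: "\<omega> \<in> space M" and less: "hitting_time X {V n} \<omega> < hitting_time X {{}} \<omega>" for \<omega>
      proof -
        have "hitting_time X {V n} \<omega> \<noteq> hitting_time X ?C \<omega>"
          by (rule hitting_times_differ[of X \<omega> "{V n}" ?C, OF markov_process_right_const[OF mp w]])
            (use full_not_critical less in auto)
        moreover have "hitting_time X (insert {} ?C) \<omega> = min (hitting_time X {{}} \<omega>) (hitting_time X ?C \<omega>)"
          using hitting_time_Un[of X "{{}}" ?C \<omega>] by simp
        ultimately show ?thesis using less by (auto simp: min_def not_less order.order_iff_strict)
      qed
      then show ?thesis unfolding cross_eq avoid_eq by blast
    qed
    have sets: "cross \<in> events" "avoid \<in> events"
      unfolding cross_def avoid_def
      by (rule exit_event_sets[OF mp finite_Conf _ empty_Conf], use D1 D2 in simp_all)+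
    have "avoid \<subseteq> cross"
      unfolding cross_eq avoid_eq using hitting_time_Un[of X "{{}}" ?C] by auto
    then have "prob (cross - avoid) = prob cross - prob avoid"
      using sets by (intro finite_measure_Diff)
    then have "\<P>(\<omega> in M. hitting_time X ?C \<omega> < hitting_time X {V n} \<omega> \<bar>
         hitting_time X {V n} \<omega> < hitting_time X {{}} \<omega>) = 1 - prob avoid / prob cross"
      unfolding cond_prob_def both cross_eq[symmetric] using cross_pos by (simp add: diff_divide_distrib)
    then show "\<bar>\<P>(\<omega> in M. hitting_time X ?C \<omega> < hitting_time X {V n} \<omega> \<bar>
         hitting_time X {V n} \<omega> < hitting_time X {{}} \<omega>) - 1\<bar> \<le> K * (\<Sum>x\<in>excited. exp (- \<beta> * (energy_h x - barrier)))"
      using ratio by simp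
  qed
qed

lemma excited_sum_tendsto: "((\<lambda>\<beta>. K * (\<Sum>x\<in>excited. exp (- \<beta> * (energy_h x - barrier)))) \<longlongrightarrow> 0) at_top"
proof -
  have "((\<lambda>\<beta>. exp (- \<beta> * (energy_h x - barrier))) \<longlongrightarrow> 0) at_top" if "x \<in> excited" for x
  proof -
    have d: "0 < energy_h x - barrier" using that by (simp add: excited_def)
    have "filterlim (\<lambda>\<beta>. \<beta> * (energy_h x - barrier)) at_top at_top"
      using filterlim_at_top_mult_tendsto_pos[OF tendsto_const d filterlim_ident] .
    then have "filterlim (\<lambda>\<beta>. - (\<beta> * (energy_h x - barrier))) at_bot at_top" by (rule filterlim_uminus_at_top[THEN iffD1])
    then show ?thesis using filterlim_compose[OF exp_at_bot] by fastforce
  qed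
  then have "((\<lambda>\<beta>. K * (\<Sum>x\<in>excited. exp (- \<beta> * (energy_h x - barrier)))) \<longlongrightarrow> K * (\<Sum>x\<in>excited. 0)) at_top"
    by (intro tendsto_intros)
  then show ?thesis by simp
qed

end

theorem theorem4:
  fixes n :: nat and h :: real
    and M :: "real \<Rightarrow> 'w measure" and X :: "real \<Rightarrow> real \<Rightarrow> 'w \<Rightarrow> config"
  assumes field: "admissible_field n h"
    and glauber: "\<And>\<beta>. 0 \<le> \<beta> \<Longrightarrow> glauber_dynamics n h \<beta> {} (M \<beta>) (X \<beta>)"
  shows "((\<lambda>\<beta>. \<P>(\<omega> in M \<beta>.
            hitting_time (X \<beta>) (critical_set n h) \<omega> < hitting_time (X \<beta>) {V n} \<omega> \<bar>
            hitting_time (X \<beta>) {V n} \<omega> < hitting_time (X \<beta>) {{}} \<omega>)) \<longlongrightarrow> 1) at_top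
    \<and> (\<forall>x\<in>critical_set n h.
         ((\<lambda>\<beta>. \<P>(\<omega> in M \<beta>.
            hitting_time (X \<beta>) (critical_set n h) \<omega> < \<infinity> \<and>
            X \<beta> (real_of_ereal (hitting_time (X \<beta>) (critical_set n h) \<omega>)) \<omega> = x))
          \<longlongrightarrow> 1 / real (card (critical_set n h))) at_top)"
proof (intro conjI ballI)
  interpret ising_cube n h by unfold_locales (rule field)
  obtain K where K: "\<And>\<beta> (M :: 'w measure) X. \<lbrakk>0 \<le> \<beta>; glauber_dynamics n h \<beta> {} M X\<rbrakk> \<Longrightarrow>
    \<bar>\<P>(\<omega> in M. hitting_time X (critical_set n h) \<omega> < hitting_time X {V n} \<omega> \<bar>
         hitting_time X {V n} \<omega> < hitting_time X {{}} \<omega>) - 1\<bar>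
      \<le> K * (\<Sum>x\<in>excited. exp (- \<beta> * (energy n h x - barrier)))"
    using crossing_estimate by blast
  let ?P = "\<lambda>\<beta>. \<P>(\<omega> in M \<beta>.
            hitting_time (X \<beta>) (critical_set n h) \<omega> < hitting_time (X \<beta>) {V n} \<omega> \<bar>
            hitting_time (X \<beta>) {V n} \<omega> < hitting_time (X \<beta>) {{}} \<omega>)"
  have "\<forall>\<^sub>F \<beta> in at_top. norm (?P \<beta> - 1) \<le> K * (\<Sum>x\<in>excited. exp (- \<beta> * (energy n h x - barrier)))"
    using eventually_ge_at_top[of 0]
  proof eventually_elim
    case (elim \<beta>)
    then show ?case using K[OF elim glauber[OF elim]] by simp
  qed
  then have "((\<lambda>\<beta>. ?P \<beta> - 1) \<longlongrightarrow> 0) at_top"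
    using excited_sum_tendsto by (rule Lim_null_comparison)
  then show "(?P \<longlongrightarrow> 1) at_top" by (simp only: LIM_zero_iff)
  fix x assume x: "x \<in> critical_set n h"
  have "\<forall>\<^sub>F \<beta> in at_top. 1 / real (card (critical_set n h)) = \<P>(\<omega> in M \<beta>.
            hitting_time (X \<beta>) (critical_set n h) \<omega> < \<infinity> \<and>
            X \<beta> (real_of_ereal (hitting_time (X \<beta>) (critical_set n h) \<omega>)) \<omega> = x)"
    using eventually_ge_at_top[of 0]
  proof eventually_elim
    case (elim \<beta>)
    show ?case using entrance_uniform[OF glauber[OF elim] x] unfolding exit_event_def by (rule sym)
  qed
  then show "((\<lambda>\<beta>. \<P>(\<omega> in M \<beta>.
            hitting_time (X \<beta>) (critical_set n h) \<omega> < \<infinity> \<and>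
            X \<beta> (real_of_ereal (hitting_time (X \<beta>) (critical_set n h) \<omega>)) \<omega> = x))
          \<longlongrightarrow> 1 / real (card (critical_set n h))) at_top"
    by (rule Lim_transform_eventually[OF tendsto_const])
qed

end
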